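(* Let $2\le r<s\le 14$ be integers, write $s=pr+q$ with $0\le q<r$, and let $t=t(s,r)$ and $v=v(s,r)$ be given by the following list, where an entry "$(s,r):\ t;\ v$" gives the values for $T(s,r)$. $(3,2): 2; \frac{3}{4}$. $(4,2): 2; \frac{3}{8}$. $(4,3): 5; \frac{72}{125}$. $(5,2): 2; \frac{5}{8}$. $(5,3): 3; \frac{10}{27}$. $(5,4): 8; \frac{525}{1024}$. $(6,2): 2; \frac{5}{16}$. $(6,3): 3; \frac{10}{81}$. $(6,4): 6; \frac{25}{72}$. $(6,5): 13; \frac{178200}{371293}$. $(7,2): 2; \frac{35}{64}$. $(7,3): 3; \frac{70}{243}$. $(7,4): 5; \frac{504}{3125}$. $(7,5): 8; \frac{11025}{32768}$. $(7,6): 19; \frac{21591360}{47045881}$. $(8,2): 2; \frac{35}{128}$. $(8,3): 3; \frac{560}{2187}$. $(8,4): 4; \frac{315}{8192}$. $(8,5): 7; \frac{21600}{117649}$. $(8,6): 11; \frac{6350400}{19487171}$. $(8,7): 25; \frac{542691072}{1220703125}$. $(9,2): 2; \frac{63}{128}$. $(9,3): 3; \frac{560}{6561}$. $(9,4): 4; \frac{945}{8192}$. $(9,5): 6; \frac{175}{2592}$. $(9,6): 9; \frac{313600}{1594323}$. $(9,7): 15; \frac{224224}{703125}$. $(9,8): 33; \frac{837724160}{1929229929}$. $(10,2): 2; \frac{63}{256}$. $(10,3): 3; \frac{1400}{6561}$. $(10,4): 4; \frac{4725}{32768}$. $(10,5): 5; \frac{4536}{390625}$. $(10,6): 8; \frac{1488375}{16777216}$.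 $(10,7): 12; \frac{67375}{331776}$. $(10,8): 19; \frac{101047564800}{322687697779}$. $(10,9): 42; \frac{796235375}{1867795524}$. $(11,2): 2; \frac{231}{512}$. $(11,3): 3; \frac{3850}{19683}$. $(11,4): 4; \frac{5775}{65536}$. $(11,5): 5; \frac{16632}{390625}$. $(11,6): 7; \frac{1069200}{40353607}$. $(11,7): 10; \frac{130977}{1250000}$. $(11,8): 15; \frac{19731712}{94921875}$. $(11,9): 24; \frac{157309075}{509607936}$. $(11,10): 51; \frac{617338863680000}{1469659553427321}$. $(12,2): 2; \frac{231}{1024}$. $(12,3): 3; \frac{3850}{59049}$. $(12,4): 4; \frac{5775}{262144}$. $(12,5): 5; \frac{133056}{1953125}$. $(12,6): 7; \frac{1069200}{282475249}$. $(12,7): 9; \frac{1724800}{43046721}$. $(12,8): 12; \frac{3705625}{31850496}$. $(12,9): 18; \frac{163788625}{774840978}$. $(12,10): 29; \frac{3721968169920000}{12200509765705829}$. $(12,11): 62; \frac{21091312901233575}{50816953792809662}$. $(13,2): 2; \frac{429}{1024}$. $(13,3): 3; \frac{10010}{59049}$. $(13,4): 4; \frac{75075}{1048576}$. $(13,5): 5; \frac{576576}{9765625}$. $(13,6): 6; \frac{25025}{1679616}$. $(13,7): 8; \frac{42567525}{4294967296}$. $(13,8): 11; \frac{14859936000}{285311670611}$. $(13,9): 15; \frac{897792896}{7119140625}$. $(13,10): 22; \frac{243737778375}{1141246682444}$. $(13,11): 35; \frac{233296472927232}{772393258984375}$. $(13,12): 74; \frac{2704936173225986700}{6582952005840035281}$.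 $(14,2): 2; \frac{429}{2048}$. $(14,3): 3; \frac{28028}{177147}$. $(14,4): 4; \frac{1576575}{16777216}$. $(14,5): 5; \frac{1345344}{48828125}$. $(14,6): 6; \frac{875875}{30233088}$. $(14,7): 8; \frac{42567525}{34359738368}$. $(14,8): 10; \frac{107270163}{6250000000}$. $(14,9): 13; \frac{1452272976000}{23298085122481}$. $(14,10): 18; \frac{14904764875}{111577100832}$. $(14,11): 26; \frac{20068705243125}{93192340489924}$. $(14,12): 41; \frac{277115986307736576000}{925103102315013629321}$. $(14,13): 86; \frac{2800242205096869658125}{6873056497129163140972}$. Then $i(T(s,r))=v$, and it is uniquely attained by $W[\frac1t,\ldots,\frac1t]$ (with $t$ parts). Moreover, for every integer $k\ge 2$: (a) if $k\le r$, then $i_k(T(s,r))=0$; (b) if $r<k\le t$, then $i_k(T(s,r))$ is uniquely attained by $W[\frac1{k-1},\ldots,\frac1{k-1}]$ (with $k-1$ parts), and, with $\ell=k-1$, $i_k(T(s,r))=\dfrac{\ell!\,s!}{(\ell-r)!\,(r-q)!\,q!\,(p!)^r\,(p+1)^q\,\ell^{s}}$; (c) if $k>t$, then $i_k(T(s,r))=v$ and it is uniquely attained by $W[\frac1t,\ldots,\frac1t]$ (with $t$ parts).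
   Context: All graphs are finite and simple. $T(s,r)$ is the Turán graph: the complete $r$-partite graph on $s$ vertices whose part sizes differ by at most one. For graphs $F,G$, $P(F,G)$ is the number of $|V(F)|$-subsets of $V(G)$ inducing a subgraph isomorphic to $F$, and $p(F,G)=P(F,G)/\binom{|V(G)|}{|V(F)|}$. $i(F,n)$ is the maximum of $p(F,G)$ over all $n$-vertex graphs $G$, and $i_k(F,n)$ is the maximum over all $n$-vertex graphs not containing $K_k$ as a subgraph; $i(F)=\lim_{n\to\infty}i(F,n)$ and $i_k(F)=\lim_{n\to\infty}i_k(F,n)$ (the limits exist). For $x_1,\ldots,x_m>0$ with $\sum x_i=1$, the complete $m$-partite graphon $W[x_1,\ldots,x_m]:[0,1]^2\to\{0,1\}$ is obtained by partitioning $[0,1]$ into intervals of lengths $x_1,\ldots,x_m$ and setting $W(x,y)=1$ iff $x,y$ lie in distinct intervals. The induced density of $F$ in $W$ is the probability that $|V(F)|$ independent uniform points of $[0,1]$ induce a copy of $F$, where distinct $u,v$ are adjacent iff $W(u,v)=1$. $i_k(F)$ (respectively $i(F)$) is attained by $W$ if the induced density of $F$ in $W$ equals $i_k(F)$ (respectively $i(F)$). "Uniquely attained" means that it is the only one, up to reordering the parts, among complete $m$-partite graphons with $m<k$ (for $i_k$), respectively among complete $m$-partite graphons with $m$ an arbitrary positive integer (for $i$). *)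

theory Defs
  imports
    "Graph_Theory.Graph_Theory"
    "HOL-Probability.Probability"
begin

text \<open>
  Finite simple graphs are the symmetric loop-free digraphs without parallel arcs of locale
  \<^locale>\<open>pair_graph\<close>: an edge is represented by its two orientations. On such graphs
  \<^const>\<open>digraph_iso\<close> is graph isomorphism:
\<close>

lemma digraph_iso_pair_graph_iff:
  fixes F :: "'a pair_pre_digraph" and G :: "'b pair_pre_digraph"
  assumes "pair_graph F" "pair_graph G"
  shows "digraph_iso (with_proj F) (with_proj G) \<longleftrightarrow>
    (\<exists>f. bij_betw f (pverts F) (pverts G) \<and>
         (\<forall>u\<in>pverts F. \<forall>v\<in>pverts F. (u, v) \<in> parcs F \<longleftrightarrow> (f u, f v) \<in> parcs G))"
    (is "?L \<longleftrightarrow> ?R")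
proof -
  interpret F: pair_graph F by fact
  interpret G: pair_graph G by fact
  show ?thesis
  proof
    assume ?L
    then obtain h where h: "pre_digraph.digraph_isomorphism (with_proj F) h"
      and G: "with_proj G = app_iso h (with_proj F)"
      by (auto simp: digraph_iso_def)
    let ?f = "iso_verts h"
    have tl: "iso_tail h = fst" and hd: "iso_head h = snd"
      using arg_cong[OF G, of tail] arg_cong[OF G, of head] by simp_all
    have vs: "pverts G = ?f ` pverts F" and as: "parcs G = iso_arcs h ` parcs F"
      using arg_cong[OF G, of verts] arg_cong[OF G, of arcs] by simp_all
    have inj: "inj_on ?f (pverts F)"
      using h by (simp add: pre_digraph.digraph_isomorphism_def)
    have ar: "iso_arcs h e = (?f (fst e), ?f (snd e))" if "e \<in> parcs F" for e
      using h that by (auto simp: pre_digraph.digraph_isomorphism_def tl hd prod_eq_iff)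
    have "(u, v) \<in> parcs F \<longleftrightarrow> (?f u, ?f v) \<in> parcs G"
      if uv: "u \<in> pverts F" "v \<in> pverts F" for u v
    proof
      assume "(u, v) \<in> parcs F"
      then show "(?f u, ?f v) \<in> parcs G" using ar[of "(u, v)"] as by force
    next
      assume "(?f u, ?f v) \<in> parcs G"
      then obtain e where e: "e \<in> parcs F" "iso_arcs h e = (?f u, ?f v)" using as by auto
      then have "?f (fst e) = ?f u" "?f (snd e) = ?f v" using ar by auto
      moreover have "fst e \<in> pverts F" "snd e \<in> pverts F"
        using e F.arc_fst_in_verts F.arc_snd_in_verts by auto
      ultimately have "fst e = u" "snd e = v" using inj uv by (auto dest: inj_onD)
      then show "(u, v) \<in> parcs F" using e by auto
    qed
    then show ?R using inj vs by (auto simp: bij_betw_def)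
  next
    assume ?R
    then obtain f where bij: "bij_betw f (pverts F) (pverts G)"
      and f: "\<And>u v. u \<in> pverts F \<Longrightarrow> v \<in> pverts F \<Longrightarrow> (u, v) \<in> parcs F \<longleftrightarrow> (f u, f v) \<in> parcs G"
      by blast
    let ?h = "\<lparr>iso_verts = f, iso_arcs = map_prod f f, iso_head = snd, iso_tail = fst\<rparr>"
    have inj: "inj_on f (pverts F)" and vs: "pverts G = f ` pverts F"
      using bij by (auto simp: bij_betw_def)
    have sub: "parcs F \<subseteq> pverts F \<times> pverts F" by (auto dest: F.in_arcsD1 F.in_arcsD2)
    have "inj_on (map_prod f f) (parcs F)"
      using map_prod_inj_on[OF inj inj] sub by (rule inj_on_subset)
    then have iso: "pre_digraph.digraph_isomorphism (with_proj F) ?h"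
      using inj F.wf_digraph by (auto simp: pre_digraph.digraph_isomorphism_def)
    have "parcs G = map_prod f f ` parcs F"
    proof (intro equalityI subsetI)
      fix e assume e: "e \<in> parcs G"
      then have "fst e \<in> f ` pverts F" "snd e \<in> f ` pverts F"
        using vs G.arc_fst_in_verts G.arc_snd_in_verts by blast+
      then obtain u v where "u \<in> pverts F" "v \<in> pverts F" "e = (f u, f v)"
        by (auto simp: prod_eq_iff)
      then show "e \<in> map_prod f f ` parcs F" using e f by force
    next
      fix e assume "e \<in> map_prod f f ` parcs F"
      then show "e \<in> parcs G" using f sub by auto
    qed
    then have "with_proj G = app_iso ?h (with_proj F)"
      using vs by (simp add: with_proj_def app_iso_def)
    with iso show ?L by (auto simp: digraph_iso_def)
  qed
qed

definition is_turan_graph :: "nat \<Rightarrow> nat \<Rightarrow> 'a pair_pre_digraph \<Rightarrow> bool" where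
  "is_turan_graph s r F \<longleftrightarrow>
     pair_graph F \<and> card (pverts F) = s \<and>
     (\<exists>\<A>. partition_on (pverts F) \<A> \<and> card \<A> = r \<and>
        parcs F = {(u, v). \<exists>A\<in>\<A>. \<exists>B\<in>\<A>. A \<noteq> B \<and> u \<in> A \<and> v \<in> B} \<and>
        (\<forall>A\<in>\<A>. \<forall>B\<in>\<A>. card A \<le> card B + 1))"

lemma is_turan_graph_mod:
  assumes "0 < r" "r \<le> s"
  shows "is_turan_graph s r
    \<lparr>pverts = {..<s}, parcs = {(u, v). u < s \<and> v < s \<and> u mod r \<noteq> v mod r}\<rparr>"
  (is "is_turan_graph s r ?T")
proof -
  define P where "P i = {u. u < s \<and> u mod r = i}" for i
  let ?A = "P ` {..<r}"
  have mem: "i \<in> P i" if "i < r" for i using that assms by (auto simp: P_def)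
  have inj: "inj_on P {..<r}"
  proof (rule inj_onI)
    fix i j assume "i \<in> {..<r}" "j \<in> {..<r}" "P i = P j"
    then have "i \<in> P j" "i < r" using mem by auto
    then show "i = j" by (simp add: P_def)
  qed
  have T: "pair_graph ?T"
    by unfold_locales
      (auto simp: symmetric_def sym_def intro: finite_subset[of _ "{..<s} \<times> {..<s}"])
  have part: "partition_on {..<s} ?A"
  proof (rule partition_onI)
    show "\<Union>?A = {..<s}" using assms by (auto simp: P_def)
    show "disjnt p q" if "p \<in> ?A" "q \<in> ?A" "p \<noteq> q" for p q
      using that by (auto simp: P_def disjnt_def)
    show "{} \<notin> ?A" using mem by auto
  qed
  have "{(u, v). u < s \<and> v < s \<and> u mod r \<noteq> v mod r} =
        {(u, v). \<exists>A\<in>?A. \<exists>B\<in>?A. A \<noteq> B \<and> u \<in> A \<and> v \<in> B}" (is "?X = ?Y")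
  proof (intro set_eqI iffI; clarsimp)
    fix u v assume uv: "u < s" "v < s" "u mod r \<noteq> v mod r"
    have "u mod r < r" "v mod r < r" using assms by auto
    moreover from this have "P (u mod r) \<noteq> P (v mod r)" using inj uv by (simp add: inj_on_eq_iff)
    ultimately show "\<exists>i\<in>{..<r}. \<exists>j\<in>{..<r}. P i \<noteq> P j \<and> u \<in> P i \<and> v \<in> P j"
      using uv by (intro bexI[of _ "u mod r"] bexI[of _ "v mod r"]) (auto simp: P_def)
  next
    fix u v i j assume "P i \<noteq> P j" "u \<in> P i" "v \<in> P j"
    then show "u < s \<and> v < s \<and> u mod r \<noteq> v mod r" by (auto simp: P_def)
  qed
  moreover have "card (P i) \<le> card (P j) + 1" if "i < r" "j < r" for i j
  proof -
    have fin: "finite (P n)" for n by (simp add: P_def)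
    have quot: "\<exists>c. u = r + c * r + i" if "u \<in> P i - {i}" for u
    proof -
      have "u = u div r * r + i"
        using that div_mult_mod_eq[of u r] by (simp add: P_def)
      moreover from this have "u div r \<noteq> 0" using that by (metis DiffE mult_0 add_0 singletonI)
      then obtain c where "u div r = Suc c" by (cases "u div r") auto
      ultimately have "u = r + c * r + i" by simp
      then show ?thesis by blast
    qed
    have "inj_on (\<lambda>u. u - r - i + j) (P i - {i})"
    proof (rule inj_onI)
      fix u v assume "u \<in> P i - {i}" "v \<in> P i - {i}" "u - r - i + j = v - r - i + j"
      with quot[of u] quot[of v] show "u = v" by auto
    qed
    moreover have "(\<lambda>u. u - r - i + j) ` (P i - {i}) \<subseteq> P j"
    proof (intro image_subsetI)
      fix u assume u: "u \<in> P i - {i}"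
      then obtain c where c: "u = r + c * r + i" using quot by blast
      then have "u - r - i + j = c * r + j" by simp
      moreover have "c * r + j < s" using c u \<open>j < r\<close> by (simp add: P_def)
      ultimately show "u - r - i + j \<in> P j" using \<open>j < r\<close> by (simp add: P_def)
    qed
    ultimately have "card (P i - {i}) \<le> card (P j)" using card_inj_on_le fin by blast
    then show ?thesis using mem[OF \<open>i < r\<close>] fin[of i] by (simp add: card_Diff_singleton)
  qed
  ultimately show ?thesis
    unfolding is_turan_graph_def using T part card_image[OF inj]
    by (intro conjI exI[of _ ?A]) auto
qed

definition induced_copies :: "'a pair_pre_digraph \<Rightarrow> 'b pair_pre_digraph \<Rightarrow> nat" where
  "induced_copies F G =
     card {S. S \<subseteq> pverts G \<and> card S = card (pverts F) \<and>
              digraph_iso (with_proj F) (with_proj G \<restriction> S)}"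

definition induced_density :: "'a pair_pre_digraph \<Rightarrow> 'b pair_pre_digraph \<Rightarrow> real" where
  "induced_density F G =
     real (induced_copies F G) / real (card (pverts G) choose card (pverts F))"

definition max_induced_density :: "'a pair_pre_digraph \<Rightarrow> nat \<Rightarrow> real" where
  "max_induced_density F n =
     Max {induced_density F G | G :: nat pair_pre_digraph. pair_graph G \<and> card (pverts G) = n}"

definition clique_free :: "nat \<Rightarrow> 'a pair_pre_digraph \<Rightarrow> bool" where
  "clique_free k G \<longleftrightarrow> \<not> (\<exists>H. subgraph H (with_proj G) \<and> complete_digraph k H)"

definition max_induced_density_free :: "nat \<Rightarrow> 'a pair_pre_digraph \<Rightarrow> nat \<Rightarrow> real" where
  "max_induced_density_free k F n =
     Max {induced_density F G | G :: nat pair_pre_digraph.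
            pair_graph G \<and> card (pverts G) = n \<and> clique_free k G}"

definition inducibility :: "'a pair_pre_digraph \<Rightarrow> real" where
  "inducibility F = lim (max_induced_density F)"

definition inducibility_free :: "nat \<Rightarrow> 'a pair_pre_digraph \<Rightarrow> real" where
  "inducibility_free k F = lim (max_induced_density_free k F)"

definition part_lengths :: "real list \<Rightarrow> bool" where
  "part_lengths xs \<longleftrightarrow> (\<forall>x\<in>set xs. 0 < x) \<and> sum_list xs = 1"

text \<open>
  The intervals are half-open, except that the last one contains its right endpoint, so that for
  \<^term>\<open>part_lengths xs\<close> they partition the closed unit interval.
\<close>

definition part_interval :: "real list \<Rightarrow> nat \<Rightarrow> real set" where
  "part_interval xs i =
     (if Suc i = length xs then {sum_list (take i xs)..sum_list (take (Suc i) xs)}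
      else {sum_list (take i xs)..<sum_list (take (Suc i) xs)})"

definition multipartite_graphon :: "real list \<Rightarrow> real \<Rightarrow> real \<Rightarrow> real" where
  "multipartite_graphon xs u v =
     (if \<exists>i<length xs. \<exists>j<length xs. i \<noteq> j \<and> u \<in> part_interval xs i \<and> v \<in> part_interval xs j
      then 1 else 0)"

text \<open>
  The graph induced by sample points \<open>x\<^sub>0, \<dots>, x\<^sub>n\<^sub>-\<^sub>1\<close> has the
  indices as its vertices; almost surely the points are distinct, so that this is the graph on the
  points themselves.
\<close>

definition sampled_graph ::
  "(real \<Rightarrow> real \<Rightarrow> real) \<Rightarrow> nat \<Rightarrow> (nat \<Rightarrow> real) \<Rightarrow> nat pair_pre_digraph" where
  "sampled_graph W n x =
     \<lparr>pverts = {..<n}, parcs = {(a, b). a < n \<and> b < n \<and> a \<noteq> b \<and> W (x a) (x b) = 1}\<rparr>"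

definition graphon_density :: "'a pair_pre_digraph \<Rightarrow> (real \<Rightarrow> real \<Rightarrow> real) \<Rightarrow> real" where
  "graphon_density F W =
     (let n = card (pverts F) in
        \<P>(x in \<Pi>\<^sub>M a\<in>{..<n}. uniform_measure lborel {0..1}.
          digraph_iso (with_proj F) (with_proj (sampled_graph W n x))))"

definition uniquely_attained :: "'a pair_pre_digraph \<Rightarrow> real list \<Rightarrow> bool" where
  "uniquely_attained F xs \<longleftrightarrow>
     part_lengths xs \<and>
     graphon_density F (multipartite_graphon xs) = inducibility F \<and>
     (\<forall>ys. part_lengths ys \<and>
           graphon_density F (multipartite_graphon ys) = inducibility F \<longrightarrow>
           mset ys = mset xs)"

definition uniquely_attained_free :: "nat \<Rightarrow> 'a pair_pre_digraph \<Rightarrow> real list \<Rightarrow> bool" where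
  "uniquely_attained_free k F xs \<longleftrightarrow>
     part_lengths xs \<and> length xs < k \<and>
     graphon_density F (multipartite_graphon xs) = inducibility_free k F \<and>
     (\<forall>ys. part_lengths ys \<and> length ys < k \<and>
           graphon_density F (multipartite_graphon ys) = inducibility_free k F \<longrightarrow>
           mset ys = mset xs)"

text \<open>An entry \<open>((s, r), t, v)\<close> gives the values \<open>t(s,r)\<close> and \<open>v(s,r)\<close>.\<close>

definition turan_table :: "((nat \<times> nat) \<times> nat \<times> real) list" where
  "turan_table =
    [((3, 2), 2, 3 / 4),
     ((4, 2), 2, 3 / 8),
     ((4, 3), 5, 72 / 125),
     ((5, 2), 2, 5 / 8),
     ((5, 3), 3, 10 / 27),
     ((5, 4), 8, 525 / 1024),
     ((6, 2), 2, 5 / 16),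
     ((6, 3), 3, 10 / 81),
     ((6, 4), 6, 25 / 72),
     ((6, 5), 13, 178200 / 371293),
     ((7, 2), 2, 35 / 64),
     ((7, 3), 3, 70 / 243),
     ((7, 4), 5, 504 / 3125),
     ((7, 5), 8, 11025 / 32768),
     ((7, 6), 19, 21591360 / 47045881),
     ((8, 2), 2, 35 / 128),
     ((8, 3), 3, 560 / 2187),
     ((8, 4), 4, 315 / 8192),
     ((8, 5), 7, 21600 / 117649),
     ((8, 6), 11, 6350400 / 19487171),
     ((8, 7), 25, 542691072 / 1220703125),
     ((9, 2), 2, 63 / 128),
     ((9, 3), 3, 560 / 6561),
     ((9, 4), 4, 945 / 8192),
     ((9, 5), 6, 175 / 2592),
     ((9, 6), 9, 313600 / 1594323),
     ((9, 7), 15, 224224 / 703125),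
     ((9, 8), 33, 837724160 / 1929229929),
     ((10, 2), 2, 63 / 256),
     ((10, 3), 3, 1400 / 6561),
     ((10, 4), 4, 4725 / 32768),
     ((10, 5), 5, 4536 / 390625),
     ((10, 6), 8, 1488375 / 16777216),
     ((10, 7), 12, 67375 / 331776),
     ((10, 8), 19, 101047564800 / 322687697779),
     ((10, 9), 42, 796235375 / 1867795524),
     ((11, 2), 2, 231 / 512),
     ((11, 3), 3, 3850 / 19683),
     ((11, 4), 4, 5775 / 65536),
     ((11, 5), 5, 16632 / 390625),
     ((11, 6), 7, 1069200 / 40353607),
     ((11, 7), 10, 130977 / 1250000),
     ((11, 8), 15, 19731712 / 94921875),
     ((11, 9), 24, 157309075 / 509607936),
     ((11, 10), 51, 617338863680000 / 1469659553427321),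
     ((12, 2), 2, 231 / 1024),
     ((12, 3), 3, 3850 / 59049),
     ((12, 4), 4, 5775 / 262144),
     ((12, 5), 5, 133056 / 1953125),
     ((12, 6), 7, 1069200 / 282475249),
     ((12, 7), 9, 1724800 / 43046721),
     ((12, 8), 12, 3705625 / 31850496),
     ((12, 9), 18, 163788625 / 774840978),
     ((12, 10), 29, 3721968169920000 / 12200509765705829),
     ((12, 11), 62, 21091312901233575 / 50816953792809662),
     ((13, 2), 2, 429 / 1024),
     ((13, 3), 3, 10010 / 59049),
     ((13, 4), 4, 75075 / 1048576),
     ((13, 5), 5, 576576 / 9765625),
     ((13, 6), 6, 25025 / 1679616),
     ((13, 7), 8, 42567525 / 4294967296),
     ((13, 8), 11, 14859936000 / 285311670611),
     ((13, 9), 15, 897792896 / 7119140625),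
     ((13, 10), 22, 243737778375 / 1141246682444),
     ((13, 11), 35, 233296472927232 / 772393258984375),
     ((13, 12), 74, 2704936173225986700 / 6582952005840035281),
     ((14, 2), 2, 429 / 2048),
     ((14, 3), 3, 28028 / 177147),
     ((14, 4), 4, 1576575 / 16777216),
     ((14, 5), 5, 1345344 / 48828125),
     ((14, 6), 6, 875875 / 30233088),
     ((14, 7), 8, 42567525 / 34359738368),
     ((14, 8), 10, 107270163 / 6250000000),
     ((14, 9), 13, 1452272976000 / 23298085122481),
     ((14, 10), 18, 14904764875 / 111577100832),
     ((14, 11), 26, 20068705243125 / 93192340489924),
     ((14, 12), 41, 277115986307736576000 / 925103102315013629321),
     ((14, 13), 86, 2800242205096869658125 / 6873056497129163140972)]"

lemma turan_table_keys:
  "map fst turan_table = [(s, r). s \<leftarrow> [3..<15], r \<leftarrow> [2..<s]]"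
  by (simp add: turan_table_def upt_rec_numeral)

end

theory Submission
  imports Defs
begin

text \<open>
  Write \<open>s = p * r + q\<close> with \<open>q < r\<close>. The Turan graph \<open>T(s, r)\<close> is the complete multipartite graph
  with \<open>r - q\<close> classes of size \<open>p\<close> and \<open>q\<close> classes of size \<open>p + 1\<close>, and its density in the complete
  multipartite graphon with part lengths \<open>x\<^sub>1, \<dots>, x\<^sub>m\<close> is a constant times the monomial symmetric
  polynomial \<open>power_poly\<close> in which \<open>r - q\<close> of the variables have exponent \<open>p\<close> and \<open>q\<close> have exponent
  \<open>p + 1\<close> (\<open>sum_colorings_of_shape\<close>, \<open>multipartite_graphon_density\<close>). Three facts give the theorem.

  Complete multipartite graphons are optimal. Two nonadjacent vertices of a complete multipartite
  graph are twins. Therefore, in a graph with vertex weights, the density is at most a convex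
  combination of the densities obtained by moving the whole weight of one of two nonadjacent
  vertices to the other (\<open>pattern_weight_merge\<close>). Repeating this ends at a weighted clique of the
  graph, which is a complete multipartite graphon with fewer than \<open>k\<close> parts if the graph has no
  \<open>k\<close>-clique (\<open>pattern_weight_le\<close>). Balanced complete multipartite graphs attain the bound in the
  limit, so that the limits exist and equal the maximum of the polynomial
  (\<open>max_density_tendsto\<close>).

  Equal parts are optimal. If all but two of the variables are fixed, and so is the sum \<open>x + y\<close> of
  these two, then \<open>x\<^sup>n + y\<^sup>n\<close> is a convex function of the product \<open>x * y\<close>, and hence so is the
  polynomial (\<open>power_poly_pair_convex\<close>). The value at a pair is thus at most a convex combination of
  the value after merging the pair into one part and the value after moving the two closer to each
  other. An induction on the number of parts, and then on the number of parts that differ from the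
  mean, shows that unequal parts are strictly worse than the best equal parts
  (\<open>power_poly_less_max_uniform\<close>).

  The best number of equal parts is unique. At \<open>m\<close> equal parts the polynomial is a constant times
  \<open>(m choose r) / m\<^sup>s\<close>, and this grows from \<open>m\<close> to \<open>m + 1\<close> if and only if
  \<open>\<Sum>i<s. (m / (m + 1))\<^sup>i\<close> is less than \<open>r\<close> (\<open>uniform_value_step\<close>). The sum increases with \<open>m\<close>,
  so the value first increases and then decreases. That the tabulated \<open>t\<close> is the turning point takes
  one integer inequality on each side of it (\<open>turan_table_ok\<close>). With at most \<open>k - 1\<close> parts the best
  number is the smaller of \<open>k - 1\<close> and \<open>t\<close>.
\<close>

section \<open>A monomial symmetric polynomial on the simplex\<close>

text \<open>
  This is the monomial symmetric polynomial with \<open>a\<close> exponents \<open>p\<close> and \<open>b\<close> exponents \<open>p + 1\<close>. The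
  recursion decides for the head of the list whether its variable is left out or which of the two
  exponents it gets.
\<close>

fun power_poly :: "nat \<Rightarrow> nat \<Rightarrow> nat \<Rightarrow> real list \<Rightarrow> real" where
  "power_poly p a b [] = (if a = 0 \<and> b = 0 then 1 else 0)"
| "power_poly p a b (x # xs) =
     power_poly p a b xs + (if a = 0 then 0 else x ^ p * power_poly p (a - 1) b xs) +
     (if b = 0 then 0 else x ^ Suc p * power_poly p a (b - 1) xs)"

lemma power_poly_nonneg: "(\<And>x. x \<in> set xs \<Longrightarrow> 0 \<le> x) \<Longrightarrow> 0 \<le> power_poly p a b xs"
  by (induction xs arbitrary: a b) auto

lemma power_poly_eq_0: "length xs < a + b \<Longrightarrow> power_poly p a b xs = 0"
  by (induction xs arbitrary: a b) auto

lemma power_poly_swap: "power_poly p a b (x # y # zs) = power_poly p a b (y # x # zs)"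
  by (simp add: algebra_simps)

lemma power_poly_Cons_cong:
  assumes "\<And>a b. power_poly p a b xs = power_poly p a b ys"
  shows "power_poly p a b (x # xs) = power_poly p a b (x # ys)"
  by (simp add: assms)

lemma power_poly_move: "power_poly p a b (ys @ x # zs) = power_poly p a b (x # ys @ zs)"
proof (induction ys arbitrary: a b)
  case (Cons y ys)
  have "power_poly p a b ((y # ys) @ x # zs) = power_poly p a b (y # x # ys @ zs)"
    unfolding append_Cons by (rule power_poly_Cons_cong) (rule Cons.IH)
  also have "\<dots> = power_poly p a b (x # y # ys @ zs)" by (rule power_poly_swap)
  finally show ?case by simp
qed simp

lemma power_poly_mset:
  "mset xs = mset ys \<Longrightarrow> power_poly p a b xs = power_poly p a b ys"
proof (induction xs arbitrary: ys a b)
  case (Cons x xs)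
  then have "x \<in> set ys" by (metis list.set_intros(1) set_mset_mset)
  then obtain us vs where ys: "ys = us @ x # vs" by (meson split_list)
  with Cons.prems have "mset xs = mset (us @ vs)" by simp
  then have "power_poly p a b (x # xs) = power_poly p a b (x # us @ vs)"
    by (intro power_poly_Cons_cong Cons.IH)
  then show ?case using ys power_poly_move by metis
qed simp

lemma power_poly_replicate:
  "power_poly p a b (replicate m y) =
     real (m choose (a + b)) * real ((a + b) choose a) * y ^ (p * a + Suc p * b)"
proof (induction m arbitrary: a b)
  case (Suc m)
  show ?case
  proof (cases a)
    case 0
    then show ?thesis using Suc by (cases b) (auto simp: algebra_simps power_add)
  next
    case a: (Suc a')
    show ?thesis
    proof (cases b)
      case 0
      then show ?thesis using Suc a by (auto simp: algebra_simps power_add)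
    next
      case b: (Suc b')
      have e: "y ^ p * y ^ (p * a' + Suc p * b) = y ^ (p * a + Suc p * b)"
        "y ^ Suc p * y ^ (p * a + Suc p * b') = y ^ (p * a + Suc p * b)"
        unfolding a b by (simp_all add: power_add algebra_simps)
      have ab: "a + b' = a' + b" using a b by simp
      have "power_poly p a b (replicate (Suc m) y) =
        power_poly p a b (replicate m y) + y ^ p * power_poly p a' b (replicate m y) +
        y ^ Suc p * power_poly p a b' (replicate m y)"
        by (simp add: a b)
      also have "\<dots> =
        real (m choose (a + b)) * real ((a + b) choose a) * y ^ (p * a + Suc p * b) +
        real (m choose (a' + b)) * real ((a' + b) choose a') * (y ^ p * y ^ (p * a' + Suc p * b)) +
        real (m choose (a + b')) * real ((a + b') choose a) * (y ^ Suc p * y ^ (p * a + Suc p * b'))"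
        by (simp only: Suc.IH mult_ac)
      also have "\<dots> = (real (m choose (a + b)) * real ((a + b) choose a) +
         real (m choose (a' + b)) * (real ((a' + b) choose a') + real ((a' + b) choose a)))
           * y ^ (p * a + Suc p * b)"
        unfolding e ab by (simp add: algebra_simps)
      also have "real ((a' + b) choose a') + real ((a' + b) choose a) = real ((a + b) choose a)"
        using a by simp
      also have "real (m choose (a + b)) * real ((a + b) choose a) +
         real (m choose (a' + b)) * real ((a + b) choose a) =
         real (Suc m choose (a + b)) * real ((a + b) choose a)"
        using a by (simp add: algebra_simps)
      finally show ?thesis .
    qed
  qed
qed simp

text \<open>
  By \<open>2 * (x ^ Suc n + y ^ Suc n) = (x + y) * (x ^ n + y ^ n) + (x - y) * (x ^ n - y ^ n)\<close>, where
  moving \<open>x\<close> and \<open>y\<close> apart increases both summands.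
\<close>

lemma power_sum_mono_spread:
  fixes x y x' y' :: real
  assumes "0 \<le> y" "y \<le> y'" "y' \<le> x'" "x' + y' = x + y"
  shows "x' ^ n + y' ^ n \<le> x ^ n + y ^ n"
proof (induction n)
  case (Suc n)
  have x: "x' \<le> x" using assms by simp
  have d: "0 \<le> x' ^ n - y' ^ n" "x' ^ n - y' ^ n \<le> x ^ n - y ^ n"
    using power_mono[of y' x' n] power_mono[of x' x n] power_mono[of y y' n] assms x by auto
  have "(x' - y') * (x' ^ n - y' ^ n) \<le> (x - y) * (x ^ n - y ^ n)"
    using d x assms by (intro mult_mono) auto
  moreover have "(x' + y') * (x' ^ n + y' ^ n) \<le> (x + y) * (x ^ n + y ^ n)"
    using Suc assms x by (auto intro!: mult_mono)
  ultimately show ?case by (simp add: algebra_simps)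
qed simp

text \<open>
  This is the quotient of \<open>(x + y) ^ Suc n - x ^ Suc n - y ^ Suc n\<close> by \<open>x * y\<close>. The recursion has
  only nonnegative terms and shows how the quotient changes when \<open>x + y\<close> is fixed.
\<close>

primrec power_sum_defect :: "nat \<Rightarrow> real \<Rightarrow> real \<Rightarrow> real" where
  "power_sum_defect 0 x y = 0"
| "power_sum_defect (Suc n) x y = (x + y) * power_sum_defect n x y + (x ^ n + y ^ n)"

lemma power_sum_defect:
  "(x + y) ^ Suc n - (x ^ Suc n + y ^ Suc n) = x * y * power_sum_defect n x y"
proof (induction n)
  case (Suc n)
  have "(x + y) ^ Suc (Suc n) - (x ^ Suc (Suc n) + y ^ Suc (Suc n)) =
    (x + y) * ((x + y) ^ Suc n - (x ^ Suc n + y ^ Suc n)) + x * y * (x ^ n + y ^ n)"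
    by (simp add: algebra_simps)
  then show ?case unfolding Suc by (simp add: algebra_simps)
qed simp

text \<open>
  With the sum of two numbers fixed, their power sum is convex as a function of their product. Here
  the points of the chord are the products \<open>0\<close> (one of the numbers is the whole sum), \<open>x * y\<close> and
  \<open>x' * y'\<close>. The claim says that \<open>power_sum_defect\<close> does not increase when the two
  numbers move closer to each other, which follows by induction from \<open>power_sum_mono_spread\<close>.
\<close>

lemma power_sum_convex:
  fixes x y x' y' :: real
  assumes "0 < y" "y \<le> y'" "y' \<le> x'" "x' + y' = x + y" and n: "0 < n"
  defines "\<theta> \<equiv> x * y / (x' * y')"
  shows "x ^ n + y ^ n \<le> (1 - \<theta>) * (x + y) ^ n + \<theta> * (x' ^ n + y' ^ n)"
proof -
  have pos: "0 < x'" "0 < y'" "x' \<le> x" "0 < x" using assms by auto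
  have Q: "power_sum_defect m x' y' \<le> power_sum_defect m x y" for m
  proof (induction m)
    case (Suc m)
    then show ?case
      using power_sum_mono_spread[of y y' x' x m] assms pos by (auto intro!: add_mono mult_left_mono)
  qed simp
  obtain m where m: "n = Suc m" using n gr0_implies_Suc by blast
  have \<theta>: "\<theta> * (x' * y') = x * y" "0 \<le> \<theta>" unfolding \<theta>_def using pos assms by auto
  have eq: "(x + y) ^ n - (x' ^ n + y' ^ n) = x' * y' * power_sum_defect m x' y'"
    unfolding m using power_sum_defect[of x' y' m] assms by simp
  have "\<theta> * ((x + y) ^ n - (x' ^ n + y' ^ n)) = x * y * power_sum_defect m x' y'"
    unfolding eq using \<theta>(1) by (metis mult.assoc)
  also have "\<dots> \<le> x * y * power_sum_defect m x y" using Q pos assms by (intro mult_left_mono) auto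
  also have "\<dots> = (x + y) ^ n - (x ^ n + y ^ n)" unfolding m power_sum_defect by simp
  finally show ?thesis by (simp add: algebra_simps)
qed

lemma product_in_between:
  fixes x y x' y' :: real
  assumes "0 < y" "y < y'" "y' \<le> x'" "x' + y' = x + y"
  shows "x * y < x' * y'"
proof -
  have x: "x = x' + y' - y" using assms(4) by simp
  have "x' * y' - x * y = (y' - y) * (x' - y)" unfolding x by (simp add: algebra_simps)
  moreover have "0 < (y' - y) * (x' - y)" using assms by (intro mult_pos_pos) auto
  ultimately show ?thesis by simp
qed

text \<open>
  The polynomial depends on two of its variables through power sums, powers of the product, and the
  sum times a power of the product, all with nonnegative coefficients. If the sum is fixed, each of
  these is a convex function of the product, and a part of length \<open>0\<close> is the same as no part.
\<close>

lemma power_poly_pair_convex: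
  fixes x y x' y' :: real
  assumes ord: "0 < y" "y < y'" "y' \<le> x'" "x' + y' = x + y" and p: "0 < p"
    and zs: "\<And>z. z \<in> set zs \<Longrightarrow> 0 \<le> z"
  defines "\<theta> \<equiv> x * y / (x' * y')"
  shows "power_poly p a b (x # y # zs) \<le>
    (1 - \<theta>) * power_poly p a b ((x + y) # zs) + \<theta> * power_poly p a b (x' # y' # zs)"
    and "0 < \<theta>" "\<theta> < 1"
proof -
  have pos: "0 < x" "0 < x'" "0 < y'" using ord by auto
  have lt: "x * y < x' * y'" using product_in_between ord by blast
  show \<theta>0: "0 < \<theta>" and \<theta>1: "\<theta> < 1" unfolding \<theta>_def using pos ord lt by auto
  have \<theta>: "\<theta> * (x' * y') = x * y" unfolding \<theta>_def using pos by auto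
  have conv: "x ^ n + y ^ n \<le> (1 - \<theta>) * (x + y) ^ n + \<theta> * (x' ^ n + y' ^ n)" if "0 < n" for n
    unfolding \<theta>_def using power_sum_convex[of y y' x' x n] ord that by auto
  have prod: "(x * y) ^ n \<le> \<theta> * (x' * y') ^ n" if n: "0 < n" for n
  proof -
    have "\<theta> ^ n \<le> \<theta> ^ 1" using \<theta>0 \<theta>1 n by (intro power_decreasing) auto
    then have "\<theta> ^ n * (x' * y') ^ n \<le> \<theta> * (x' * y') ^ n"
      using pos by (intro mult_right_mono) auto
    then show ?thesis by (simp add: \<theta>[symmetric] power_mult_distrib)
  qed
  have nn: "0 \<le> power_poly p c d zs" for c d using zs by (rule power_poly_nonneg)
  define P where "P = power_poly p"
  \<comment> \<open>With exponent pairs of the two chosen variables, up to order: \<open>C\<^sub>0\<close> belongs to \<open>(0, 0)\<close>, \<open>C\<^sub>1\<close> to \<open>(p, 0)\<close>,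
    \<open>C\<^sub>2\<close> to \<open>(p + 1, 0)\<close>, \<open>C\<^sub>3\<close> to \<open>(p, p)\<close>, \<open>C\<^sub>4\<close> to \<open>(p, p + 1)\<close> and \<open>C\<^sub>5\<close> to \<open>(p + 1, p + 1)\<close>.\<close>
  define C\<^sub>0 where "C\<^sub>0 = P a b zs"
  define C\<^sub>1 where "C\<^sub>1 = (if a = 0 then 0 else P (a - 1) b zs)"
  define C\<^sub>2 where "C\<^sub>2 = (if b = 0 then 0 else P a (b - 1) zs)"
  define C\<^sub>3 where "C\<^sub>3 = (if a < 2 then 0 else P (a - 2) b zs)"
  define C\<^sub>4 where "C\<^sub>4 = (if a = 0 \<or> b = 0 then 0 else P (a - 1) (b - 1) zs)"
  define C\<^sub>5 where "C\<^sub>5 = (if b < 2 then 0 else P a (b - 2) zs)"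
  note C = C\<^sub>0_def C\<^sub>1_def C\<^sub>2_def C\<^sub>3_def C\<^sub>4_def C\<^sub>5_def
  have C_nonneg: "0 \<le> C\<^sub>1" "0 \<le> C\<^sub>2" "0 \<le> C\<^sub>3" "0 \<le> C\<^sub>4" "0 \<le> C\<^sub>5"
    unfolding C P_def using nn by auto
  have expand: "P a b (u # v # zs) = C\<^sub>0 + C\<^sub>1 * (u ^ p + v ^ p) + C\<^sub>2 * (u ^ Suc p + v ^ Suc p) +
     C\<^sub>3 * (u * v) ^ p + C\<^sub>4 * (u + v) * (u * v) ^ p + C\<^sub>5 * (u * v) ^ Suc p" for u v
    unfolding C P_def
    by (cases "a = 0"; cases "b = 0"; cases "a < 2"; cases "b < 2")
      (auto simp: algebra_simps power_mult_distrib numeral_2_eq_2)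
  have "P a b (x # y # zs) \<le> C\<^sub>0 + C\<^sub>1 * ((1 - \<theta>) * (x + y) ^ p + \<theta> * (x' ^ p + y' ^ p))
     + C\<^sub>2 * ((1 - \<theta>) * (x + y) ^ Suc p + \<theta> * (x' ^ Suc p + y' ^ Suc p))
     + C\<^sub>3 * (\<theta> * (x' * y') ^ p) + C\<^sub>4 * (x + y) * (\<theta> * (x' * y') ^ p)
     + C\<^sub>5 * (\<theta> * (x' * y') ^ Suc p)"
    unfolding expand
    using mult_left_mono[OF conv[OF p] C_nonneg(1)] mult_left_mono[OF conv[of "Suc p"] C_nonneg(2)]
      mult_left_mono[OF prod[OF p] C_nonneg(3)] mult_left_mono[OF prod[of "Suc p"] C_nonneg(5)]
      mult_left_mono[OF prod[OF p], of "C\<^sub>4 * (x + y)"] C_nonneg(4) pos ord(1)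
    by (simp del: power_Suc)
  also have "\<dots> = (1 - \<theta>) * (C\<^sub>0 + C\<^sub>1 * (x + y) ^ p + C\<^sub>2 * (x + y) ^ Suc p) +
     \<theta> * P a b (x' # y' # zs)"
    unfolding expand using ord(4) by (simp add: algebra_simps)
  also have "C\<^sub>0 + C\<^sub>1 * (x + y) ^ p + C\<^sub>2 * (x + y) ^ Suc p = P a b ((x + y) # zs)"
    unfolding C P_def by simp
  finally show "power_poly p a b (x # y # zs) \<le>
    (1 - \<theta>) * power_poly p a b ((x + y) # zs) + \<theta> * power_poly p a b (x' # y' # zs)"
    unfolding P_def .
qed


lemma nonuniform_obtains_below_above:
  fixes xs :: "real list"
  assumes "sum_list xs = 1" "xs \<noteq> replicate (length xs) (1 / real (length xs))"
  obtains x y where "x \<in> set xs" "y \<in> set xs"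
    "x < 1 / real (length xs)" "1 / real (length xs) < y"
proof -
  define c where "c = 1 / real (length xs)"
  have ne: "xs \<noteq> []" using assms by auto
  have diff: "sum_list (map (\<lambda>x. x - c) xs) = 0"
    using assms(1) ne sum_list_subtractf[of "\<lambda>x. x" "\<lambda>_. c" xs]
    by (simp add: sum_list_triv c_def)
  have nconst: "\<exists>x\<in>set xs. x - c \<noteq> 0"
    using assms(2) replicate_eqI[of xs "length xs" c] unfolding c_def by auto
  have "\<exists>x\<in>set xs. x < c"
  proof (rule ccontr)
    assume *: "\<not> ?thesis"
    then have "\<forall>x\<in>set (map (\<lambda>x. x - c) xs). x = 0"
      using diff by (subst sum_list_nonneg_eq_0_iff[symmetric]) auto
    then show False using nconst by auto
  qed
  moreover have "\<exists>x\<in>set xs. c < x"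
  proof (rule ccontr)
    assume *: "\<not> ?thesis"
    have "sum_list (map (\<lambda>x. c - x) xs) = 0"
      using assms(1) ne sum_list_subtractf[of "\<lambda>_. c" "\<lambda>x. x" xs]
      by (simp add: sum_list_triv c_def)
    then have "\<forall>x\<in>set (map (\<lambda>x. c - x) xs). x = 0"
      using * by (subst sum_list_nonneg_eq_0_iff[symmetric]) auto
    then show False using nconst by auto
  qed
  ultimately show ?thesis using that unfolding c_def by blast
qed

lemma mset_extract_two:
  assumes "x \<in> set xs" "y \<in> set xs" "x \<noteq> y"
  obtains zs where "mset xs = mset (x # y # zs)"
proof -
  have "y \<in># mset xs - {#x#}" using assms by (simp add: in_diff_count)
  then have "mset xs = add_mset x (add_mset y (mset xs - {#x#} - {#y#}))"
    using assms by (metis insert_DiffM set_mset_mset)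
  then show ?thesis using that ex_mset by (metis mset.simps(2))
qed

text \<open>
  A strict inequality needs a pair whose merging leaves unequal parts; without further parts, merging
  leads to a single part, at which the polynomial vanishes.
\<close>

lemma nonuniform_obtains_pair:
  fixes xs :: "real list"
  assumes sum: "sum_list xs = 1" and pos: "\<And>x. x \<in> set xs \<Longrightarrow> 0 < x"
    and nu: "xs \<noteq> replicate (length xs) (1 / real (length xs))"
  obtains x y zs where "mset xs = mset (x # y # zs)"
    "x < 1 / real (length xs)" "1 / real (length xs) < y"
    "zs = [] \<or> (x + y) # zs \<noteq> replicate (Suc (length zs)) (1 / real (Suc (length zs)))"
proof -
  obtain x y where xy: "x \<in> set xs" "y \<in> set xs"
    "x < 1 / real (length xs)" "1 / real (length xs) < y"
    using nonuniform_obtains_below_above[OF sum nu] by blast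
  then obtain zs where zs: "mset xs = mset (x # y # zs)"
    using mset_extract_two[of x xs y] by (metis less_asym less_trans)
  show ?thesis
  proof (cases "zs = [] \<or> (x + y) # zs \<noteq> replicate (Suc (length zs)) (1 / real (Suc (length zs)))")
    case True
    then show ?thesis using that zs xy by blast
  next
    case False
    then obtain z zs' where z: "zs = z # zs'" by (cases zs) auto
    \<comment> \<open>All other parts equal \<open>x + y\<close>; merging \<open>x\<close> with one of them instead leaves \<open>y\<close>,
      which is smaller than the merged part.\<close>
    have zxy: "z = x + y" using False z by simp
    have x0: "0 < x" using pos xy by blast
    have "mset xs = mset (x # z # y # zs')" using zs z by simp
    moreover have "1 / real (length xs) < z" using zxy x0 xy by simp
    moreover have "(x + z) # y # zs' \<noteq>
        replicate (Suc (length (y # zs'))) (1 / real (Suc (length (y # zs'))))"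
      using zxy x0 by auto
    ultimately show ?thesis using that xy(3) by blast
  qed
qed

text \<open>
  By \<open>power_poly_pair_convex\<close>, the value at a nonuniform point lies between those at two other points.
  Merging a pair gives a shorter list. Moving the pair closer to each other until one of the two
  is the mean gives a list of the same length with more entries equal to the mean. So both lists come
  earlier in the lexicographic order by length and number of entries that differ from the mean.
\<close>

theorem power_poly_less_max_uniform:
  fixes xs :: "real list"
  assumes p: "0 < p" and ab: "2 \<le> a + b" and M: "0 < M"
    and unif: "\<And>m. 0 < m \<Longrightarrow> m \<le> l \<Longrightarrow> power_poly p a b (replicate m (1 / real m)) \<le> M"
    and xs: "sum_list xs = 1" "\<And>x. x \<in> set xs \<Longrightarrow> 0 < x" "length xs \<le> l"
    and nu: "xs \<noteq> replicate (length xs) (1 / real (length xs))"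
  shows "power_poly p a b xs < M"
  using xs nu
proof (induction xs rule: wf_induct_rule[OF wf_measures[of
    "[length, \<lambda>xs. length (filter (\<lambda>x. x \<noteq> 1 / real (length xs)) xs)]"]])
  case (1 xs)
  define c where "c = 1 / real (length xs)"
  obtain x y zs where xs: "mset xs = mset (x # y # zs)" and x: "x < c" and y: "c < y"
    and merge: "zs = [] \<or> (x + y) # zs \<noteq> replicate (Suc (length zs)) (1 / real (Suc (length zs)))"
    using nonuniform_obtains_pair[OF 1(2,3,5)] unfolding c_def by blast
  have set: "set xs = set (x # y # zs)" using xs by (metis set_mset_mset)
  have len: "length xs = Suc (Suc (length zs))" using xs by (metis size_mset length_Cons)
  have sum: "x + y + sum_list zs = 1"
    using 1(2) arg_cong[OF xs, of sum_mset] unfolding sum_mset_sum_list by simp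
  have pos: "0 < x" "0 < y" "\<And>z. z \<in> set zs \<Longrightarrow> 0 < z" using 1(3) set by auto
  have c: "0 < c" using x pos by simp
  define ys where "ys = (x + y) # zs"
  define us where "us = c # (x + y - c) # zs"
  have ys: "power_poly p a b ys < M"
  proof (cases "zs = []")
    case True
    then show ?thesis using M ab power_poly_eq_0[of ys a b p] unfolding ys_def by simp
  next
    case False
    then show ?thesis using 1(4) merge sum pos len unfolding ys_def
      by (intro "1.IH") auto
  qed
  have us: "power_poly p a b us \<le> M"
  proof (cases "us = replicate (length us) (1 / real (length us))")
    case True
    then have "power_poly p a b us = power_poly p a b (replicate (length us) (1 / real (length us)))"
      by (rule arg_cong)
    also have "\<dots> \<le> M" using len 1(4) unfolding us_def by (intro unif) auto
    finally show ?thesis .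
  next
    case False
    have lu: "length us = length xs" using len unfolding us_def by simp
    have "length (filter (\<lambda>x. x \<noteq> c) xs) = size (filter_mset (\<lambda>x. x \<noteq> c) (mset xs))"
      by (metis mset_filter size_mset)
    also have "\<dots> = Suc (Suc (length (filter (\<lambda>x. x \<noteq> c) zs)))"
      unfolding xs using x y by (simp flip: mset_filter)
    finally have "length (filter (\<lambda>x. x \<noteq> c) us) < length (filter (\<lambda>x. x \<noteq> c) xs)"
      unfolding us_def by simp
    then have "(us, xs) \<in> measures
        [length, \<lambda>xs. length (filter (\<lambda>x. x \<noteq> 1 / real (length xs)) xs)]"
      using lu unfolding c_def by simp
    then have "power_poly p a b us < M"
    proof (rule "1.IH")
      show "sum_list us = 1" using sum unfolding us_def by simp
      show "0 < u" if "u \<in> set us" for u using that pos c y unfolding us_def by auto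
      show "length us \<le> l" using lu 1(4) by simp
    qed (use False in auto)
    then show ?thesis by simp
  qed
  \<comment> \<open>\<open>power_poly_pair_convex\<close> expects the larger number first.\<close>
  define x' where "x' = max c (x + y - c)"
  define y' where "y' = min c (x + y - c)"
  have xy': "x' + y' = y + x" "x < y'" "y' \<le> x'" using x y unfolding x'_def y'_def by auto
  define \<theta> where "\<theta> = y * x / (x' * y')"
  have conv: "power_poly p a b (y # x # zs) \<le>
      (1 - \<theta>) * power_poly p a b ((y + x) # zs) + \<theta> * power_poly p a b (x' # y' # zs)"
    and \<theta>: "0 < \<theta>" "\<theta> < 1"
    unfolding \<theta>_def
    using power_poly_pair_convex(1)[of x y' x' y p zs a b] power_poly_pair_convex(2,3)[of x y' x' y p zs]
      pos xy' p less_imp_le by blast+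
  have "power_poly p a b xs = power_poly p a b (y # x # zs)" using xs by (intro power_poly_mset) simp
  moreover have "power_poly p a b (x' # y' # zs) = power_poly p a b us"
    unfolding x'_def y'_def us_def by (intro power_poly_mset) (auto simp: max_def min_def)
  moreover have "(1 - \<theta>) * power_poly p a b ys + \<theta> * power_poly p a b us < (1 - \<theta>) * M + \<theta> * M"
    using ys us \<theta> by (intro add_less_le_mono) auto
  ultimately show ?case using conv unfolding ys_def by (simp add: add.commute algebra_simps)
qed

section \<open>The polynomial at uniform points\<close>

text \<open>
  The quotient of \<open>(m + 1 choose r) / (m + 1) ^ s\<close> by \<open>(m choose r) / m ^ s\<close> exceeds \<open>1\<close> if and only if
  \<open>1 - (m / (m + 1)) ^ s < r / (m + 1)\<close>. Dividing by \<open>1 / (m + 1) = 1 - m / (m + 1)\<close> turns the left-hand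
  side into this geometric sum, which is visibly monotone in \<open>m\<close>.
\<close>

definition uniform_ratio_sum :: "nat \<Rightarrow> nat \<Rightarrow> real" where
  "uniform_ratio_sum s m = (\<Sum>i<s. (real m / real (m + 1)) ^ i)"

lemma uniform_ratio_sum_mono:
  assumes "m \<le> n" shows "uniform_ratio_sum s m \<le> uniform_ratio_sum s n"
proof -
  have "real m / real (m + 1) \<le> real n / real (n + 1)" using assms by (simp add: field_simps)
  then show ?thesis unfolding uniform_ratio_sum_def by (intro sum_mono power_mono) auto
qed

lemma uniform_ratio_sum_closed:
  "uniform_ratio_sum s m = (real (m + 1) ^ s - real m ^ s) / real (m + 1) ^ (s - 1)"
proof (cases s)
  case 0
  then show ?thesis by (simp add: uniform_ratio_sum_def)
next
  case (Suc n)
  define y where "y = real m / real (m + 1)"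
  have y: "1 - y = 1 / real (m + 1)" "y \<noteq> 1" unfolding y_def by (auto simp: field_simps)
  have "uniform_ratio_sum s m = (1 - y ^ s) / (1 - y)"
    unfolding uniform_ratio_sum_def y_def[symmetric] using y(2) by (simp add: sum_gp_strict)
  also have "\<dots> = (1 - real m ^ s / real (m + 1) ^ s) * real (m + 1)"
    unfolding y(1) by (simp add: y_def power_divide)
  also have "\<dots> = (real (m + 1) ^ s - real m ^ s) / real (m + 1) ^ s * real (m + 1)"
    by (simp add: diff_divide_distrib)
  finally show ?thesis unfolding Suc by simp
qed

definition uniform_value :: "nat \<Rightarrow> nat \<Rightarrow> nat \<Rightarrow> real" where
  "uniform_value s r m = real (m choose r) / real m ^ s"

lemma uniform_value_step:
  assumes m: "0 < m" "r \<le> m + 1" and s: "0 < s"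
  shows "uniform_value s r m < uniform_value s r (m + 1) \<longleftrightarrow> uniform_ratio_sum s m < real r"
      (is ?inc)
    and "uniform_value s r (m + 1) < uniform_value s r m \<longleftrightarrow> real r < uniform_ratio_sum s m"
      (is ?dec)
proof -
  define C where "C = real (m + 1 choose r)"
  have C: "0 < C" using m unfolding C_def by simp
  have binom: "real (m choose r) = C * (real (m + 1) - real r) / real (m + 1)"
  proof (cases "r = m + 1")
    case False
    then have "(m + 1) * (m choose r) = (m + 1 - r) * (m + 1 choose r)"
      using binomial_absorb_comp[of "m + 1" r] by simp
    then have "real (m + 1) * real (m choose r) = real (m + 1 - r) * C"
      unfolding C_def by (metis of_nat_mult)
    then show ?thesis using m by (simp add: field_simps of_nat_diff)
  qed simp
  define d where "d = C / (real m ^ s * real (m + 1) ^ s)"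
  have d: "0 < d" using C m unfolding d_def by simp
  have pw: "real (m + 1) ^ s = real (m + 1) ^ (s - 1) * real (m + 1)"
    using s by (cases s) auto
  have diff: "uniform_value s r (m + 1) - uniform_value s r m =
      d * (real (m + 1) ^ (s - 1) * (real r - uniform_ratio_sum s m))"
  proof -
    have "real (m + 1) ^ (s - 1) * uniform_ratio_sum s m = real (m + 1) ^ s - real m ^ s"
      unfolding uniform_ratio_sum_closed by simp
    then have "real (m + 1) ^ (s - 1) * (real r - uniform_ratio_sum s m) =
        real m ^ s - real (m + 1) ^ (s - 1) * (real (m + 1) - real r)"
      unfolding pw by (simp add: algebra_simps)
    moreover have "uniform_value s r (m + 1) = d * real m ^ s"
      using m unfolding uniform_value_def d_def C_def by simp
    moreover have "uniform_value s r m = d * (real (m + 1) ^ (s - 1) * (real (m + 1) - real r))"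
    proof -
      define q where "q = real (m + 1) ^ (s - 1)"
      have "C * k / N / u = C / (u * (q * N)) * (q * k)" if "0 < u" "0 < N" for k u N
        using that unfolding q_def by simp
      then show ?thesis using m unfolding uniform_value_def d_def binom pw q_def[symmetric]
        by simp
    qed
    ultimately show ?thesis by (simp add: algebra_simps)
  qed
  have sgn: "0 < d * real (m + 1) ^ (s - 1) * u \<longleftrightarrow> 0 < u"
    "d * real (m + 1) ^ (s - 1) * u < 0 \<longleftrightarrow> u < 0" for u
  proof -
    have "0 < d * real (m + 1) ^ (s - 1)" using d by simp
    then show "0 < d * real (m + 1) ^ (s - 1) * u \<longleftrightarrow> 0 < u"
      "d * real (m + 1) ^ (s - 1) * u < 0 \<longleftrightarrow> u < 0"
      by (metis mult_pos_pos zero_less_mult_pos)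
        (metis mult_pos_neg mult_less_0_iff less_asym \<open>0 < d * real (m + 1) ^ (s - 1)\<close>)
  qed
  have "uniform_value s r m < uniform_value s r (m + 1) \<longleftrightarrow>
      0 < d * real (m + 1) ^ (s - 1) * (real r - uniform_ratio_sum s m)"
    using diff by (auto simp: mult.assoc)
  then show ?inc using sgn(1) by simp
  have "uniform_value s r (m + 1) < uniform_value s r m \<longleftrightarrow>
      d * real (m + 1) ^ (s - 1) * (real r - uniform_ratio_sum s m) < 0"
    using diff by (auto simp: mult.assoc)
  then show ?dec using sgn(2) by simp
qed

text \<open>
  Since \<open>uniform_ratio_sum\<close> increases, the steps go up until \<open>t\<close> and down afterwards, strictly in
  both cases. Below \<open>r\<close> parts the value is \<open>0\<close>.
\<close>

lemma uniform_value_less_peak: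
  assumes r: "0 < r" "r \<le> t" "0 < s"
    and peak: "uniform_ratio_sum s (t - 1) < real r" "real r < uniform_ratio_sum s t"
    and l: "r \<le> l" and m: "0 < m" "m \<le> l" "m \<noteq> min l t"
  shows "uniform_value s r m < uniform_value s r (min l t)"
proof -
  have up: "uniform_value s r n < uniform_value s r n'" if "r \<le> n" "n < n'" "n' \<le> t" for n n'
    using that(2,3)
  proof (induction n')
    case (Suc n')
    have "uniform_ratio_sum s n' \<le> uniform_ratio_sum s (t - 1)"
      using Suc.prems by (intro uniform_ratio_sum_mono) auto
    then have "uniform_value s r n' < uniform_value s r (n' + 1)"
      using peak(1) Suc.prems that(1) r by (subst uniform_value_step) auto
    then show ?case using Suc by (cases "n = n'") auto
  qed simp
  have down: "uniform_value s r n' < uniform_value s r n" if "t \<le> n" "n < n'" for n n'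
    using that(2)
  proof (induction n')
    case (Suc n')
    have "uniform_ratio_sum s t \<le> uniform_ratio_sum s n'"
      using Suc.prems that(1) by (intro uniform_ratio_sum_mono) auto
    then have "uniform_value s r (n' + 1) < uniform_value s r n'"
      using peak(2) Suc.prems that(1) r by (subst uniform_value_step) auto
    then show ?case using Suc by (cases "n = n'") auto
  qed simp
  show ?thesis
  proof (cases "m < r")
    case True
    then have "uniform_value s r m = 0" unfolding uniform_value_def by simp
    moreover have "0 < uniform_value s r (min l t)"
      using r l unfolding uniform_value_def by simp
    ultimately show ?thesis by simp
  next
    case False
    then show ?thesis using up[of m "min l t"] down[of t m] m
      by (cases "m < min l t") (auto simp: min_def split: if_splits)
  qed
qed

section \<open>Counting colorings by class sizes\<close>

text \<open>
  A coloring enters only through its partition into color classes, so that the shape is a property of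
  a family of sets and colorings with colors of different types can be compared.
\<close>

definition family_shape :: "nat \<Rightarrow> nat \<Rightarrow> nat \<Rightarrow> 'x set set \<Rightarrow> bool" where
  "family_shape p a b C \<longleftrightarrow> card {A \<in> C. card A = p} = a \<and> card {A \<in> C. card A = Suc p} = b \<and>
     (\<forall>A\<in>C. card A = p \<or> card A = Suc p)"

definition color_classes :: "'x set \<Rightarrow> ('x \<Rightarrow> 'c) \<Rightarrow> 'x set set" where
  "color_classes N f = (\<lambda>x. {y \<in> N. f y = f x}) ` N"

abbreviation class_shape :: "nat \<Rightarrow> nat \<Rightarrow> nat \<Rightarrow> 'x set \<Rightarrow> ('x \<Rightarrow> 'c) \<Rightarrow> bool" where
  "class_shape p a b N f \<equiv> family_shape p a b (color_classes N f)"

lemma color_classes_kernel: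
  assumes "\<And>x y. x \<in> N \<Longrightarrow> y \<in> N \<Longrightarrow> f x = f y \<longleftrightarrow> g x = g y"
  shows "color_classes N f = color_classes N g"
  unfolding color_classes_def
proof (rule image_cong[OF refl])
  fix x assume "x \<in> N"
  then show "{y \<in> N. f y = f x} = {y \<in> N. g y = g x}" using assms[of _ x] by blast
qed

lemma family_shape_insert:
  assumes "finite C" "A \<notin> C"
  shows "family_shape p a b (insert A C) \<longleftrightarrow>
     card A = p \<and> 0 < a \<and> family_shape p (a - 1) b C \<or>
     card A = Suc p \<and> 0 < b \<and> family_shape p a (b - 1) C"
proof -
  have "{B \<in> insert A C. card B = n} =
      (if card A = n then insert A {B \<in> C. card B = n} else {B \<in> C. card B = n})" for n
    by auto
  then have "card {B \<in> insert A C. card B = n} =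
      (if card A = n then Suc (card {B \<in> C. card B = n}) else card {B \<in> C. card B = n})" for n
    using assms by simp
  then show ?thesis unfolding family_shape_def by auto
qed

definition glue :: "'x set \<Rightarrow> 'c \<Rightarrow> ('x \<Rightarrow> 'c) \<Rightarrow> 'x \<Rightarrow> 'c" where
  "glue A v f = (\<lambda>x. if x \<in> A then v else f x)"

text \<open>
  The new color \<open>v\<close> has the class \<open>A\<close>, and the other classes are those of \<open>f\<close>. This is the step by
  which the colorings of a given shape are counted one color at a time.
\<close>

lemma class_shape_glue:
  assumes N: "finite N" and A: "A \<subseteq> N" and p: "0 < p" and v: "v \<notin> f ` (N - A)"
  shows "class_shape p a b N (glue A v f) \<longleftrightarrow>
     card A = 0 \<and> class_shape p a b (N - A) f \<or>
     card A = p \<and> 0 < a \<and> class_shape p (a - 1) b (N - A) f \<or>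
     card A = Suc p \<and> 0 < b \<and> class_shape p a (b - 1) (N - A) f"
proof (cases "A = {}")
  case True
  then show ?thesis using p by (simp add: glue_def)
next
  case False
  have "card A \<noteq> 0" using False finite_subset[OF A N] by simp
  let ?g = "glue A v f" and ?M = "N - A"
  have "color_classes N ?g = (\<lambda>x. {y \<in> N. ?g y = ?g x}) ` A \<union> (\<lambda>x. {y \<in> N. ?g y = ?g x}) ` ?M"
    unfolding color_classes_def image_Un[symmetric] using A by (simp add: Un_absorb1)
  also have "(\<lambda>x. {y \<in> N. ?g y = ?g x}) ` A = {A}"
  proof -
    have "{y \<in> N. ?g y = ?g x} = A" if "x \<in> A" for x
      using A v that unfolding glue_def by auto
    then show ?thesis using False by auto
  qed
  also have "(\<lambda>x. {y \<in> N. ?g y = ?g x}) ` ?M = color_classes ?M f"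
    unfolding color_classes_def
  proof (rule image_cong[OF refl])
    fix x assume "x \<in> ?M"
    then show "{y \<in> N. ?g y = ?g x} = {y \<in> ?M. f y = f x}" using v unfolding glue_def by auto
  qed
  finally have "color_classes N ?g = insert A (color_classes ?M f)" by simp
  moreover have "A \<notin> color_classes ?M f" using False unfolding color_classes_def by auto
  moreover have "finite (color_classes ?M f)" using N unfolding color_classes_def by simp
  ultimately show ?thesis using \<open>card A \<noteq> 0\<close> by (simp add: family_shape_insert)
qed

lemma sum_over_glue:
  fixes h :: "('x \<Rightarrow> 'c) \<Rightarrow> real"
  assumes N: "finite N" and V: "finite V" "v \<notin> V"
  shows "(\<Sum>g\<in>N \<rightarrow>\<^sub>E insert v V. h g) = (\<Sum>A\<in>Pow N. \<Sum>f\<in>(N - A) \<rightarrow>\<^sub>E V. h (glue A v f))"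
proof -
  have "(\<Sum>A\<in>Pow N. \<Sum>f\<in>(N - A) \<rightarrow>\<^sub>E V. h (glue A v f)) =
      (\<Sum>(A, f)\<in>Sigma (Pow N) (\<lambda>A. (N - A) \<rightarrow>\<^sub>E V). h (glue A v f))"
    using N V by (intro sum.Sigma) (auto intro: finite_PiE)
  also have "\<dots> = (\<Sum>g\<in>N \<rightarrow>\<^sub>E insert v V. h g)"
  proof (rule sum.reindex_bij_witness[of _
      "\<lambda>g. ({x \<in> N. g x = v}, restrict g (N - {x \<in> N. g x = v}))" "\<lambda>(A, f). glue A v f"])
    fix q assume "q \<in> Sigma (Pow N) (\<lambda>A. (N - A) \<rightarrow>\<^sub>E V)"
    then obtain A f where q: "q = (A, f)" "A \<subseteq> N" and f: "f \<in> (N - A) \<rightarrow>\<^sub>E V" by blast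
    have "f x \<noteq> v" if "x \<in> N - A" for x using that PiE_mem[OF f] V by metis
    then have e: "{x \<in> N. glue A v f x = v} = A" using q(2) unfolding glue_def by auto
    have "restrict (glue A v f) (N - A) = f"
      using PiE_arb[OF f] unfolding glue_def by (intro ext) (simp add: restrict_def)
    then show "({x \<in> N. (case q of (A, f) \<Rightarrow> glue A v f) x = v},
        restrict (case q of (A, f) \<Rightarrow> glue A v f)
          (N - {x \<in> N. (case q of (A, f) \<Rightarrow> glue A v f) x = v})) = q"
      unfolding q(1) prod.case e by simp
    have "glue A v f \<in> N \<rightarrow>\<^sub>E insert v V"
    proof (rule PiE_I)
      show "glue A v f x \<in> insert v V" if "x \<in> N" for x
        using that PiE_mem[OF f] unfolding glue_def by auto
      show "glue A v f x = undefined" if "x \<notin> N" for x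
        using that PiE_arb[OF f] q(2) unfolding glue_def by auto
    qed
    then show "(case q of (A, f) \<Rightarrow> glue A v f) \<in> N \<rightarrow>\<^sub>E insert v V" using q(1) by simp
    show "h (case q of (A, f) \<Rightarrow> glue A v f) = (case q of (A, f) \<Rightarrow> h (glue A v f))"
      using q(1) by simp
  next
    fix g assume g: "g \<in> N \<rightarrow>\<^sub>E insert v V"
    define A where "A = {x \<in> N. g x = v}"
    have "glue A v (restrict g (N - A)) = g"
    proof
      fix x show "glue A v (restrict g (N - A)) x = g x"
        using PiE_arb[OF g, of x] unfolding glue_def A_def by (cases "x \<in> N") auto
    qed
    then show "(case ({x \<in> N. g x = v}, restrict g (N - {x \<in> N. g x = v})) of
        (A, f) \<Rightarrow> glue A v f) = g" unfolding A_def by simp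
    have "restrict g (N - A) \<in> (N - A) \<rightarrow>\<^sub>E V"
    proof (rule restrict_PiE_iff[THEN iffD2], rule ballI)
      fix x assume "x \<in> N - A"
      then show "g x \<in> V" using PiE_mem[OF g, of x] unfolding A_def by auto
    qed
    then show "({x \<in> N. g x = v}, restrict g (N - {x \<in> N. g x = v})) \<in>
        Sigma (Pow N) (\<lambda>A. (N - A) \<rightarrow>\<^sub>E V)" unfolding A_def by blast
  qed
  finally show ?thesis by simp
qed

lemma sum_card_subsets:
  fixes c :: real
  assumes "finite N"
  shows "(\<Sum>A\<in>Pow N. of_bool (card A = k) * c) = real (card N choose k) * c"
proof -
  have "(\<Sum>A\<in>Pow N. of_bool (card A = k) * c) = real (card (Pow N \<inter> {A. card A = k})) * c"
    using assms by simp
  also have "Pow N \<inter> {A. card A = k} = {A. A \<subseteq> N \<and> card A = k}" by auto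
  finally show ?thesis using n_subsets[OF assms] by simp
qed

text \<open>
  The number of ways to distribute labeled points to \<open>a\<close> given classes of size \<open>p\<close> and \<open>b\<close> given
  classes of size \<open>p + 1\<close>.
\<close>

definition multinomial_factor :: "nat \<Rightarrow> nat \<Rightarrow> nat \<Rightarrow> real" where
  "multinomial_factor p a b = fact (p * a + Suc p * b) / (fact p ^ a * fact (Suc p) ^ b)"

lemma multinomial_factor_choose:
  "0 < a \<Longrightarrow> real ((p * a + Suc p * b) choose p) * multinomial_factor p (a - 1) b =
     multinomial_factor p a b"
  "0 < b \<Longrightarrow> real ((p * a + Suc p * b) choose Suc p) * multinomial_factor p a (b - 1) =
     multinomial_factor p a b"
proof -
  assume "0 < a"
  then obtain a' where a: "a = Suc a'" by (cases a) auto
  have "real ((p + (p * a' + Suc p * b)) choose p) * fact (p * a' + Suc p * b) =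
      fact (p + (p * a' + Suc p * b)) / fact p"
    by (simp only: binomial_fact[OF le_add1]) simp
  then show "real ((p * a + Suc p * b) choose p) * multinomial_factor p (a - 1) b =
     multinomial_factor p a b"
    unfolding multinomial_factor_def a by (simp add: field_simps del: fact_Suc)
next
  assume "0 < b"
  then obtain b' where b: "b = Suc b'" by (cases b) auto
  have "real ((Suc p + (p * a + Suc p * b')) choose Suc p) * fact (p * a + Suc p * b') =
      fact (Suc p + (p * a + Suc p * b')) / fact (Suc p)"
    by (simp only: binomial_fact[OF le_add1]) simp
  moreover have "p * a + Suc p * b = Suc p + (p * a + Suc p * b')" unfolding b by simp
  ultimately show "real ((p * a + Suc p * b) choose Suc p) * multinomial_factor p a (b - 1) =
     multinomial_factor p a b"
    unfolding multinomial_factor_def by (simp add: b field_simps del: fact_Suc mult_Suc binomial_Suc_Suc)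
qed

text \<open>
  The recursion of \<open>power_poly\<close> matches the choice of the class of the first color, which is empty or
  has \<open>p\<close> or \<open>p + 1\<close> elements; the binomial coefficients for this choice multiply to
  \<open>multinomial_factor\<close>.
\<close>

theorem sum_colorings_of_shape:
  fixes w :: "'c \<Rightarrow> real" and N :: "'x set"
  assumes "finite N" "distinct vs" "0 < p"
  shows "(\<Sum>f\<in>N \<rightarrow>\<^sub>E set vs. of_bool (class_shape p a b N f) * (\<Prod>x\<in>N. w (f x))) =
     of_bool (card N = p * a + Suc p * b) * multinomial_factor p a b * power_poly p a b (map w vs)"
  using assms(1,2)
proof (induction vs arbitrary: N a b)
  case Nil
  show ?case
  proof (cases "N = {}")
    case True
    then show ?thesis using assms(3) by (simp add: family_shape_def color_classes_def multinomial_factor_def)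
  next
    case False
    then have "N \<rightarrow>\<^sub>E set ([] :: 'c list) = {}" by (auto simp: PiE_eq_empty_iff)
    moreover have "card N \<noteq> 0" using False Nil by simp
    ultimately show ?thesis by (auto simp: multinomial_factor_def)
  qed
next
  case (Cons v vs)
  let ?V = "set vs"
  define S where "S a b M = (\<Sum>f\<in>M \<rightarrow>\<^sub>E ?V. of_bool (class_shape p a b M f) * (\<Prod>x\<in>M. w (f x)))"
    for a b and M :: "'x set"
  have IH: "S a b M = of_bool (card M = p * a + Suc p * b) * multinomial_factor p a b *
      power_poly p a b (map w vs)" if "finite M" for a b M
    unfolding S_def by (rule Cons.IH[OF that]) (use Cons.prems in simp)
  have v: "v \<notin> ?V" using Cons.prems by simp
  have "(\<Sum>f\<in>N \<rightarrow>\<^sub>E set (v # vs). of_bool (class_shape p a b N f) * (\<Prod>x\<in>N. w (f x))) =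
      (\<Sum>A\<in>Pow N. \<Sum>f\<in>(N - A) \<rightarrow>\<^sub>E ?V.
         of_bool (class_shape p a b N (glue A v f)) * (\<Prod>x\<in>N. w (glue A v f x)))"
    using sum_over_glue[OF Cons.prems(1) finite_set v] by simp
  also have "\<dots> = (\<Sum>A\<in>Pow N. of_bool (card A = 0) * S a b N +
      of_bool (card A = p) * (of_bool (0 < a) * w v ^ p * S (a - 1) b (N - A)) +
      of_bool (card A = Suc p) * (of_bool (0 < b) * w v ^ Suc p * S a (b - 1) (N - A)))"
  proof (rule sum.cong[OF refl])
    fix A assume "A \<in> Pow N"
    then have A: "A \<subseteq> N" "finite A" using Cons.prems finite_subset by auto
    have weight: "(\<Prod>x\<in>N. w (glue A v f x)) = w v ^ card A * (\<Prod>x\<in>N - A. w (f x))" for f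
    proof -
      have "(\<Prod>x\<in>N. w (glue A v f x)) =
          (\<Prod>x\<in>N - A. w (glue A v f x)) * (\<Prod>x\<in>A. w (glue A v f x))"
        using A Cons.prems by (metis prod.subset_diff)
      then show ?thesis by (simp add: glue_def)
    qed
    have shape: "of_bool (class_shape p a b N (glue A v f)) =
        of_bool (card A = 0) * of_bool (class_shape p a b (N - A) f) +
        of_bool (card A = p) * (of_bool (0 < a) * of_bool (class_shape p (a - 1) b (N - A) f)) +
        of_bool (card A = Suc p) * (of_bool (0 < b) * (of_bool (class_shape p a (b - 1) (N - A) f) :: real))"
      if "f \<in> (N - A) \<rightarrow>\<^sub>E ?V" for f
    proof -
      have "v \<notin> f ` (N - A)" using that v by auto
      then show ?thesis
        unfolding class_shape_glue[OF Cons.prems(1) A(1) assms(3) \<open>v \<notin> f ` (N - A)\<close>]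
        using assms(3) by (cases "card A = 0"; cases "card A = p"; cases "card A = Suc p"; simp)
    qed
    have "(\<Sum>f\<in>(N - A) \<rightarrow>\<^sub>E ?V.
         of_bool (class_shape p a b N (glue A v f)) * (\<Prod>x\<in>N. w (glue A v f x))) =
       (\<Sum>f\<in>(N - A) \<rightarrow>\<^sub>E ?V.
        of_bool (card A = 0) * (of_bool (class_shape p a b (N - A) f) * (\<Prod>x\<in>N - A. w (f x))) +
        of_bool (card A = p) * (of_bool (0 < a) * w v ^ p * (of_bool (class_shape p (a - 1) b (N - A) f) * (\<Prod>x\<in>N - A. w (f x)))) +
        of_bool (card A = Suc p) * (of_bool (0 < b) * w v ^ Suc p * (of_bool (class_shape p a (b - 1) (N - A) f) * (\<Prod>x\<in>N - A. w (f x)))))"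
      using assms(3) by (intro sum.cong refl, simp only: weight shape)
        (cases "card A = 0"; cases "card A = p"; cases "card A = Suc p"; simp)
    also have "\<dots> = of_bool (card A = 0) * S a b (N - A) +
      of_bool (card A = p) * (of_bool (0 < a) * w v ^ p * S (a - 1) b (N - A)) +
      of_bool (card A = Suc p) * (of_bool (0 < b) * w v ^ Suc p * S a (b - 1) (N - A))"
      unfolding S_def by (simp only: sum.distrib sum_distrib_left)
    finally show "(\<Sum>f\<in>(N - A) \<rightarrow>\<^sub>E ?V.
         of_bool (class_shape p a b N (glue A v f)) * (\<Prod>x\<in>N. w (glue A v f x))) =
      of_bool (card A = 0) * S a b N +
      of_bool (card A = p) * (of_bool (0 < a) * w v ^ p * S (a - 1) b (N - A)) +
      of_bool (card A = Suc p) * (of_bool (0 < b) * w v ^ Suc p * S a (b - 1) (N - A))"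
      using A by auto
  qed
  also have "\<dots> = (\<Sum>A\<in>Pow N. of_bool (card A = 0) * S a b N +
      of_bool (card A = p) * (of_bool (0 < a \<and> card N = p * a + Suc p * b) * w v ^ p *
        (multinomial_factor p (a - 1) b * power_poly p (a - 1) b (map w vs))) +
      of_bool (card A = Suc p) * (of_bool (0 < b \<and> card N = p * a + Suc p * b) * w v ^ Suc p *
        (multinomial_factor p a (b - 1) * power_poly p a (b - 1) (map w vs))))"
  proof (rule sum.cong[OF refl])
    fix A assume "A \<in> Pow N"
    then have "A \<subseteq> N" "finite A" using Cons.prems finite_subset by auto
    then have A: "card (N - A) + card A = card N"
      using Cons.prems card_mono[of N A] by (simp add: card_Diff_subset)
    have "of_bool (card A = p) * (of_bool (0 < a) * w v ^ p * S (a - 1) b (N - A)) =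
        of_bool (card A = p) * (of_bool (0 < a \<and> card N = p * a + Suc p * b) * w v ^ p *
        (multinomial_factor p (a - 1) b * power_poly p (a - 1) b (map w vs)))"
    proof (cases "card A = p \<and> 0 < a")
      case True
      then have "card (N - A) = p * (a - 1) + Suc p * b \<longleftrightarrow> card N = p * a + Suc p * b"
        using A by (cases a) auto
      then show ?thesis using True Cons.prems(1) IH[of "N - A" "a - 1" b] by simp
    qed auto
    moreover have "of_bool (card A = Suc p) * (of_bool (0 < b) * w v ^ Suc p * S a (b - 1) (N - A)) =
        of_bool (card A = Suc p) * (of_bool (0 < b \<and> card N = p * a + Suc p * b) * w v ^ Suc p *
        (multinomial_factor p a (b - 1) * power_poly p a (b - 1) (map w vs)))"
    proof (cases "card A = Suc p \<and> 0 < b")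
      case True
      then have "card (N - A) = p * a + Suc p * (b - 1) \<longleftrightarrow> card N = p * a + Suc p * b"
        using A by (cases b) auto
      then show ?thesis using True Cons.prems(1) IH[of "N - A" a "b - 1"] by simp
    qed auto
    ultimately show "of_bool (card A = 0) * S a b N +
      of_bool (card A = p) * (of_bool (0 < a) * w v ^ p * S (a - 1) b (N - A)) +
      of_bool (card A = Suc p) * (of_bool (0 < b) * w v ^ Suc p * S a (b - 1) (N - A)) =
      of_bool (card A = 0) * S a b N +
      of_bool (card A = p) * (of_bool (0 < a \<and> card N = p * a + Suc p * b) * w v ^ p *
        (multinomial_factor p (a - 1) b * power_poly p (a - 1) b (map w vs))) +
      of_bool (card A = Suc p) * (of_bool (0 < b \<and> card N = p * a + Suc p * b) * w v ^ Suc p *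
        (multinomial_factor p a (b - 1) * power_poly p a (b - 1) (map w vs)))"
      by (simp only:)
  qed
  also have "\<dots> = S a b N +
      real (card N choose p) * (of_bool (0 < a \<and> card N = p * a + Suc p * b) * w v ^ p *
        (multinomial_factor p (a - 1) b * power_poly p (a - 1) b (map w vs))) +
      real (card N choose Suc p) * (of_bool (0 < b \<and> card N = p * a + Suc p * b) * w v ^ Suc p *
        (multinomial_factor p a (b - 1) * power_poly p a (b - 1) (map w vs)))"
    by (simp only: sum.distrib sum_card_subsets[OF Cons.prems(1)]) simp
  also have "\<dots> = of_bool (card N = p * a + Suc p * b) * (multinomial_factor p a b * power_poly p a b (map w vs) +
      of_bool (0 < a) * w v ^ p * (real ((p * a + Suc p * b) choose p) * multinomial_factor p (a - 1) b) * power_poly p (a - 1) b (map w vs) +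
      of_bool (0 < b) * w v ^ Suc p * (real ((p * a + Suc p * b) choose Suc p) * multinomial_factor p a (b - 1)) * power_poly p a (b - 1) (map w vs))"
  proof (cases "card N = p * a + Suc p * b")
    case True
    show ?thesis unfolding IH[OF Cons.prems(1)] True
      by (simp only: simp_thms of_bool_eq mult_1_left mult_ac)
  next
    case False
    then show ?thesis unfolding IH[OF Cons.prems(1)] by simp
  qed
  also have "\<dots> = of_bool (card N = p * a + Suc p * b) * multinomial_factor p a b *
      power_poly p a b (map w (v # vs))"
  proof -
    have m: "of_bool (0 < a) * w v ^ p * (real ((p * a + Suc p * b) choose p) * multinomial_factor p (a - 1) b) =
        of_bool (0 < a) * w v ^ p * multinomial_factor p a b"
      "of_bool (0 < b) * w v ^ Suc p * (real ((p * a + Suc p * b) choose Suc p) * multinomial_factor p a (b - 1)) =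
        of_bool (0 < b) * w v ^ Suc p * multinomial_factor p a b"
      by (cases "0 < a"; simp only: of_bool_eq mult_zero_left multinomial_factor_choose(1))
        (cases "0 < b"; simp only: of_bool_eq mult_zero_left multinomial_factor_choose(2))
    have rec: "power_poly p a b (map w (v # vs)) = power_poly p a b (map w vs) +
        of_bool (0 < a) * w v ^ p * power_poly p (a - 1) b (map w vs) +
        of_bool (0 < b) * w v ^ Suc p * power_poly p a (b - 1) (map w vs)"
      by simp
    have ring: "c * (m * e + x * m * f + y * m * g) = c * m * (e + x * f + y * g)"
      for c m e x f y g :: real by (simp add: algebra_simps)
    show ?thesis unfolding m rec by (rule ring)
  qed
  finally show ?case .
qed

section \<open>Symmetrization of weighted graphs\<close>

text \<open>
  The adjacency of the complete multipartite graph on \<open>N\<close> with \<open>a\<close> classes of size \<open>p\<close> and \<open>b\<close> classes of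
  size \<open>p + 1\<close>. A relation admits a coloring with colors of any type if and only if it admits one
  whose colors are sets of vertices (\<open>turan_relation_coloring\<close>); this choice keeps the type of the colors
  out of the definition.
\<close>

definition turan_relation :: "nat \<Rightarrow> nat \<Rightarrow> nat \<Rightarrow> 'x set \<Rightarrow> ('x \<Rightarrow> 'x \<Rightarrow> bool) \<Rightarrow> bool" where
  "turan_relation p a b N E \<longleftrightarrow>
     (\<exists>c :: 'x \<Rightarrow> 'x set. class_shape p a b N c \<and> (\<forall>x\<in>N. \<forall>y\<in>N. E x y \<longleftrightarrow> c x \<noteq> c y))"

lemma turan_relation_cong:
  assumes "\<And>x y. x \<in> N \<Longrightarrow> y \<in> N \<Longrightarrow> E x y \<longleftrightarrow> E' x y"
  shows "turan_relation p a b N E \<longleftrightarrow> turan_relation p a b N E'"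
  unfolding turan_relation_def using assms by simp

lemma turan_relation_coloring:
  fixes c :: "'x \<Rightarrow> 'c"
  assumes E: "\<And>x y. x \<in> N \<Longrightarrow> y \<in> N \<Longrightarrow> E x y \<longleftrightarrow> c x \<noteq> c y"
  shows "turan_relation p a b N E \<longleftrightarrow> class_shape p a b N c"
proof
  assume "turan_relation p a b N E"
  then obtain d :: "'x \<Rightarrow> 'x set" where d: "class_shape p a b N d" "\<forall>x\<in>N. \<forall>y\<in>N. E x y \<longleftrightarrow> d x \<noteq> d y"
    unfolding turan_relation_def by blast
  have "color_classes N c = color_classes N d"
    by (rule color_classes_kernel) (use d E in blast)
  with d show "class_shape p a b N c" by simp
next
  assume c: "class_shape p a b N c"
  define d where "d x = {y \<in> N. c y = c x}" for x
  have d: "c x = c y \<longleftrightarrow> d x = d y" if "x \<in> N" "y \<in> N" for x y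
    using that unfolding d_def by auto
  have "color_classes N c = color_classes N d"
    by (rule color_classes_kernel) (rule d)
  with c have "class_shape p a b N d" by simp
  moreover have "\<forall>x\<in>N. \<forall>y\<in>N. E x y \<longleftrightarrow> d x \<noteq> d y" using d E by blast
  ultimately show "turan_relation p a b N E" unfolding turan_relation_def by blast
qed

text \<open>
  The elements of \<open>A\<close> are not adjacent to \<open>z\<close>, hence have the color of \<open>z\<close>, and replacing them all by \<open>z\<close>
  preserves the coloring.
\<close>

lemma turan_relation_twins:
  assumes "turan_relation p a b N E" and z: "z \<in> N"
    and A: "\<And>x. x \<in> A \<Longrightarrow> x \<in> N \<and> \<not> E x z"
    and E': "\<And>x y. x \<in> N \<Longrightarrow> y \<in> N \<Longrightarrow>
      E' x y \<longleftrightarrow> E (if x \<in> A then z else x) (if y \<in> A then z else y)"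
  shows "turan_relation p a b N E'"
proof -
  from assms(1) obtain c :: "'a \<Rightarrow> 'a set" where c: "class_shape p a b N c"
    and E: "\<And>x y. x \<in> N \<Longrightarrow> y \<in> N \<Longrightarrow> E x y \<longleftrightarrow> c x \<noteq> c y"
    unfolding turan_relation_def by blast
  have "c (if x \<in> A then z else x) = c x" for x using A E z by (cases "x \<in> A") auto
  then have "E' x y \<longleftrightarrow> c x \<noteq> c y" if "x \<in> N" "y \<in> N" for x y
    using E[of "if x \<in> A then z else x" "if y \<in> A then z else y"] E'[OF that] that z by simp
  then show ?thesis using c turan_relation_coloring[of N E' c] by blast
qed

text \<open>
  If \<open>w\<close> is a probability distribution on \<open>V\<close>, this is the probability that independent random vertices
  \<open>f x\<close> for \<open>x \<in> N\<close> induce the Turan relation, where a vertex that is drawn several times counts as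
  several nonadjacent points.
\<close>

definition pattern_weight ::
  "nat \<Rightarrow> nat \<Rightarrow> nat \<Rightarrow> 'x set \<Rightarrow> ('v \<Rightarrow> 'v \<Rightarrow> bool) \<Rightarrow> 'v set \<Rightarrow> ('v \<Rightarrow> real) \<Rightarrow> real" where
  "pattern_weight p a b N R V w =
     (\<Sum>f\<in>N \<rightarrow>\<^sub>E V. of_bool (turan_relation p a b N (\<lambda>x y. R (f x) (f y))) * (\<Prod>x\<in>N. w (f x)))"

lemma pattern_weight_complete:
  assumes "finite N" "distinct vs" "0 < p" "card N = p * a + Suc p * b"
    and R: "\<And>u v. u \<in> set vs \<Longrightarrow> v \<in> set vs \<Longrightarrow> R u v \<longleftrightarrow> u \<noteq> v"
  shows "pattern_weight p a b N R (set vs) w = multinomial_factor p a b * power_poly p a b (map w vs)"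
proof -
  have "pattern_weight p a b N R (set vs) w =
      (\<Sum>f\<in>N \<rightarrow>\<^sub>E set vs. of_bool (class_shape p a b N f) * (\<Prod>x\<in>N. w (f x)))"
    unfolding pattern_weight_def
  proof (rule sum.cong[OF refl])
    fix f assume f: "f \<in> N \<rightarrow>\<^sub>E set vs"
    have "turan_relation p a b N (\<lambda>x y. R (f x) (f y)) \<longleftrightarrow> class_shape p a b N f"
      by (rule turan_relation_coloring) (rule R; rule PiE_mem[OF f])
    then show "of_bool (turan_relation p a b N (\<lambda>x y. R (f x) (f y))) * (\<Prod>x\<in>N. w (f x)) =
        of_bool (class_shape p a b N f) * (\<Prod>x\<in>N. w (f x))" by simp
  qed
  also have "\<dots> = multinomial_factor p a b * power_poly p a b (map w vs)"
    using sum_colorings_of_shape[OF assms(1,2,3)] assms(4) by simp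
  finally show ?thesis .
qed

text \<open>
  Group the maps \<open>f\<close> by their image \<open>g\<close> after \<open>v\<close> is identified with \<open>u\<close>. If a point \<open>z\<close> is mapped to \<open>u\<close> or
  \<open>v\<close>, then within the group \<open>f z\<close> is \<open>u\<close> with probability \<open>w u / (w u + w v)\<close>, and a good map remains good
  when all points at \<open>u\<close> or \<open>v\<close> are moved to \<open>f z\<close>, because they are nonadjacent to \<open>z\<close>.
\<close>

lemma pattern_weight_merge:
  fixes R :: "'v \<Rightarrow> 'v \<Rightarrow> bool" and N :: "'x set"
  assumes N: "finite N" and V: "finite V" "u \<in> V" "v \<in> V" "u \<noteq> v"
    and R: "\<not> R u v" "\<not> R v u" "\<not> R u u" "\<not> R v v"
    and w: "\<And>x. x \<in> V \<Longrightarrow> 0 < w x"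
  shows "(w u + w v) * pattern_weight p a b N R V w \<le>
    w u * pattern_weight p a b N R (V - {v}) (w(u := w u + w v)) +
    w v * pattern_weight p a b N R (V - {u}) (w(v := w u + w v))"
proof -
  define good where "good f \<longleftrightarrow> turan_relation p a b N (\<lambda>x y. R (f x) (f y))" for f :: "'x \<Rightarrow> 'v"
  define to where "to z f = restrict (\<lambda>x. if f x = u \<or> f x = v then z else f x) N"
    for z and f :: "'x \<Rightarrow> 'v"
  define W where "W f = (\<Prod>x\<in>N. w (f x))" for f
  define T where "T f = (\<Prod>x\<in>N. (w(u := w u + w v)) (f x))" for f
  have good_cong: "good f \<longleftrightarrow> good g" if "\<And>x. x \<in> N \<Longrightarrow> f x = g x" for f g
    unfolding good_def by (rule turan_relation_cong) (simp add: that)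
  have good_to: "good (to (f z) f)" if f: "good f" and z: "z \<in> N" "f z = u \<or> f z = v" for f z
    unfolding good_def
  proof (rule turan_relation_twins[OF f[unfolded good_def] z(1)])
    show "x \<in> N \<and> \<not> R (f x) (f z)" if "x \<in> {x \<in> N. f x = u \<or> f x = v}" for x
      using that z R by auto
    show "R (to (f z) f x) (to (f z) f y) \<longleftrightarrow>
        R (f (if x \<in> {x \<in> N. f x = u \<or> f x = v} then z else x))
          (f (if y \<in> {x \<in> N. f x = u \<or> f x = v} then z else y))"
      if "x \<in> N" "y \<in> N" for x y using that unfolding to_def by simp
  qed
  have fib: "(w u + w v) * (\<Sum>f\<in>{f \<in> N \<rightarrow>\<^sub>E V. to u f = g}. of_bool (good f) * W f) \<le>
      w u * (of_bool (good g) * T g) + w v * (of_bool (good (to v g)) * T g)"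
    if g: "g \<in> N \<rightarrow>\<^sub>E V - {v}" for g
  proof -
    \<comment> \<open>The group of \<open>g\<close> is a product set, so that its weights factorize.\<close>
    define S where "S x = (if g x = u then {u, v} else {g x})" for x
    have gV: "g x \<in> V" "g x \<noteq> v" if "x \<in> N" for x using PiE_mem[OF g that] by auto
    have fibre: "{f \<in> N \<rightarrow>\<^sub>E V. to u f = g} = PiE N S"
    proof (intro equalityI subsetI)
      fix f assume f: "f \<in> {f \<in> N \<rightarrow>\<^sub>E V. to u f = g}"
      show "f \<in> PiE N S"
      proof (rule PiE_I)
        fix x assume x: "x \<in> N"
        have "g x = (if f x = u \<or> f x = v then u else f x)" using f x unfolding to_def by auto
        then show "f x \<in> S x" unfolding S_def by auto
      next
        fix x assume "x \<notin> N"
        then show "f x = undefined" using f PiE_arb by force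
      qed
    next
      fix f assume f: "f \<in> PiE N S"
      have fx: "f x \<in> V" "(if f x = u \<or> f x = v then u else f x) = g x" if "x \<in> N" for x
        using PiE_mem[OF f that] gV[OF that] V unfolding S_def by (auto split: if_splits)
      have "f \<in> N \<rightarrow>\<^sub>E V" using fx(1) PiE_arb[OF f] by (intro PiE_I) auto
      moreover have "to u f = g"
        using fx(2) PiE_arb[OF g] unfolding to_def by (intro ext) (simp add: restrict_def)
      ultimately show "f \<in> {f \<in> N \<rightarrow>\<^sub>E V. to u f = g}" by simp
    qed
    have Sfin: "finite (S x)" for x unfolding S_def by simp
    have Ssum: "(\<Sum>y\<in>S x. w y) = (w(u := w u + w v)) (g x)" if "x \<in> N" for x
      using V(4) unfolding S_def by auto
    have Wnn: "0 \<le> W f" if "f \<in> N \<rightarrow>\<^sub>E V" for f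
      unfolding W_def using w PiE_mem[OF that] by (intro prod_nonneg ballI less_imp_le) auto
    have to_v: "to v f = to v g" if "to u f = g" for f
      using V(4) unfolding that[symmetric] to_def by (auto simp: restrict_def fun_eq_iff)
    show ?thesis
    proof (cases "\<exists>z\<in>N. g z = u")
      case False
      then have "S x = {g x}" if "x \<in> N" for x using that unfolding S_def by auto
      then have "PiE N S = PiE N (\<lambda>x. {g x})" by (rule PiE_cong)
      also have "\<dots> = {g}" using g PiE_singleton by (metis PiE_iff)
      finally have "PiE N S = {g}" .
      moreover have "W g = T g" unfolding W_def T_def
        by (rule prod.cong) (use False in auto)
      moreover have "good (to v g) \<longleftrightarrow> good g"
        by (rule good_cong) (use False gV in \<open>auto simp: to_def\<close>)
      ultimately show ?thesis unfolding fibre by (simp add: algebra_simps)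
    next
      case True
      then obtain z where z: "z \<in> N" "g z = u" by blast
      have Sz: "S z = {u, v}" unfolding S_def using z by simp
      define B where "B y = PiE N (S(z := {y}))" for y
      have split: "PiE N S = B u \<union> B v"
        using z Sz unfolding B_def PiE_def Pi_def by (auto split: if_splits)
      have Bz: "f z = y" if "f \<in> B y" for f y using that z unfolding B_def by (auto simp: PiE_iff split: if_splits)
      have Bfin: "finite (B y)" for y unfolding B_def using N Sfin by (intro finite_PiE) auto
      have disj: "B u \<inter> B v = {}" 
        unfolding disjoint_iff using Bz V(4) by metis
      have sumB: "(w u + w v) * (\<Sum>f\<in>B y. W f) = w y * T g" for y
      proof -
        have "(\<Sum>f\<in>B y. W f) = (\<Prod>x\<in>N. \<Sum>y\<in>(S(z := {y})) x. w y)"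
          unfolding B_def W_def using N Sfin by (subst prod_sum_PiE) auto
        also have "\<dots> = w y * (\<Prod>x\<in>N - {z}. \<Sum>y\<in>S x. w y)"
          using N z by (subst prod.remove[of N z]) auto
        also have "(\<Prod>x\<in>N - {z}. \<Sum>y\<in>S x. w y) = (\<Prod>x\<in>N - {z}. (w(u := w u + w v)) (g x))"
          by (rule prod.cong) (auto simp: Ssum)
        finally have "(\<Sum>f\<in>B y. W f) = w y * (\<Prod>x\<in>N - {z}. (w(u := w u + w v)) (g x))" .
        moreover have "T g = (w u + w v) * (\<Prod>x\<in>N - {z}. (w(u := w u + w v)) (g x))"
          unfolding T_def using N z by (subst prod.remove[of N z]) auto
        ultimately show ?thesis by simp
      qed
      have bnd: "(\<Sum>f\<in>B y. of_bool (good f) * W f) \<le> of_bool (good (to y g)) * (\<Sum>f\<in>B y. W f)"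
        if y: "y = u \<or> y = v" for y
        unfolding sum_distrib_left
      proof (rule sum_mono)
        fix f assume f: "f \<in> B y"
        then have f': "f \<in> N \<rightarrow>\<^sub>E V" "to u f = g" using split fibre y by auto
        have "good (to y g)" if "good f"
        proof -
          have "good (to y f)" using good_to[OF that z(1)] Bz[OF f] y by simp
          moreover have "to y f = to y g"
          proof (cases "y = u")
            case True
            have "to u g = g" using PiE_arb[OF g] gV unfolding to_def
              by (intro ext) (auto simp: restrict_def)
            then show ?thesis using True f'(2) by simp
          next
            case False
            then show ?thesis using y to_v[OF f'(2)] by simp
          qed
          ultimately show ?thesis by simp
        qed
        then show "of_bool (good f) * W f \<le> of_bool (good (to y g)) * W f"
          using Wnn[OF f'(1)] by (intro mult_right_mono) auto
      qed
      have pos: "0 \<le> w u + w v" using w V by (simp add: add_nonneg_nonneg less_imp_le)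
      have "to u g = g" using PiE_arb[OF g] gV unfolding to_def
        by (intro ext) (auto simp: restrict_def)
      have "(w u + w v) * (\<Sum>f\<in>PiE N S. of_bool (good f) * W f) =
          (w u + w v) * (\<Sum>f\<in>B u. of_bool (good f) * W f) + (w u + w v) * (\<Sum>f\<in>B v. of_bool (good f) * W f)"
        by (simp only: split sum.union_disjoint[OF Bfin Bfin disj] distrib_left)
      also have "\<dots> \<le> (w u + w v) * (of_bool (good (to u g)) * (\<Sum>f\<in>B u. W f)) +
          (w u + w v) * (of_bool (good (to v g)) * (\<Sum>f\<in>B v. W f))"
        using pos bnd by (intro add_mono mult_left_mono) auto
      also have "\<dots> = of_bool (good g) * ((w u + w v) * (\<Sum>f\<in>B u. W f)) +
          of_bool (good (to v g)) * ((w u + w v) * (\<Sum>f\<in>B v. W f))"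
        unfolding \<open>to u g = g\<close> by (simp only: mult_ac)
      also have "\<dots> = w u * (of_bool (good g) * T g) + w v * (of_bool (good (to v g)) * T g)"
        unfolding sumB by (simp only: mult_ac)
      finally show ?thesis unfolding fibre .
    qed
  qed
  have finV: "finite (N \<rightarrow>\<^sub>E V)" "finite (N \<rightarrow>\<^sub>E V - {v})" using N V by (auto intro: finite_PiE)
  have maps: "to u ` (N \<rightarrow>\<^sub>E V) \<subseteq> N \<rightarrow>\<^sub>E V - {v}"
    using V unfolding to_def by (auto simp: PiE_iff split: if_splits)
  have "(w u + w v) * pattern_weight p a b N R V w =
      (w u + w v) * (\<Sum>f\<in>N \<rightarrow>\<^sub>E V. of_bool (good f) * W f)"
    unfolding pattern_weight_def good_def W_def by simp
  also have "\<dots> = (\<Sum>g\<in>N \<rightarrow>\<^sub>E V - {v}. (w u + w v) *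
      (\<Sum>f\<in>{f \<in> N \<rightarrow>\<^sub>E V. to u f = g}. of_bool (good f) * W f))"
    unfolding sum_distrib_left[symmetric]
    using sum.group[OF finV maps, of "\<lambda>f. of_bool (good f) * W f"] by simp
  also have "\<dots> \<le> (\<Sum>g\<in>N \<rightarrow>\<^sub>E V - {v}. w u * (of_bool (good g) * T g) + w v * (of_bool (good (to v g)) * T g))"
    by (rule sum_mono) (rule fib)
  also have "\<dots> = w u * (\<Sum>g\<in>N \<rightarrow>\<^sub>E V - {v}. of_bool (good g) * T g) +
      w v * (\<Sum>g\<in>N \<rightarrow>\<^sub>E V - {v}. of_bool (good (to v g)) * T g)"
    by (simp only: sum.distrib sum_distrib_left)
  also have "(\<Sum>g\<in>N \<rightarrow>\<^sub>E V - {v}. of_bool (good g) * T g) =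
      pattern_weight p a b N R (V - {v}) (w(u := w u + w v))"
    unfolding pattern_weight_def good_def T_def by simp
  also have "(\<Sum>g\<in>N \<rightarrow>\<^sub>E V - {v}. of_bool (good (to v g)) * T g) =
      (\<Sum>g\<in>N \<rightarrow>\<^sub>E V - {u}. of_bool (good g) * (\<Prod>x\<in>N. (w(v := w u + w v)) (g x)))"
  proof (rule sum.reindex_bij_witness[of _ "to u" "to v"])
    fix g assume g: "g \<in> N \<rightarrow>\<^sub>E V - {v}"
    have gV: "g x \<in> V" "g x \<noteq> v" if "x \<in> N" for x using PiE_mem[OF g that] by auto
    show "to u (to v g) = g" using PiE_arb[OF g] gV unfolding to_def
      by (intro ext) (auto simp: restrict_def)
    show "to v g \<in> N \<rightarrow>\<^sub>E V - {u}" using gV V unfolding to_def by (auto simp: PiE_iff)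
    have "(\<Prod>x\<in>N. (w(v := w u + w v)) (to v g x)) = T g"
      unfolding T_def using gV V(4) by (intro prod.cong refl) (auto simp: to_def)
    then show "of_bool (good (to v g)) * (\<Prod>x\<in>N. (w(v := w u + w v)) (to v g x)) =
        of_bool (good (to v g)) * T g" by simp
  next
    fix g assume g: "g \<in> N \<rightarrow>\<^sub>E V - {u}"
    have gV: "g x \<in> V" "g x \<noteq> u" if "x \<in> N" for x using PiE_mem[OF g that] by auto
    show "to v (to u g) = g" using PiE_arb[OF g] gV unfolding to_def
      by (intro ext) (auto simp: restrict_def)
    show "to u g \<in> N \<rightarrow>\<^sub>E V - {v}" using gV V unfolding to_def by (auto simp: PiE_iff)
  qed
  also have "\<dots> = pattern_weight p a b N R (V - {u}) (w(v := w u + w v))"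
    unfolding pattern_weight_def good_def by simp
  finally show ?thesis .
qed

text \<open>
  Merging nonadjacent vertices deletes vertices from the graph, so the process stops at a clique of
  the original graph, and the weights on this clique are a point of the simplex with at most \<open>l\<close>
  coordinates.
\<close>

theorem pattern_weight_le:
  fixes R :: "'v \<Rightarrow> 'v \<Rightarrow> bool" and N :: "'x set"
  assumes N: "finite N" "card N = p * a + Suc p * b" and p: "0 < p"
    and bound: "\<And>xs. sum_list xs = 1 \<Longrightarrow> (\<And>x. x \<in> set xs \<Longrightarrow> 0 < x) \<Longrightarrow> length xs \<le> l \<Longrightarrow>
      multinomial_factor p a b * power_poly p a b xs \<le> B"
    and sym: "\<And>x y. R x y \<Longrightarrow> R y x" and irr: "\<And>x. \<not> R x x"
    and V: "finite V" and w: "\<And>x. x \<in> V \<Longrightarrow> 0 < w x" "sum w V = 1"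
    and clique: "\<And>C. C \<subseteq> V \<Longrightarrow> (\<And>x y. x \<in> C \<Longrightarrow> y \<in> C \<Longrightarrow> x \<noteq> y \<Longrightarrow> R x y) \<Longrightarrow> card C \<le> l"
  shows "pattern_weight p a b N R V w \<le> B"
  using V w clique
proof (induction "card V" arbitrary: V w rule: less_induct)
  case (less V w)
  show ?case
  proof (cases "\<exists>u\<in>V. \<exists>v\<in>V. u \<noteq> v \<and> \<not> R u v")
    case True
    then obtain u v where uv: "u \<in> V" "v \<in> V" "u \<noteq> v" "\<not> R u v" by blast
    define s where "s = w u + w v"
    have pos: "0 < w u" "0 < w v" "0 < s" using less.prems uv unfolding s_def by (auto intro: add_pos_pos)
    have rest: "pattern_weight p a b N R (V - {y}) (w(x := s)) \<le> B"
      if xy: "x \<in> V" "y \<in> V" "x \<noteq> y" "s = w x + w y" for x y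
    proof (rule less.hyps)
      show "card (V - {y}) < card V" using less.prems(1) xy by (intro psubset_card_mono) auto
      show "finite (V - {y})" using less.prems by simp
      show "0 < (w(x := s)) z" if "z \<in> V - {y}" for z using that less.prems pos by auto
      have "sum (w(x := s)) (V - {y}) = s + sum (w(x := s)) (V - {y} - {x})"
        using less.prems(1) xy by (subst sum.remove[of _ x]) auto
      also have "sum (w(x := s)) (V - {y} - {x}) = sum w (V - {y} - {x})"
        by (rule sum.cong) auto
      also have "s + \<dots> = w y + (w x + sum w (V - {y} - {x}))" using xy by simp
      also have "w x + sum w (V - {y} - {x}) = sum w (V - {y})"
        using less.prems(1) xy by (subst (2) sum.remove[of _ x]) auto
      also have "w y + \<dots> = sum w V" using less.prems(1) xy by (subst (2) sum.remove[of _ y]) auto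
      finally show "sum (w(x := s)) (V - {y}) = 1" using less.prems by simp
      show "card C \<le> l" if "C \<subseteq> V - {y}" "\<And>x y. x \<in> C \<Longrightarrow> y \<in> C \<Longrightarrow> x \<noteq> y \<Longrightarrow> R x y" for C
        using that by (intro less.prems(4)) auto
    qed
    have "s * pattern_weight p a b N R V w \<le>
        w u * pattern_weight p a b N R (V - {v}) (w(u := s)) +
        w v * pattern_weight p a b N R (V - {u}) (w(v := s))"
      unfolding s_def using N(1) less.prems uv irr sym by (intro pattern_weight_merge) auto
    also have "\<dots> \<le> w u * B + w v * B"
      using rest[of u v] rest[of v u] uv pos unfolding s_def
      by (intro add_mono mult_left_mono) auto
    also have "\<dots> = s * B" unfolding s_def by (simp add: distrib_right)
    finally show ?thesis using pos by simp
  next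
    case False
    obtain vs where vs: "set vs = V" "distinct vs" using finite_distinct_list[OF less.prems(1)] by blast
    have "pattern_weight p a b N R (set vs) w = multinomial_factor p a b * power_poly p a b (map w vs)"
      using N p vs False irr by (intro pattern_weight_complete) auto
    also have "\<dots> \<le> B"
    proof (rule bound)
      show "sum_list (map w vs) = 1" using less.prems(3) vs by (simp add: sum_list_distinct_conv_sum_set)
      show "0 < x" if "x \<in> set (map w vs)" for x using that less.prems(2) vs by auto
      have "card V \<le> l" using False by (intro less.prems(4)) auto
      then show "length (map w vs) \<le> l" using vs distinct_card by fastforce
    qed
    finally show ?thesis using vs by simp
  qed
qed

section \<open>Turan graphs as relations\<close>

lemma partition_color_classes:
  assumes P: "partition_on V P"
  obtains c where "color_classes V c = P"
    "\<And>x A. x \<in> A \<Longrightarrow> A \<in> P \<Longrightarrow> c x = A" "\<And>x. x \<in> V \<Longrightarrow> c x \<in> P \<and> x \<in> c x"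
proof -
  define c where "c x = (THE A. A \<in> P \<and> x \<in> A)" for x
  have c: "c x = A" if "x \<in> A" "A \<in> P" for x A
    unfolding c_def using that P by (intro the_equality) (auto simp: partition_on_def disjoint_def)
  have cV: "c x \<in> P \<and> x \<in> c x" if x: "x \<in> V" for x
  proof -
    obtain A where "A \<in> P" "x \<in> A" using x P by (auto simp: partition_on_def)
    then show ?thesis using c by simp
  qed
  have cls: "{y \<in> V. c y = c x} = c x" if x: "x \<in> V" for x
  proof (intro set_eqI iffI)
    fix y assume "y \<in> {y \<in> V. c y = c x}"
    then show "y \<in> c x" using cV by blast
  next
    fix y assume y: "y \<in> c x"
    moreover have "y \<in> V" using y cV[OF x] P by (auto simp: partition_on_def)
    ultimately show "y \<in> {y \<in> V. c y = c x}" using c cV[OF x] by simp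
  qed
  have "color_classes V c = P"
  proof (intro set_eqI iffI)
    fix A assume "A \<in> color_classes V c"
    then show "A \<in> P" unfolding color_classes_def using cls cV by auto
  next
    fix A assume A: "A \<in> P"
    then obtain x where "x \<in> A" using P unfolding partition_on_def by (metis ex_in_conv)
    then have "x \<in> V" "c x = A" using A P c by (auto simp: partition_on_def)
    then show "A \<in> color_classes V c" unfolding color_classes_def using cls by force
  qed
  then show ?thesis using that c cV by blast
qed

text \<open>
  The class sizes take only two consecutive values \<open>m\<close> and \<open>m + 1\<close>, and fewer than \<open>r\<close> classes have the
  larger size. So \<open>m\<close> and the number of larger classes are quotient and remainder of \<open>card V\<close> by \<open>r\<close>.
\<close>

lemma balanced_family_shape:
  assumes P: "partition_on V P" "finite V" "card P = r" "card V = p * r + q" and q: "q < r"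
    and bal: "\<And>A B. A \<in> P \<Longrightarrow> B \<in> P \<Longrightarrow> card A \<le> card B + 1"
  shows "family_shape p (r - q) q P"
proof -
  have finP: "finite P" using P finite_elements by blast
  have "P \<noteq> {}" using q P(3) by auto
  \<comment> \<open>A class of the minimal size exists, so fewer than \<open>r\<close> classes have the larger size.\<close>
  define m where "m = Min (card ` P)"
  have "m \<in> card ` P" unfolding m_def using finP \<open>P \<noteq> {}\<close> by (intro Min_in) auto
  then obtain A0 where A0: "A0 \<in> P" "card A0 = m" by auto
  have lo: "m \<le> card A" if "A \<in> P" for A using that finP unfolding m_def by simp
  have two: "card A = m \<or> card A = Suc m" if "A \<in> P" for A
    using lo[OF that] bal[OF that A0(1)] A0(2) by auto
  define k where "k = card {A \<in> P. card A = Suc m}"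
  have split: "card {A \<in> P. card A = m} + k = r"
  proof -
    have "P = {A \<in> P. card A = m} \<union> {A \<in> P. card A = Suc m}" using two by auto
    then have "card P = card {A \<in> P. card A = m} + k"
      unfolding k_def using finP by (subst card_Un_disjoint[symmetric]) auto
    then show ?thesis using P(3) by simp
  qed
  have "0 < card {A \<in> P. card A = m}" using A0 finP by (auto simp: card_gt_0_iff)
  then have k: "k < r" using split by simp
  have "card V = (\<Sum>A\<in>P. card A)" 
    using product_partition[OF P(1)] P(1,2)
    by (metis finite_subset partition_on_def Sup_upper)
  also have "\<dots> = (\<Sum>A\<in>P. m + (if card A = Suc m then 1 else 0))"
    by (rule sum.cong) (use two in force)+
  also have "\<dots> = m * r + k" using finP P(3) unfolding k_def by (simp add: sum.distrib sum.If_cases Int_def)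
  finally have "m * r + k = p * r + q" using P(4) by simp
  moreover have "m = (m * r + k) div r" using k by simp
  moreover have "p = (p * r + q) div r" using q by simp
  ultimately have "m = p" by simp
  then have "k = q" using \<open>m * r + k = p * r + q\<close> by simp
  then show ?thesis using split two unfolding family_shape_def k_def \<open>m = p\<close> by auto
qed

lemma turan_graph_relation:
  assumes F: "is_turan_graph s r F" and s: "s = p * r + q" "q < r"
  shows "turan_relation p (r - q) q (pverts F) (\<lambda>x y. (x, y) \<in> parcs F)"
proof -
  from F interpret pair_graph F by (simp add: is_turan_graph_def)
  obtain P where P: "partition_on (pverts F) P" "card P = r"
    and arcs: "parcs F = {(u, v). \<exists>A\<in>P. \<exists>B\<in>P. A \<noteq> B \<and> u \<in> A \<and> v \<in> B}"
    and bal: "\<forall>A\<in>P. \<forall>B\<in>P. card A \<le> card B + 1" and cV: "card (pverts F) = s"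
    using F unfolding is_turan_graph_def by blast
  obtain c where c: "color_classes (pverts F) c = P"
    "\<And>x A. x \<in> A \<Longrightarrow> A \<in> P \<Longrightarrow> c x = A" "\<And>x. x \<in> pverts F \<Longrightarrow> c x \<in> P \<and> x \<in> c x"
    using partition_color_classes[OF P(1)] by blast
  have "family_shape p (r - q) q P"
    using balanced_family_shape[OF P(1) pair_finite_verts P(2)] cV s bal by blast
  moreover have "(x, y) \<in> parcs F \<longleftrightarrow> c x \<noteq> c y" if "x \<in> pverts F" "y \<in> pverts F" for x y
  proof
    assume "(x, y) \<in> parcs F"
    then obtain A B where "A \<in> P" "B \<in> P" "A \<noteq> B" "x \<in> A" "y \<in> B" unfolding arcs by blast
    then show "c x \<noteq> c y" using c(2) by metis
  next
    assume "c x \<noteq> c y"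
    then show "(x, y) \<in> parcs F" unfolding arcs using c(3) that by blast
  qed
  ultimately show ?thesis
    using turan_relation_coloring[of "pverts F" "\<lambda>x y. (x, y) \<in> parcs F" c] c(1) by simp
qed

lemma turan_relation_bij:
  assumes f: "bij_betw f N N'"
    and E: "\<And>x y. x \<in> N \<Longrightarrow> y \<in> N \<Longrightarrow> E x y \<longleftrightarrow> E' (f x) (f y)"
  shows "turan_relation p a b N E \<longleftrightarrow> turan_relation p a b N' E'"
proof -
  have imp: "turan_relation p a b N' E'"
    if f: "bij_betw f N N'" and E: "\<And>x y. x \<in> N \<Longrightarrow> y \<in> N \<Longrightarrow> E x y \<longleftrightarrow> E' (f x) (f y)"
      and t: "turan_relation p a b N E"
    for f :: "'u \<Rightarrow> 'w" and N :: "'u set" and N' and E and E'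
  proof -
    obtain c :: "'u \<Rightarrow> 'u set" where c: "class_shape p a b N c"
      and Ec: "\<forall>x\<in>N. \<forall>y\<in>N. E x y \<longleftrightarrow> c x \<noteq> c y"
      using t unfolding turan_relation_def by blast
    define g where "g = inv_into N f"
    have gf: "g (f x) = x" if "x \<in> N" for x
      unfolding g_def using bij_betw_inv_into_left[OF f that] .
    have N': "N' = f ` N" using f by (simp add: bij_betw_def)
    have inj: "inj_on f N" using f by (simp add: bij_betw_def)
    define C where "C = color_classes N c"
    have sub: "A \<subseteq> N" if "A \<in> C" for A using that unfolding C_def color_classes_def by auto
    have cls: "color_classes N' (c \<circ> g) = (`) f ` C"
    proof -
      have "{y \<in> N'. (c \<circ> g) y = (c \<circ> g) (f x)} = f ` {y \<in> N. c y = c x}" if "x \<in> N" for x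
        using that gf unfolding N' by auto
      then show ?thesis unfolding color_classes_def C_def N' image_image
        by (intro image_cong) auto
    qed
    have injC: "inj_on ((`) f) C"
      using inj_on_image_Pow[OF inj] sub by (auto intro: inj_on_subset)
    have cardf: "card (f ` A) = card A" if "A \<in> C" for A
      by (rule card_image) (rule inj_on_subset[OF inj sub[OF that]])
    have "{B \<in> (`) f ` C. card B = n} = (`) f ` {A \<in> C. card A = n}" for n
      using cardf by auto
    then have "card {B \<in> (`) f ` C. card B = n} = card {A \<in> C. card A = n}" for n
      using card_image[OF inj_on_subset[OF injC], of "{A \<in> C. card A = n}"] by auto
    then have "class_shape p a b N' (c \<circ> g)"
      using c cardf unfolding cls C_def[symmetric] family_shape_def by auto
    moreover have "E' x y \<longleftrightarrow> (c \<circ> g) x \<noteq> (c \<circ> g) y" if "x \<in> N'" "y \<in> N'" for x y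
      using that Ec E gf unfolding N' by auto
    ultimately show ?thesis using turan_relation_coloring[of N' E' "c \<circ> g"] by blast
  qed
  have fi: "f (inv_into N f y) = y" "inv_into N f y \<in> N" if "y \<in> N'" for y
    using bij_betw_inv_into_right[OF f that] bij_betw_apply[OF bij_betw_inv_into[OF f] that] by auto
  show ?thesis
  proof
    assume "turan_relation p a b N E"
    then show "turan_relation p a b N' E'" by (rule imp[OF f, rotated]) (rule E)
  next
    assume "turan_relation p a b N' E'"
    then show "turan_relation p a b N E"
      by (rule imp[OF bij_betw_inv_into[OF f], rotated]) (simp add: E fi)
  qed
qed

text \<open>
  Two colorings of the same shape admit a bijection between their classes that preserves the size;
  bijections between corresponding classes then combine to an isomorphism.
\<close>

lemma turan_relation_unique:
  assumes N: "finite N" "finite N'"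
    and t: "turan_relation p a b N E" "turan_relation p a b N' E'"
  shows "\<exists>f. bij_betw f N N' \<and> (\<forall>x\<in>N. \<forall>y\<in>N. E x y \<longleftrightarrow> E' (f x) (f y))"
proof -
  obtain c :: "'a \<Rightarrow> 'a set" where c: "class_shape p a b N c"
    and E: "\<forall>x\<in>N. \<forall>y\<in>N. E x y \<longleftrightarrow> c x \<noteq> c y"
    using t(1) unfolding turan_relation_def by blast
  obtain c' :: "'b \<Rightarrow> 'b set" where c': "class_shape p a b N' c'"
    and E': "\<forall>x\<in>N'. \<forall>y\<in>N'. E' x y \<longleftrightarrow> c' x \<noteq> c' y"
    using t(2) unfolding turan_relation_def by blast
  define cl where "cl x = {y \<in> N. c y = c x}" for x
  define cl' where "cl' x = {y \<in> N'. c' y = c' x}" for x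
  define C where "C = color_classes N c"
  define C' where "C' = color_classes N' c'"
  have C: "C = cl ` N" and C': "C' = cl' ` N'"
    unfolding C_def C'_def color_classes_def cl_def cl'_def by auto
  have fin: "finite C" "finite C'" using N unfolding C C' by auto
  have shape: "family_shape p a b C" "family_shape p a b C'" using c c' unfolding C_def C'_def .
  have level: "\<exists>h. bij_betw h {A \<in> C. card A = n} {A \<in> C'. card A = n}" if "n = p \<or> n = Suc p" for n
    using that shape fin unfolding family_shape_def by (intro finite_same_card_bij) auto
  obtain h0 h1 where h0: "bij_betw h0 {A \<in> C. card A = p} {A \<in> C'. card A = p}"
    and h1: "bij_betw h1 {A \<in> C. card A = Suc p} {A \<in> C'. card A = Suc p}"
    using level[of p] level[of "Suc p"] by blast
  define h where "h A = (if card A = p then h0 A else h1 A)" for A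
  have "bij_betw h ({A \<in> C. card A = p} \<union> {A \<in> C. card A = Suc p})
      ({A \<in> C'. card A = p} \<union> {A \<in> C'. card A = Suc p})"
  proof (rule bij_betw_combine)
    show "bij_betw h {A \<in> C. card A = p} {A \<in> C'. card A = p}"
      using h0 by (rule bij_betw_cong[THEN iffD1, rotated]) (simp add: h_def)
    show "bij_betw h {A \<in> C. card A = Suc p} {A \<in> C'. card A = Suc p}"
      using h1 by (rule bij_betw_cong[THEN iffD1, rotated]) (simp add: h_def)
  qed auto
  moreover have "{A \<in> C. card A = p} \<union> {A \<in> C. card A = Suc p} = C"
    "{A \<in> C'. card A = p} \<union> {A \<in> C'. card A = Suc p} = C'"
    using shape unfolding family_shape_def by auto
  ultimately have h: "bij_betw h C C'" by simp
  have hcard: "card (h A) = card A" if "A \<in> C" for A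
  proof (cases "card A = p")
    case True
    then show ?thesis using bij_betw_apply[OF h0, of A] that unfolding h_def by auto
  next
    case False
    then have "card A = Suc p" using shape(1) that unfolding family_shape_def by auto
    then show ?thesis using bij_betw_apply[OF h1, of A] that False unfolding h_def by auto
  qed
  have finA: "finite A" if "A \<in> C" for A using that N(1) unfolding C cl_def by auto
  have finB: "finite A" if "A \<in> C'" for A using that N(2) unfolding C' cl'_def by auto
  have "\<exists>g. bij_betw g A (h A)" if "A \<in> C" for A
    using that finA finB[OF bij_betw_apply[OF h that]] hcard[OF that] by (intro finite_same_card_bij) auto
  then obtain g where g: "\<And>A. A \<in> C \<Longrightarrow> bij_betw (g A) A (h A)" by metis
  define f where "f x = g (cl x) x" for x
  have cl: "cl x \<in> C" "x \<in> cl x" if "x \<in> N" for x using that unfolding C cl_def by auto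
  have hcl: "h (cl x) \<in> C'" if "x \<in> N" for x using bij_betw_apply[OF h cl(1)[OF that]] .
  have fx: "f x \<in> h (cl x)" if "x \<in> N" for x
    unfolding f_def using bij_betw_apply[OF g[OF cl(1)[OF that]] cl(2)[OF that]] .
  have cl'_eq: "y \<in> N' \<and> cl' y = B" if "y \<in> B" "B \<in> C'" for y B
  proof -
    from that(2) obtain x where x: "B = cl' x" unfolding C' by blast
    show ?thesis using that(1) unfolding x cl'_def by simp
  qed
  have fN': "f x \<in> N'" "cl' (f x) = h (cl x)" if "x \<in> N" for x
    using cl'_eq[OF fx[OF that] hcl[OF that]] by auto
  have cl_eq: "cl y = A" if "y \<in> A" "A \<in> C" for y A
  proof -
    from that(2) obtain x where x: "A = cl x" unfolding C by blast
    show ?thesis using that(1) unfolding x cl_def by simp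
  qed
  have bij: "bij_betw f N N'"
  proof (rule bij_betwI')
    fix x y assume xy: "x \<in> N" "y \<in> N"
    show "f x = f y \<longleftrightarrow> x = y"
    proof
      assume eq: "f x = f y"
      then have "h (cl x) = h (cl y)" using fN' xy by metis
      then have "cl x = cl y" using h cl xy by (meson bij_betw_def inj_onD)
      then show "x = y" using eq g[OF cl(1)[OF xy(1)]] cl(2) xy unfolding f_def
        by (metis bij_betw_def inj_onD)
    qed simp
  next
    fix x assume "x \<in> N" then show "f x \<in> N'" by (rule fN')
  next
    fix y assume y: "y \<in> N'"
    then have yC: "cl' y \<in> C'" "y \<in> cl' y" unfolding C' cl'_def by auto
    then obtain A where A: "A \<in> C" "h A = cl' y" using h by (metis bij_betw_def imageE)
    then obtain x where x: "x \<in> A" "g A x = y" using g[OF A(1)] yC by (metis bij_betw_def imageE)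
    then have "cl x = A" using A cl_eq by blast
    moreover have "x \<in> N" using x(1) A(1) unfolding C cl_def by blast
    ultimately have "x \<in> N" "cl x = A" by simp_all
    then show "\<exists>x\<in>N. y = f x" using x unfolding f_def by auto
  qed
  have "E x y \<longleftrightarrow> E' (f x) (f y)" if xy: "x \<in> N" "y \<in> N" for x y
  proof -
    have "c x = c y \<longleftrightarrow> cl x = cl y" using cl(2)[OF xy(1)] unfolding cl_def by auto
    then have "E x y \<longleftrightarrow> cl x \<noteq> cl y" using E xy by blast
    also have "\<dots> \<longleftrightarrow> h (cl x) \<noteq> h (cl y)" using h cl(1) xy by (metis bij_betw_def inj_onD)
    also have "\<dots> \<longleftrightarrow> cl' (f x) \<noteq> cl' (f y)" using fN' xy by simp
    also have "\<dots> \<longleftrightarrow> c' (f x) \<noteq> c' (f y)" using fN'(1)[OF xy(1)] unfolding cl'_def by auto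
    also have "\<dots> \<longleftrightarrow> E' (f x) (f y)" using E' fN'(1) xy by blast
    finally show ?thesis .
  qed
  with bij show ?thesis by blast
qed

lemma turan_graph_iso_iff:
  assumes F: "is_turan_graph s r F" and s: "s = p * r + q" "q < r" and H: "pair_graph H"
  shows "digraph_iso (with_proj F) (with_proj H) \<longleftrightarrow>
     turan_relation p (r - q) q (pverts H) (\<lambda>x y. (x, y) \<in> parcs H)"
proof -
  have pF: "pair_graph F" using F by (simp add: is_turan_graph_def)
  have fin: "finite (pverts F)" "finite (pverts H)"
    using pF H pair_graph.axioms(1) pair_digraph.axioms(1) pair_fin_digraph.pair_finite_verts by blast+
  note tF = turan_graph_relation[OF F s]
  show ?thesis unfolding digraph_iso_pair_graph_iff[OF pF H]
  proof
    assume "turan_relation p (r - q) q (pverts H) (\<lambda>x y. (x, y) \<in> parcs H)"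
    from turan_relation_unique[OF fin tF this]
    show "\<exists>f. bij_betw f (pverts F) (pverts H) \<and>
      (\<forall>u\<in>pverts F. \<forall>v\<in>pverts F. (u, v) \<in> parcs F \<longleftrightarrow> (f u, f v) \<in> parcs H)" .
  next
    assume "\<exists>f. bij_betw f (pverts F) (pverts H) \<and>
      (\<forall>u\<in>pverts F. \<forall>v\<in>pverts F. (u, v) \<in> parcs F \<longleftrightarrow> (f u, f v) \<in> parcs H)"
    then obtain f where f: "bij_betw f (pverts F) (pverts H)"
      and arcs: "\<And>u v. u \<in> pverts F \<Longrightarrow> v \<in> pverts F \<Longrightarrow> (u, v) \<in> parcs F \<longleftrightarrow> (f u, f v) \<in> parcs H"
      by blast
    have "turan_relation p (r - q) q (pverts F) (\<lambda>x y. (x, y) \<in> parcs F) \<longleftrightarrow>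
        turan_relation p (r - q) q (pverts H) (\<lambda>x y. (x, y) \<in> parcs H)"
      by (rule turan_relation_bij[OF f]) (rule arcs)
    with tF show "turan_relation p (r - q) q (pverts H) (\<lambda>x y. (x, y) \<in> parcs H)" by simp
  qed
qed

section \<open>Limits of maximal induced densities\<close>

definition embeddings :: "nat \<Rightarrow> nat \<Rightarrow> nat \<Rightarrow> nat \<Rightarrow> 'v pair_pre_digraph \<Rightarrow> (nat \<Rightarrow> 'v) set" where
  "embeddings s p a b G = {f \<in> {..<s} \<rightarrow>\<^sub>E pverts G. inj_on f {..<s} \<and>
     turan_relation p a b {..<s} (\<lambda>x y. (f x, f y) \<in> parcs G)}"

lemma card_injections:
  assumes "finite S"
  shows "card {f \<in> {..<s} \<rightarrow>\<^sub>E S. inj_on f {..<s}} = fact s * (card S choose s)"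
proof (cases "s \<le> card S")
  case True
  have "card {f \<in> {..<s} \<rightarrow>\<^sub>E S. inj_on f {..<s}} = prod ((-) (card S)) {0..<s}"
    using card_inj_on_subset_funcset[of "{..<s}" S "{..<s}"] assms by simp
  moreover have "real (prod ((-) (card S)) {0..<s}) = real (fact s * (card S choose s))"
  proof -
    have "real (prod ((-) (card S)) {0..<s}) = (\<Prod>i = 0..<s. real (card S) - real i)"
      using True by (simp add: of_nat_diff)
    then show ?thesis by (simp add: gbinomial_mult_fact[symmetric] binomial_gbinomial)
  qed
  ultimately show ?thesis by (metis of_nat_eq_iff)
next
  case False
  have "{f \<in> {..<s} \<rightarrow>\<^sub>E S. inj_on f {..<s}} = {}"
    using False assms card_inj[of _ "{..<s}" S] by (auto simp: PiE_def)
  then show ?thesis using False by (simp only: card.empty) simp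
qed

lemma induced_subgraph_pair:
  assumes "pair_graph G" "S \<subseteq> pverts G"
  defines "H \<equiv> \<lparr>pverts = S, parcs = {(u, v) \<in> parcs G. u \<in> S \<and> v \<in> S}\<rparr>"
  shows "with_proj G \<restriction> S = with_proj H" "pair_graph H"
proof -
  interpret pair_graph G by fact
  show "with_proj G \<restriction> S = with_proj H"
    unfolding H_def with_proj_def induce_subgraph_def by auto
  have sym: "(v, u) \<in> parcs G" if "(u, v) \<in> parcs G" for u v
    using that pair_sym_arcs by (auto simp: symmetric_def sym_def)
  have finS: "finite S" using assms(2) pair_finite_verts finite_subset by blast
  show "pair_graph H"
  proof
    show "finite (parcs H)" using pair_finite_arcs 
      by (rule finite_subset[rotated]) (auto simp: H_def)
    show "symmetric (with_proj H)" unfolding H_def symmetric_def sym_def using sym by auto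
  qed (use finS pair_no_loops in \<open>auto simp: H_def\<close>)
qed

text \<open>
  Each vertex set that induces a copy is the image of exactly \<open>fact s\<close> embeddings.
\<close>

lemma induced_copies_embeddings:
  assumes F: "is_turan_graph s r F" and s: "s = p * r + q" "q < r" and G: "pair_graph G"
  shows "fact s * induced_copies F G = card (embeddings s p (r - q) q G)"
proof -
  define copies where "copies = {S. S \<subseteq> pverts G \<and> card S = s \<and>
      turan_relation p (r - q) q S (\<lambda>x y. (x, y) \<in> parcs G)}"
  define inj where "inj S = {f \<in> {..<s} \<rightarrow>\<^sub>E S. inj_on f {..<s}}" for S :: "'b set"
  have finG: "finite (pverts G)"
    using G pair_graph.axioms(1) pair_digraph.axioms(1) pair_fin_digraph.pair_finite_verts by blast
  have cF: "card (pverts F) = s" using F by (simp add: is_turan_graph_def)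
  have iso: "digraph_iso (with_proj F) (with_proj G \<restriction> S) \<longleftrightarrow>
      turan_relation p (r - q) q S (\<lambda>x y. (x, y) \<in> parcs G)" if "S \<subseteq> pverts G" for S
    unfolding induced_subgraph_pair(1)[OF G that]
      turan_graph_iso_iff[OF F s induced_subgraph_pair(2)[OF G that]]
    by (simp, rule turan_relation_cong) simp
  have "{S. S \<subseteq> pverts G \<and> card S = card (pverts F) \<and>
      digraph_iso (with_proj F) (with_proj G \<restriction> S)} = copies"
    unfolding copies_def cF using iso by (intro Collect_cong) blast
  then have "induced_copies F G = card copies" unfolding induced_copies_def by simp
  have img: "bij_betw f {..<s} S" if "f \<in> inj S" "S \<in> copies" for f S
  proof -
    have f: "inj_on f {..<s}" "f ` {..<s} \<subseteq> S" using that(1) unfolding inj_def by auto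
    have "finite S" "card S = s"
      using that(2) finite_subset[OF _ finG] unfolding copies_def by blast+
    then have "f ` {..<s} = S" using f by (intro card_subset_eq) (auto simp: card_image)
    then show ?thesis using f(1) by (simp add: bij_betw_def)
  qed
  have "embeddings s p (r - q) q G = (\<Union>S\<in>copies. inj S)"
  proof (intro equalityI subsetI)
    fix f assume f: "f \<in> embeddings s p (r - q) q G"
    define S where "S = f ` {..<s}"
    have "bij_betw f {..<s} S" using f unfolding S_def embeddings_def bij_betw_def by auto
    from turan_relation_bij[OF this, of "\<lambda>x y. (f x, f y) \<in> parcs G" "\<lambda>x y. (x, y) \<in> parcs G"]
    have "turan_relation p (r - q) q S (\<lambda>x y. (x, y) \<in> parcs G)"
      using f unfolding embeddings_def by auto
    moreover have "S \<subseteq> pverts G" "card S = s"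
      using f unfolding S_def embeddings_def by (auto simp: card_image)
    moreover have "f \<in> inj S" using f unfolding inj_def S_def embeddings_def by (auto simp: PiE_iff)
    ultimately show "f \<in> (\<Union>S\<in>copies. inj S)" unfolding copies_def by blast
  next
    fix f assume "f \<in> (\<Union>S\<in>copies. inj S)"
    then obtain S where S: "S \<in> copies" and f: "f \<in> inj S" by blast
    have "turan_relation p (r - q) q {..<s} (\<lambda>x y. (f x, f y) \<in> parcs G)"
      using turan_relation_bij[OF img[OF f S], of "\<lambda>x y. (f x, f y) \<in> parcs G" "\<lambda>x y. (x, y) \<in> parcs G"] S
      unfolding copies_def by auto
    then show "f \<in> embeddings s p (r - q) q G"
      using f S unfolding embeddings_def inj_def copies_def by (auto simp: PiE_iff)
  qed
  moreover have "card (\<Union>S\<in>copies. inj S) = (\<Sum>S\<in>copies. card (inj S))"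
  proof (rule card_UN_disjoint)
    show "finite copies" unfolding copies_def using finG by auto
    show "\<forall>S\<in>copies. finite (inj S)"
    proof
      fix S assume "S \<in> copies"
      then have "finite S" using finite_subset[OF _ finG] unfolding copies_def by blast
      then have "finite ({..<s} \<rightarrow>\<^sub>E S)" by (intro finite_PiE) auto
      then show "finite (inj S)" unfolding inj_def by simp
    qed
    show "\<forall>S\<in>copies. \<forall>T\<in>copies. S \<noteq> T \<longrightarrow> inj S \<inter> inj T = {}"
      using img unfolding bij_betw_def by blast
  qed
  moreover have "card (inj S) = fact s" if "S \<in> copies" for S
  proof -
    have "finite S" "card S = s"
      using that finite_subset[OF _ finG] unfolding copies_def by blast+
    then show ?thesis unfolding inj_def by (simp add: card_injections)
  qed
  ultimately show ?thesis using \<open>induced_copies F G = card copies\<close> by simp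
qed

text \<open>
  Embeddings are among all maps that induce the Turan relation, and the latter are counted by
  \<open>pattern_weight\<close> with all weights equal to \<open>1 / n\<close>. The last factor, which tends to \<open>1\<close>, is the price for the
  maps that are not injective.
\<close>

lemma induced_density_le:
  assumes F: "is_turan_graph s r F" and s: "s = p * r + q" "q < r" "0 < p" and G: "pair_graph G"
    and n: "card (pverts G) = n" "0 < n" "s \<le> n"
    and bound: "\<And>xs. sum_list xs = 1 \<Longrightarrow> (\<And>x. x \<in> set xs \<Longrightarrow> 0 < x) \<Longrightarrow> length xs \<le> l \<Longrightarrow>
      multinomial_factor p (r - q) q * power_poly p (r - q) q xs \<le> B"
    and clique: "\<And>C. C \<subseteq> pverts G \<Longrightarrow>
      (\<And>x y. x \<in> C \<Longrightarrow> y \<in> C \<Longrightarrow> x \<noteq> y \<Longrightarrow> (x, y) \<in> parcs G) \<Longrightarrow> card C \<le> l"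
  shows "induced_density F G \<le> B * (real n ^ s / (fact s * real (n choose s)))"
proof -
  interpret pair_graph G by fact
  define M where "M = {f \<in> {..<s} \<rightarrow>\<^sub>E pverts G.
      turan_relation p (r - q) q {..<s} (\<lambda>x y. (f x, f y) \<in> parcs G)}"
  have finE: "finite ({..<s} \<rightarrow>\<^sub>E pverts G)" using pair_finite_verts by (intro finite_PiE) auto
  have eq: "pattern_weight p (r - q) q {..<s} (\<lambda>x y. (x, y) \<in> parcs G) (pverts G) (\<lambda>_. 1 / real n) =
      real (card M) * (1 / real n) ^ s"
    unfolding pattern_weight_def M_def using finE
    by (simp add: sum_distrib_right[symmetric] Int_def del: power_one_over)
  have "pattern_weight p (r - q) q {..<s} (\<lambda>x y. (x, y) \<in> parcs G) (pverts G) (\<lambda>_. 1 / real n) \<le> B"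
  proof (rule pattern_weight_le[where l = l])
    have "p * (r - q) + Suc p * q = p * ((r - q) + q) + q" by (simp only: distrib_left) simp
    then show "card {..<s} = p * (r - q) + Suc p * q" using s by simp
    show "(y, x) \<in> parcs G" if "(x, y) \<in> parcs G" for x y
      using that pair_sym_arcs by (auto simp: symmetric_def sym_def)
    show "(x, x) \<notin> parcs G" for x using pair_no_loops by force
    show "(\<Sum>x\<in>pverts G. 1 / real n) = 1" using n by simp
  qed (use s n bound clique pair_finite_verts in auto)
  then have "real (card M) * (1 / real n) ^ s * real n ^ s \<le> B * real n ^ s"
    unfolding eq by (rule mult_right_mono) simp
  then have M: "real (card M) \<le> B * real n ^ s" using n by (simp add: power_divide)
  have "embeddings s p (r - q) q G \<subseteq> M" unfolding embeddings_def M_def by auto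
  then have "card (embeddings s p (r - q) q G) \<le> card M"
    using finE unfolding M_def by (intro card_mono) auto
  then have "fact s * real (induced_copies F G) \<le> B * real n ^ s"
    using M induced_copies_embeddings[OF F s(1,2) G] by (metis of_nat_fact of_nat_mult of_nat_le_iff order_trans)
  then have "fact s * real (induced_copies F G) / (fact s * real (n choose s)) \<le>
      B * real n ^ s / (fact s * real (n choose s))"
    by (rule divide_right_mono) simp
  moreover have "card (pverts F) = s" using F by (simp add: is_turan_graph_def)
  ultimately show ?thesis unfolding induced_density_def n(1) by simp
qed

lemma clique_free_card_le:
  assumes G: "pair_graph G" "clique_free k G" and C: "C \<subseteq> pverts G"
    "\<And>x y. x \<in> C \<Longrightarrow> y \<in> C \<Longrightarrow> x \<noteq> y \<Longrightarrow> (x, y) \<in> parcs G"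
  shows "card C \<le> k - 1"
proof (rule ccontr)
  interpret pair_graph G by fact
  assume "\<not> card C \<le> k - 1"
  then have "k \<le> card C" by simp
  then obtain D where D: "D \<subseteq> C" "card D = k" "finite D" by (rule obtain_subset_with_card_n)
  define H where "H = \<lparr>pverts = D, parcs = {(u, v). (u, v) \<in> D \<times> D \<and> u \<noteq> v}\<rparr>"
  have K: "complete_digraph k (with_proj H)"
    unfolding complete_digraph_pair_def H_def using D by simp
  have "subgraph (with_proj H) (with_proj G)"
    unfolding subgraph_def
  proof (intro conjI)
    show "verts (with_proj H) \<subseteq> verts (with_proj G)" using D C unfolding H_def by auto
    have "(x, y) \<in> parcs G" if "x \<in> D" "y \<in> D" "x \<noteq> y" for x y using C(2) D(1) that by blast
    then show "arcs (with_proj H) \<subseteq> arcs (with_proj G)" unfolding H_def by auto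
    show "wf_digraph (with_proj G)" unfolding wf_digraph_wp_iff by unfold_locales
    show "wf_digraph (with_proj H)" unfolding wf_digraph_wp_iff H_def by unfold_locales auto
    show "compatible (with_proj G) (with_proj H)" unfolding compatible_def by simp
  qed
  with K G(2) show False unfolding clique_free_def by blast
qed

definition balanced_host :: "nat \<Rightarrow> nat \<Rightarrow> nat pair_pre_digraph" where
  "balanced_host m n =
     \<lparr>pverts = {..<n}, parcs = {(u, v). u < n \<and> v < n \<and> u mod m \<noteq> v mod m}\<rparr>"

lemma pair_graph_balanced_host: "pair_graph (balanced_host m n)"
  unfolding balanced_host_def
  by unfold_locales
    (auto simp: symmetric_def sym_def intro: finite_subset[of _ "{..<n} \<times> {..<n}"])

lemma clique_free_balanced_host:
  assumes m: "0 < m" "m < k"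
  shows "clique_free k (balanced_host m n)"
  unfolding clique_free_def
proof
  assume "\<exists>H. subgraph H (with_proj (balanced_host m n)) \<and> complete_digraph k H"
  then obtain H where H: "subgraph H (with_proj (balanced_host m n))" "complete_digraph k H" by blast
  have "inj_on (\<lambda>u. u mod m) (verts H)"
  proof (rule inj_onI, rule ccontr)
    fix u v assume uv: "u \<in> verts H" "v \<in> verts H" "u mod m = v mod m" "u \<noteq> v"
    then have "(u, v) \<in> arcs_ends H" using H(2) unfolding complete_digraph_def by auto
    then obtain e where e: "e \<in> arcs H" "tail H e = u" "head H e = v"
      unfolding arcs_ends_def arc_to_ends_def by auto
    have "tail H = fst" "head H = snd" "arcs H \<subseteq> parcs (balanced_host m n)"
      using H(1) unfolding subgraph_def compatible_def by auto
    then have "(u, v) \<in> parcs (balanced_host m n)" using e by (metis prod.collapse subsetD)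
    then show False using uv(3) unfolding balanced_host_def by simp
  qed
  then have "card (verts H) = card ((\<lambda>u. u mod m) ` verts H)" by (simp add: card_image)
  also have "\<dots> \<le> card {..<m}" using m by (intro card_mono) auto
  finally show False using H(2) m unfolding complete_digraph_def by simp
qed

text \<open>
  A coloring \<open>c\<close> of the right shape and an injective \<open>y\<close> give the embedding \<open>\<lambda>i. m * y i + c i\<close>, whose residues
  modulo \<open>m\<close> are the colors.
\<close>

lemma card_embeddings_balanced_host:
  assumes m: "0 < m"
  shows "card {c \<in> {..<s} \<rightarrow>\<^sub>E {..<m}. class_shape p a b {..<s} c} * (fact s * ((n div m) choose s)) \<le>
    card (embeddings s p a b (balanced_host m n))"
proof -
  define A where "A = {c \<in> {..<s} \<rightarrow>\<^sub>E {..<m}. class_shape p a b {..<s} c}"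
  define Y where "Y = {y \<in> {..<s} \<rightarrow>\<^sub>E {..<n div m}. inj_on y {..<s}}"
  define h where "h = (\<lambda>(c, y). restrict (\<lambda>i. m * y i + c i :: nat) {..<s})"
  have dm: "(m * y + c) mod m = c" "(m * y + c) div m = y" if "c < m" for y c using that by auto
  have "inj_on h (A \<times> Y)"
  proof (rule inj_onI, clarify)
    fix c y c' y' assume cy: "c \<in> A" "y \<in> Y" "c' \<in> A" "y' \<in> Y" and eq: "h (c, y) = h (c', y')"
    have ext: "c \<in> {..<s} \<rightarrow>\<^sub>E {..<m}" "c' \<in> {..<s} \<rightarrow>\<^sub>E {..<m}" "y \<in> {..<s} \<rightarrow>\<^sub>E {..<n div m}"
      "y' \<in> {..<s} \<rightarrow>\<^sub>E {..<n div m}" using cy unfolding A_def Y_def by auto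
    have "c i = c' i \<and> y i = y' i" if i: "i \<in> {..<s}" for i
    proof -
      have "m * y i + c i = m * y' i + c' i" using fun_cong[OF eq, of i] i unfolding h_def by simp
      moreover have "c i < m" "c' i < m" using ext(1,2) i by auto
      ultimately show ?thesis using dm by metis
    qed
    then show "c = c' \<and> y = y'" using PiE_ext[OF ext(1,2)] PiE_ext[OF ext(3,4)] by blast
  qed
  moreover have "h ` (A \<times> Y) \<subseteq> embeddings s p a b (balanced_host m n)"
  proof (rule image_subsetI, clarify)
    fix c y assume c: "c \<in> A" and y: "y \<in> Y"
    have ci: "c i < m" if "i < s" for i using c that unfolding A_def by auto
    have yi: "y i < n div m" if "i < s" for i using y that unfolding Y_def by auto
    have lt: "m * y i + c i < n" if "i < s" for i
    proof -
      have "m * y i + c i < m * Suc (y i)" using ci[OF that] by simp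
      also have "\<dots> \<le> m * (n div m)" using yi[OF that] by (intro mult_le_mono2) simp
      also have "\<dots> \<le> n" by simp
      finally show ?thesis .
    qed
    have "inj_on (h (c, y)) {..<s}"
    proof (rule inj_onI)
      fix i j assume ij: "i \<in> {..<s}" "j \<in> {..<s}" "h (c, y) i = h (c, y) j"
      then have "m * y i + c i = m * y j + c j" unfolding h_def by simp
      then have "y i = y j" using dm(2)[OF ci] ij by (metis lessThan_iff)
      then show "i = j" using y ij unfolding Y_def inj_on_def by auto
    qed
    moreover have "turan_relation p a b {..<s}
        (\<lambda>i j. (h (c, y) i, h (c, y) j) \<in> parcs (balanced_host m n))"
    proof (rule turan_relation_coloring[THEN iffD2])
      show "class_shape p a b {..<s} c" using c unfolding A_def by simp
      show "(h (c, y) i, h (c, y) j) \<in> parcs (balanced_host m n) \<longleftrightarrow> c i \<noteq> c j"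
        if "i \<in> {..<s}" "j \<in> {..<s}" for i j
        using that lt ci unfolding h_def balanced_host_def by simp
    qed
    moreover have "h (c, y) \<in> {..<s} \<rightarrow>\<^sub>E pverts (balanced_host m n)"
      using lt unfolding h_def balanced_host_def by auto
    ultimately show "h (c, y) \<in> embeddings s p a b (balanced_host m n)"
      unfolding embeddings_def by blast
  qed
  moreover have "finite (embeddings s p a b (balanced_host m n))"
    by (rule finite_subset[of _ "{..<s} \<rightarrow>\<^sub>E pverts (balanced_host m n)"])
      (auto simp: embeddings_def balanced_host_def intro!: finite_PiE)
  ultimately have "card (A \<times> Y) \<le> card (embeddings s p a b (balanced_host m n))"
    by (rule card_inj_on_le)
  moreover have "card Y = fact s * ((n div m) choose s)" unfolding Y_def by (subst card_injections) auto
  ultimately show ?thesis unfolding A_def[symmetric] by (simp add: card_cartesian_product)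
qed

lemma falling_factorial_ratio_limit:
  "(\<lambda>n. fact s * real (n choose s) / real n ^ s) \<longlonglongrightarrow> 1"
proof -
  have "(\<lambda>n. \<Prod>i = 0..<s. 1 - real i / real n) \<longlonglongrightarrow> (\<Prod>i = 0..<s. 1 - 0)"
    by (intro tendsto_prod tendsto_diff tendsto_const lim_const_over_n)
  moreover have "\<forall>\<^sub>F n in sequentially.
      (\<Prod>i = 0..<s. 1 - real i / real n) = fact s * real (n choose s) / real n ^ s"
  proof (rule eventually_sequentiallyI)
    fix n :: nat assume "1 \<le> n"
    then have "(\<Prod>i = 0..<s. 1 - real i / real n) = (\<Prod>i = 0..<s. (real n - real i) / real n)"
      by (intro prod.cong) (auto simp: field_simps)
    also have "\<dots> = (\<Prod>i = 0..<s. real n - real i) / real n ^ s" by (simp add: prod_dividef)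
    finally show "(\<Prod>i = 0..<s. 1 - real i / real n) = fact s * real (n choose s) / real n ^ s"
      by (simp add: gbinomial_mult_fact[symmetric] binomial_gbinomial)
  qed
  ultimately show ?thesis by (simp add: tendsto_cong)
qed

lemma div_ratio_limit:
  assumes m: "0 < m"
  shows "(\<lambda>n. real (n div m) / real n) \<longlonglongrightarrow> 1 / real m"
proof (rule tendsto_sandwich)
  show "(\<lambda>n. 1 / real m - 1 / real n) \<longlonglongrightarrow> 1 / real m"
    using tendsto_diff[OF tendsto_const lim_const_over_n[of 1]] by simp
  have d: "real n = real m * real (n div m) + real (n mod m)" for n
    by (metis mult_div_mod_eq of_nat_add of_nat_mult)
  show "\<forall>\<^sub>F n in sequentially. 1 / real m - 1 / real n \<le> real (n div m) / real n"
  proof (rule eventually_sequentiallyI)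
    fix n :: nat assume "1 \<le> n"
    then have n: "0 < real n" by simp
    have "real (n mod m) \<le> real m" using m by (simp add: less_imp_le)
    then have "real n - real m \<le> real m * real (n div m)" using d[of n] by simp
    then have "(real n - real m) / (real m * real n) \<le> real m * real (n div m) / (real m * real n)"
      by (rule divide_right_mono) simp
    then show "1 / real m - 1 / real n \<le> real (n div m) / real n"
      using n m by (simp add: diff_divide_distrib)
  qed
  show "\<forall>\<^sub>F n in sequentially. real (n div m) / real n \<le> 1 / real m"
  proof (rule eventually_sequentiallyI)
    fix n :: nat assume "1 \<le> n"
    then have n: "0 < real n" by simp
    have "real m * real (n div m) \<le> real n" using d[of n] by simp
    then show "real (n div m) / real n \<le> 1 / real m"
      using n m by (simp add: field_simps)
  qed
qed simp

lemma balanced_host_ratio_limit: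
  assumes m: "0 < m"
  shows "(\<lambda>n. real ((n div m) choose s) / real (n choose s)) \<longlonglongrightarrow> (1 / real m) ^ s"
proof -
  define \<phi> where "\<phi> n = fact s * real (n choose s) / real n ^ s" for n :: nat
  have \<phi>: "\<phi> \<longlonglongrightarrow> 1" unfolding \<phi>_def by (rule falling_factorial_ratio_limit)
  have "(\<lambda>n. \<phi> (n div m)) \<longlonglongrightarrow> 1"
    using filterlim_compose[OF \<phi> filterlim_at_top_div_const_nat[OF m]] .
  then have "(\<lambda>n. \<phi> (n div m) * (real (n div m) / real n) ^ s / \<phi> n) \<longlonglongrightarrow> 1 * (1 / real m) ^ s / 1"
    by (rule tendsto_divide[OF tendsto_mult[OF _ tendsto_power[OF div_ratio_limit[OF m]]] \<phi>]) simp
  moreover have "\<forall>\<^sub>F n in sequentially. \<phi> (n div m) * (real (n div m) / real n) ^ s / \<phi> n =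
      real ((n div m) choose s) / real (n choose s)"
  proof (rule eventually_sequentiallyI)
    fix n :: nat assume n: "max m s \<le> n"
    then have "0 < n div m" "0 < n" using m by (auto simp: div_greater_zero_iff)
    then show "\<phi> (n div m) * (real (n div m) / real n) ^ s / \<phi> n =
        real ((n div m) choose s) / real (n choose s)"
      unfolding \<phi>_def by (simp add: power_divide field_simps)
  qed
  ultimately show ?thesis by (simp add: tendsto_cong)
qed

text \<open>
  Upper and lower bounds with the same limit enclose the maximum, which yields the existence of the
  limit together with its value.
\<close>

lemma max_density_tendsto:
  fixes Q :: "nat pair_pre_digraph \<Rightarrow> bool" and L :: "nat \<Rightarrow> real"
  assumes upper: "\<And>G n. pair_graph G \<Longrightarrow> card (pverts G) = n \<Longrightarrow> Q G \<Longrightarrow> 0 < n \<Longrightarrow> s \<le> n \<Longrightarrow>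
      induced_density F G \<le> B * (real n ^ s / (fact s * real (n choose s)))"
    and lower: "\<And>n. \<exists>G. pair_graph G \<and> card (pverts G) = n \<and> Q G \<and> L n \<le> induced_density F G"
    and L: "L \<longlonglongrightarrow> B"
  shows "(\<lambda>n. Max {induced_density F G | G :: nat pair_pre_digraph.
      pair_graph G \<and> card (pverts G) = n \<and> Q G}) \<longlonglongrightarrow> B"
proof -
  define S where "S n = {induced_density F G | G :: nat pair_pre_digraph.
      pair_graph G \<and> card (pverts G) = n \<and> Q G}" for n
  have fin: "finite (S n)" for n
  proof (rule finite_subset)
    show "S n \<subseteq> (\<lambda>c. real c / real (n choose card (pverts F))) ` {..2 ^ n}"
    proof
      fix x assume "x \<in> S n"
      then obtain G :: "nat pair_pre_digraph" where G: "pair_graph G" "card (pverts G) = n"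
        "x = induced_density F G" unfolding S_def by blast
      interpret pair_graph G by fact
      have "induced_copies F G \<le> card (Pow (pverts G))"
        unfolding induced_copies_def using pair_finite_verts by (intro card_mono) auto
      also have "\<dots> = 2 ^ n" using G(2) by (simp add: card_Pow pair_finite_verts)
      finally show "x \<in> (\<lambda>c. real c / real (n choose card (pverts F))) ` {..2 ^ n}"
        using G unfolding induced_density_def by auto
    qed
  qed simp
  have ne: "S n \<noteq> {}" for n using lower[of n] unfolding S_def by blast
  have "(\<lambda>n. Max (S n)) \<longlonglongrightarrow> B"
  proof (rule tendsto_sandwich[OF _ _ L])
    show "\<forall>\<^sub>F n in sequentially. L n \<le> Max (S n)"
    proof (rule always_eventually, rule allI)
      fix n
      obtain G where "pair_graph G" "card (pverts G) = n" "Q G" and L: "L n \<le> induced_density F G"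
        using lower by blast
      then have "induced_density F G \<le> Max (S n)" using fin by (intro Max_ge) (auto simp: S_def)
      then show "L n \<le> Max (S n)" using L by simp
    qed
    have "(\<lambda>n. B * (1 / (fact s * real (n choose s) / real n ^ s))) \<longlonglongrightarrow> B * (1 / 1)"
      by (intro tendsto_intros falling_factorial_ratio_limit) simp
    then show "(\<lambda>n. B * (real n ^ s / (fact s * real (n choose s)))) \<longlonglongrightarrow> B" by simp
    show "\<forall>\<^sub>F n in sequentially. Max (S n) \<le> B * (real n ^ s / (fact s * real (n choose s)))"
    proof (rule eventually_sequentiallyI)
      fix n assume "max 1 s \<le> n"
      then show "Max (S n) \<le> B * (real n ^ s / (fact s * real (n choose s)))"
        using fin ne upper by (subst Max_le_iff) (auto simp: S_def)
    qed
  qed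
  then show ?thesis unfolding S_def .
qed

lemma induced_density_balanced_host_ge:
  assumes F: "is_turan_graph s r F" and s: "s = p * r + q" "q < r" "0 < p" and m: "0 < m"
  shows "multinomial_factor p (r - q) q * power_poly p (r - q) q (replicate m (1 / real m)) * real m ^ s *
      (real ((n div m) choose s) / real (n choose s)) \<le> induced_density F (balanced_host m n)"
proof -
  define A where "A = {c \<in> {..<s} \<rightarrow>\<^sub>E {..<m}. class_shape p (r - q) q {..<s} c}"
  have "p * (r - q) + Suc p * q = p * ((r - q) + q) + q" by (simp only: distrib_left) simp
  then have sab: "card {..<s} = p * (r - q) + Suc p * q" using s by simp
  have finE: "finite ({..<s} \<rightarrow>\<^sub>E {..<m})" by (intro finite_PiE) auto
  have count: "(\<Sum>f\<in>{..<s} \<rightarrow>\<^sub>E set [0..<m]. of_bool (class_shape p (r - q) q {..<s} f) * (\<Prod>x\<in>{..<s}. 1 / real m)) =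
      real (card A) * (1 / real m) ^ s"
    unfolding A_def using finE
    by (simp add: sum_distrib_right[symmetric] Int_def lessThan_atLeast0 del: power_one_over)
  have density: "(\<Sum>f\<in>{..<s} \<rightarrow>\<^sub>E set [0..<m]. of_bool (class_shape p (r - q) q {..<s} f) * (\<Prod>x\<in>{..<s}. 1 / real m)) =
      multinomial_factor p (r - q) q * power_poly p (r - q) q (replicate m (1 / real m))"
    using sum_colorings_of_shape[of "{..<s}" "[0..<m]" p "r - q" q "\<lambda>_. 1 / real m"] s(3) sab
    by (simp add: map_replicate_const)
  have A: "multinomial_factor p (r - q) q * power_poly p (r - q) q (replicate m (1 / real m)) * real m ^ s
      = real (card A)"
    unfolding density[symmetric] count using m by (simp add: power_divide)
  have "real (card A * (fact s * ((n div m) choose s))) \<le> real (fact s * induced_copies F (balanced_host m n))"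
    unfolding A_def induced_copies_embeddings[OF F s(1,2) pair_graph_balanced_host]
    using card_embeddings_balanced_host[OF m] by (simp only: of_nat_le_iff)
  then have "fact s * (real (card A) * real ((n div m) choose s)) \<le>
      fact s * real (induced_copies F (balanced_host m n))" by (simp add: mult_ac)
  then have "real (card A) * real ((n div m) choose s) \<le> real (induced_copies F (balanced_host m n))"
    by (simp only: mult_le_cancel_left_pos[OF fact_gt_zero])
  then have "real (card A) * real ((n div m) choose s) / real (n choose s) \<le>
      real (induced_copies F (balanced_host m n)) / real (n choose s)"
    by (rule divide_right_mono) simp
  moreover have "card (pverts F) = s" using F by (simp add: is_turan_graph_def)
  moreover have "card (pverts (balanced_host m n)) = n" by (simp add: balanced_host_def)
  ultimately show ?thesis unfolding A induced_density_def by simp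
qed

section \<open>Densities in complete multipartite graphons\<close>

lemma sum_list_take_bounds:
  fixes xs :: "real list"
  assumes "\<And>x. x \<in> set xs \<Longrightarrow> 0 < x" "i \<le> j"
  shows "sum_list (take i xs) \<le> sum_list (take j xs)"
proof -
  have "take j xs = take i xs @ take (j - i) (drop i xs)"
    using assms(2) by (metis take_add le_add_diff_inverse)
  moreover have "0 \<le> sum_list (take (j - i) (drop i xs))"
    using assms(1) by (intro sum_list_nonneg) (meson in_set_dropD in_set_takeD less_imp_le)
  ultimately show ?thesis by simp
qed

lemma part_interval_measure:
  assumes xs: "part_lengths xs" and i: "i < length xs"
  shows "part_interval xs i \<subseteq> {0..1}" "part_interval xs i \<in> sets lborel"
    "measure lborel (part_interval xs i) = xs ! i"
proof -
  have pos: "\<And>x. x \<in> set xs \<Longrightarrow> 0 < x" and sum: "sum_list xs = 1"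
    using xs by (auto simp: part_lengths_def)
  have lo: "0 \<le> sum_list (take i xs)" using sum_list_take_bounds[where xs = xs and i = 0 and j = i] pos by simp
  have hi: "sum_list (take (Suc i) xs) \<le> 1"
    using sum_list_take_bounds[where xs = xs and i = "Suc i" and j = "length xs"] pos i sum by simp
  have step: "sum_list (take (Suc i) xs) = sum_list (take i xs) + xs ! i"
    using i by (simp add: take_Suc_conv_app_nth)
  have xi: "0 < xs ! i" using pos i by simp
  show "part_interval xs i \<subseteq> {0..1}" using lo hi unfolding part_interval_def by auto
  show "part_interval xs i \<in> sets lborel" unfolding part_interval_def by simp
  show "measure lborel (part_interval xs i) = xs ! i"
  proof -
    define a where "a = sum_list (take i xs)"
    define b where "b = sum_list (take (Suc i) xs)"
    have "b - a = xs ! i" "a \<le> b" using step xi unfolding a_def b_def by auto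
    then show ?thesis unfolding part_interval_def a_def[symmetric] b_def[symmetric] by simp
  qed
qed

lemma part_interval_disjoint:
  assumes xs: "part_lengths xs" and ij: "i < length xs" "j < length xs" "i \<noteq> j"
  shows "part_interval xs i \<inter> part_interval xs j = {}"
proof -
  have pos: "\<And>x. x \<in> set xs \<Longrightarrow> 0 < x" using xs by (auto simp: part_lengths_def)
  have aux: "part_interval xs i \<inter> part_interval xs j = {}" if "i < j" "j < length xs" for i j
  proof -
    have "sum_list (take (Suc i) xs) \<le> sum_list (take j xs)"
      using that by (intro sum_list_take_bounds[OF pos]) auto
    then show ?thesis using that unfolding part_interval_def by auto
  qed
  show ?thesis
  proof (cases "i < j")
    case True
    then show ?thesis using aux ij by blast
  next
    case False
    then have "j < i" using ij by simp
    then show ?thesis using aux[of j i] ij by blast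
  qed
qed

text \<open>
  The sample points are colored by the part that contains them, and the density is a sum over
  colorings of the volumes of boxes. Points outside the unit interval, which are isolated in the graphon,
  get the additional color \<open>m\<close>, so that the boxes cover the whole product space; the boxes in which
  this color occurs have measure \<open>0\<close>.
\<close>

theorem multipartite_graphon_density:
  assumes F: "is_turan_graph s r F" and s: "s = p * r + q" "q < r" "0 < p"
    and xs: "part_lengths xs"
  shows "graphon_density F (multipartite_graphon xs) =
    multinomial_factor p (r - q) q * power_poly p (r - q) q xs"
proof -
  define m where "m = length xs"
  define U where "U = uniform_measure lborel {0..1 :: real}"
  define J where "J i = (if i < m then part_interval xs i else - (\<Union>i<m. part_interval xs i))" for i
  define R where "R i j \<longleftrightarrow> i \<noteq> j \<and> i < m \<and> j < m" for i j
  define P where "P = PiM {..<s} (\<lambda>_. U)"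
  define good where "good c \<longleftrightarrow> turan_relation p (r - q) q {..<s} (\<lambda>a b. R (c a) (c b))" for c
  define colorings where "colorings = {c \<in> {..<s} \<rightarrow>\<^sub>E {..m}. good c}"
  define box where "box c = PiE {..<s} (\<lambda>a. J (c a))" for c
  have setsU: "sets U = sets borel" "space U = UNIV" unfolding U_def by auto
  interpret U: prob_space U unfolding U_def by (rule prob_space_uniform_measure) auto
  interpret prod: finite_product_prob_space "\<lambda>_. U" "{..<s}" by unfold_locales auto
  have Jsets: "J i \<in> sets U" for i
  proof -
    have sets: "part_interval xs k \<in> sets borel" if "k < m" for k
      using part_interval_measure(2)[OF xs] that unfolding m_def by simp
    then have "(\<Union>k<m. part_interval xs k) \<in> sets borel" by (intro sets.finite_UN) auto
    then have "- (\<Union>k<m. part_interval xs k) \<in> sets borel" by (rule borel_comp)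
    then show ?thesis using sets unfolding setsU J_def by simp
  qed
  have mI: "measure U (J i) = xs ! i" if "i < m" for i
  proof -
    have "measure U (part_interval xs i) =
        measure lborel ({0..1} \<inter> part_interval xs i) / measure lborel {0..1 :: real}"
      unfolding U_def using part_interval_measure(2)[OF xs] that
      by (intro measure_uniform_measure) (auto simp: m_def)
    moreover have "{0..1} \<inter> part_interval xs i = part_interval xs i"
      using part_interval_measure(1)[OF xs] that unfolding m_def by blast
    ultimately show ?thesis
      using part_interval_measure(3)[OF xs] that unfolding J_def m_def by simp
  qed
  have Jdisj: "J i \<inter> J j = {}" if "i \<le> m" "j \<le> m" "i \<noteq> j" for i j
    using that part_interval_disjoint[OF xs, of i j] unfolding J_def m_def by auto
  have Jcover: "\<exists>i\<le>m. y \<in> J i" for y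
  proof (cases "\<exists>i<m. y \<in> part_interval xs i")
    case True
    then show ?thesis unfolding J_def by (metis less_imp_le)
  next
    case False
    then have "y \<in> J m" unfolding J_def by auto
    then show ?thesis by blast
  qed
  have mJm: "measure U (J m) = 0"
  proof -
    have "measure U (\<Union>i<m. J i) = (\<Sum>i<m. measure U (J i))"
      using Jsets Jdisj by (intro U.finite_measure_finite_Union) (auto simp: disjoint_family_on_def)
    also have "\<dots> = (\<Sum>i<m. xs ! i)" using mI by simp
    also have "\<dots> = sum_list xs" unfolding m_def by (simp add: sum_list_sum_nth atLeast0LessThan)
    also have "\<dots> = 1" using xs by (simp add: part_lengths_def)
    finally have "measure U (\<Union>i<m. J i) = 1" .
    moreover have "J m = space U - (\<Union>i<m. J i)" unfolding J_def setsU by auto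
    moreover have "(\<Union>i<m. J i) \<in> sets U" using Jsets by (intro sets.finite_UN) auto
    ultimately show ?thesis using U.prob_compl by simp
  qed
  have W: "multipartite_graphon xs u v = 1 \<longleftrightarrow> R i j"
    if "i \<le> m" "j \<le> m" "u \<in> J i" "v \<in> J j" for u v i j
  proof -
    have idx: "u \<in> part_interval xs k \<longleftrightarrow> k = i" if "k < m" for k
      using Jdisj[of k i] \<open>u \<in> J i\<close> \<open>i \<le> m\<close> that unfolding J_def by (auto split: if_splits)
    have jdx: "v \<in> part_interval xs k \<longleftrightarrow> k = j" if "k < m" for k
      using Jdisj[of k j] \<open>v \<in> J j\<close> \<open>j \<le> m\<close> that unfolding J_def by (auto split: if_splits)
    show ?thesis unfolding multipartite_graphon_def R_def m_def[symmetric]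
      using idx jdx by auto
  qed
  have event: "digraph_iso (with_proj F) (with_proj (sampled_graph (multipartite_graphon xs) s x)) \<longleftrightarrow> good c"
    if c: "c \<in> {..<s} \<rightarrow>\<^sub>E {..m}" and x: "x \<in> box c" for x c
  proof -
    let ?H = "sampled_graph (multipartite_graphon xs) s x"
    have cm: "c a \<le> m" "x a \<in> J (c a)" if "a < s" for a
      using c x that unfolding box_def by auto
    have arcs: "(a, b) \<in> parcs ?H \<longleftrightarrow> a < s \<and> b < s \<and> R (c a) (c b)" for a b
    proof -
      have "multipartite_graphon xs (x a) (x b) = 1 \<longleftrightarrow> R (c a) (c b)" if "a < s" "b < s"
        using W[OF cm(1) cm(1) cm(2) cm(2)] that by blast
      moreover have "a \<noteq> b" if "R (c a) (c b)" using that unfolding R_def by auto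
      ultimately show ?thesis unfolding sampled_graph_def by auto
    qed
    have "pair_graph ?H"
    proof
      show "finite (parcs ?H)" by (rule finite_subset[of _ "{..<s} \<times> {..<s}"]) (auto simp: arcs)
      show "symmetric (with_proj ?H)" unfolding symmetric_def sym_def by (auto simp: arcs R_def)
    qed (auto simp: arcs sampled_graph_def)
    from turan_graph_iso_iff[OF F s(1,2) this]
    have "digraph_iso (with_proj F) (with_proj ?H) \<longleftrightarrow>
        turan_relation p (r - q) q {..<s} (\<lambda>a b. (a, b) \<in> parcs ?H)"
      by (simp add: sampled_graph_def)
    also have "\<dots> \<longleftrightarrow> good c" unfolding good_def by (rule turan_relation_cong) (simp add: arcs)
    finally show ?thesis .
  qed
  have cover: "\<exists>c\<in>{..<s} \<rightarrow>\<^sub>E {..m}. x \<in> box c" if x: "x \<in> space P" for x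
  proof -
    have "\<forall>a. \<exists>i. i \<le> m \<and> x a \<in> J i" using Jcover by blast
    from choice[OF this] obtain d where d: "\<And>a. d a \<le> m \<and> x a \<in> J (d a)" by blast
    have "restrict d {..<s} \<in> {..<s} \<rightarrow>\<^sub>E {..m}" using d by auto
    moreover have "x \<in> box (restrict d {..<s})"
      using x d unfolding box_def P_def by (auto simp: space_PiM PiE_iff)
    ultimately show ?thesis by blast
  qed
  have boxspace: "box c \<subseteq> space P" for c
    unfolding box_def P_def space_PiM setsU by auto
  have "{x \<in> space P. digraph_iso (with_proj F) (with_proj (sampled_graph (multipartite_graphon xs) s x))} =
      (\<Union>c\<in>colorings. box c)"
  proof (intro equalityI subsetI)
    fix x assume x: "x \<in> {x \<in> space P. digraph_iso (with_proj F)
        (with_proj (sampled_graph (multipartite_graphon xs) s x))}"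
    then obtain c where "c \<in> {..<s} \<rightarrow>\<^sub>E {..m}" "x \<in> box c" using cover by blast
    then show "x \<in> (\<Union>c\<in>colorings. box c)" using event x unfolding colorings_def by blast
  next
    fix x assume "x \<in> (\<Union>c\<in>colorings. box c)"
    then obtain c where c: "c \<in> {..<s} \<rightarrow>\<^sub>E {..m}" "good c" "x \<in> box c" unfolding colorings_def by blast
    then show "x \<in> {x \<in> space P. digraph_iso (with_proj F)
        (with_proj (sampled_graph (multipartite_graphon xs) s x))}"
      using event[OF c(1,3)] boxspace by blast
  qed
  then have "graphon_density F (multipartite_graphon xs) = measure P (\<Union>c\<in>colorings. box c)"
    using F unfolding graphon_density_def is_turan_graph_def by (simp add: P_def U_def Let_def)
  also have "\<dots> = (\<Sum>c\<in>colorings. measure P (box c))"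
    unfolding P_def
  proof (rule prod.finite_measure_finite_Union)
    have "finite ({..<s} \<rightarrow>\<^sub>E {..m})" by (intro finite_PiE) auto
    then show "finite colorings" unfolding colorings_def by simp
    show "box ` colorings \<subseteq> sets (PiM {..<s} (\<lambda>_. U))"
      unfolding box_def using Jsets by (auto intro!: sets_PiM_I_finite)
    show "disjoint_family_on box colorings"
      unfolding disjoint_family_on_def
    proof (intro ballI impI, rule ccontr)
      fix c d assume cd: "c \<in> colorings" "d \<in> colorings" "c \<noteq> d" "box c \<inter> box d \<noteq> {}"
      then obtain x where x: "x \<in> box c" "x \<in> box d" by blast
      have "c a = d a" if a: "a \<in> {..<s}" for a
      proof -
        have "x a \<in> J (c a) \<inter> J (d a)" "c a \<le> m" "d a \<le> m"
          using x a cd(1,2) unfolding box_def colorings_def by auto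
        then show ?thesis using Jdisj[of "c a" "d a"] by blast
      qed
      moreover have "c \<in> {..<s} \<rightarrow>\<^sub>E {..m}" "d \<in> {..<s} \<rightarrow>\<^sub>E {..m}"
        using cd unfolding colorings_def by auto
      ultimately show False using cd(3) PiE_ext by blast
    qed
  qed
  also have "\<dots> = (\<Sum>c\<in>colorings. \<Prod>a\<in>{..<s}. measure U (J (c a)))"
    unfolding P_def box_def using Jsets by (intro sum.cong refl prod.prob_times) auto
  also have "\<dots> = (\<Sum>c\<in>{..<s} \<rightarrow>\<^sub>E {..m}. of_bool (good c) * (\<Prod>a\<in>{..<s}. measure U (J (c a))))"
  proof -
    have "finite ({..<s} \<rightarrow>\<^sub>E {..m})" by (intro finite_PiE) auto
    then show ?thesis unfolding colorings_def by (simp add: Int_def)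
  qed
  also have "\<dots> = pattern_weight p (r - q) q {..<s} R {..<m} (\<lambda>i. measure U (J i))"
    unfolding pattern_weight_def good_def[symmetric]
  proof (rule sum.mono_neutral_right)
    show "finite ({..<s} \<rightarrow>\<^sub>E {..m})" by (intro finite_PiE) auto
    show "{..<s} \<rightarrow>\<^sub>E {..<m} \<subseteq> {..<s} \<rightarrow>\<^sub>E {..m}" by (rule PiE_mono) auto
    show "\<forall>c\<in>({..<s} \<rightarrow>\<^sub>E {..m}) - ({..<s} \<rightarrow>\<^sub>E {..<m}).
        of_bool (good c) * (\<Prod>a\<in>{..<s}. measure U (J (c a))) = 0"
    proof
      fix c assume c: "c \<in> ({..<s} \<rightarrow>\<^sub>E {..m}) - ({..<s} \<rightarrow>\<^sub>E {..<m})"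
      then obtain a where a: "a < s" "\<not> c a < m" by (auto simp: PiE_iff)
      moreover have "c a \<le> m" using c a(1) by auto
      ultimately have "c a = m" by simp
      then have "measure U (J (c a)) = 0" using mJm by simp
      then have "(\<Prod>a\<in>{..<s}. measure U (J (c a))) = 0" using a by (intro prod_zero) auto
      then show "of_bool (good c) * (\<Prod>a\<in>{..<s}. measure U (J (c a))) = 0" by simp
    qed
  qed
  also have "\<dots> = multinomial_factor p (r - q) q *
      power_poly p (r - q) q (map (\<lambda>i. measure U (J i)) [0..<m])"
  proof -
    have "p * (r - q) + Suc p * q = p * ((r - q) + q) + q" by (simp only: distrib_left) simp
    then have "card {..<s} = p * (r - q) + Suc p * q" using s by simp
    then show ?thesis
      using pattern_weight_complete[of "{..<s}" "[0..<m]" p "r - q" q R "\<lambda>i. measure U (J i)"] s(3)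
      by (simp add: R_def lessThan_atLeast0)
  qed
  also have "map (\<lambda>i. measure U (J i)) [0..<m] = xs"
    using mI unfolding m_def by (intro nth_equalityI) auto
  finally show ?thesis .
qed

section \<open>The best complete multipartite graphon\<close>

definition multipartite_density :: "nat \<Rightarrow> nat \<Rightarrow> nat \<Rightarrow> real list \<Rightarrow> real" where
  "multipartite_density p r q xs = multinomial_factor p (r - q) q * power_poly p (r - q) q xs"

definition uniform_parts :: "nat \<Rightarrow> real list" where
  "uniform_parts m = replicate m (1 / real m)"

lemma part_lengths_uniform: "0 < m \<Longrightarrow> part_lengths (uniform_parts m)"
  unfolding part_lengths_def uniform_parts_def by (simp add: sum_list_replicate)

lemma power_poly_uniform:
  assumes s: "s = p * r + q" "q < r"
  shows "power_poly p (r - q) q (uniform_parts m) = real (r choose (r - q)) * uniform_value s r m"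
proof -
  have "p * (r - q) + Suc p * q = p * ((r - q) + q) + q" by (simp only: distrib_left) simp
  then have "p * (r - q) + Suc p * q = s" "r - q + q = r" using s by auto
  then show ?thesis
    unfolding uniform_parts_def power_poly_replicate uniform_value_def by (simp add: power_divide)
qed

lemma multinomial_factor_pos: "0 < multinomial_factor p a b"
  unfolding multinomial_factor_def by simp

lemma multipartite_density_uniform:
  assumes s: "s = p * r + q" "q < r" and m: "r \<le> m"
  shows "multipartite_density p r q (uniform_parts m) = fact m * fact s /
    (fact (m - r) * fact (r - q) * fact q * fact p ^ r * real (p + 1) ^ q * real m ^ s)"
proof -
  have "p * (r - q) + Suc p * q = p * ((r - q) + q) + q" by (simp only: distrib_left) simp
  then have ps: "p * (r - q) + Suc p * q = s" using s by auto
  have "fact (Suc p) ^ q * fact p ^ (r - q) = real (p + 1) ^ q * (fact p ^ (r - q) * fact p ^ q :: real)"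
    by (simp add: power_mult_distrib)
  also have "fact p ^ (r - q) * fact p ^ q = (fact p ^ r :: real)"
    using s(2) by (simp flip: power_add)
  finally have pf: "fact p ^ (r - q) * fact (Suc p) ^ q = real (p + 1) ^ q * (fact p ^ r :: real)"
    by (simp only: mult.commute)
  have rq: "real (r choose (r - q)) = fact r / (fact (r - q) * fact q)"
    using s(2) by (simp add: binomial_fact)
  have mr: "real (m choose r) = fact m / (fact r * fact (m - r))" using m by (simp add: binomial_fact)
  show ?thesis
    unfolding multipartite_density_def power_poly_uniform[OF s] uniform_value_def
      multinomial_factor_def ps pf rq mr
    by (simp add: field_simps)
qed

lemma multipartite_density_eq_0:
  "length xs < r \<Longrightarrow> q < r \<Longrightarrow> multipartite_density p r q xs = 0"
  unfolding multipartite_density_def by (simp add: power_poly_eq_0)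

text \<open>
  The constraint \<open>length xs \<le> l\<close> moves the best number of parts from \<open>t\<close> to \<open>min l t\<close>, since the values at
  uniform points increase up to \<open>t\<close>.
\<close>

lemma multipartite_density_maximum:
  assumes s: "s = p * r + q" "q < r" "0 < p" and r: "2 \<le> r" "r \<le> t" "r \<le> l"
    and peak: "uniform_ratio_sum s (t - 1) < real r" "real r < uniform_ratio_sum s t"
    and xs: "part_lengths xs" "length xs \<le> l"
  shows "multipartite_density p r q xs \<le> multipartite_density p r q (uniform_parts (min l t))"
    and "multipartite_density p r q xs = multipartite_density p r q (uniform_parts (min l t)) \<Longrightarrow>
      xs = uniform_parts (min l t)"
proof -
  define M where "M = power_poly p (r - q) q (uniform_parts (min l t))"
  have s0: "0 < s" using s r by (cases p) auto
  have choose: "0 < real (r choose (r - q))" by simp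
  have M: "0 < M"
    unfolding M_def power_poly_uniform[OF s(1,2)] uniform_value_def using r by simp
  have less: "power_poly p (r - q) q (uniform_parts m) < M" if "0 < m" "m \<le> l" "m \<noteq> min l t" for m
    unfolding M_def power_poly_uniform[OF s(1,2)]
    using uniform_value_less_peak[OF _ r(2) s0 peak r(3) that] r(1) choose by simp
  then have le: "power_poly p (r - q) q (uniform_parts m) \<le> M" if "0 < m" "m \<le> l" for m
    using that unfolding M_def by (cases "m = min l t") (auto intro: less_imp_le)
  have strict: "power_poly p (r - q) q xs < M" if "xs \<noteq> uniform_parts (min l t)"
  proof (cases "xs = uniform_parts (length xs)")
    case True
    have "0 < length xs" using xs by (auto simp: part_lengths_def)
    moreover have "length xs \<noteq> min l t" using True that by metis
    ultimately show ?thesis using less[of "length xs"] xs(2) True by metis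
  next
    case False
    show ?thesis
    proof (rule power_poly_less_max_uniform[where l = l])
      show "power_poly p (r - q) q (replicate m (1 / real m)) \<le> M" if "0 < m" "m \<le> l" for m
        using le[OF that] unfolding uniform_parts_def .
      show "xs \<noteq> replicate (length xs) (1 / real (length xs))"
        using False unfolding uniform_parts_def .
    qed (use s r M xs in \<open>auto simp: part_lengths_def\<close>)
  qed
  then have "power_poly p (r - q) q xs \<le> M"
    unfolding M_def by (cases "xs = uniform_parts (min l t)") (auto intro: less_imp_le)
  then show "multipartite_density p r q xs \<le> multipartite_density p r q (uniform_parts (min l t))"
    using multinomial_factor_pos[of p "r - q" q] unfolding multipartite_density_def M_def by simp
  show "xs = uniform_parts (min l t)"
    if "multipartite_density p r q xs = multipartite_density p r q (uniform_parts (min l t))"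
    using that strict multinomial_factor_pos[of p "r - q" q]
    unfolding multipartite_density_def M_def by (cases "xs = uniform_parts (min l t)") auto
qed

lemma balanced_host_density_limit:
  assumes F: "is_turan_graph s r F" and s: "s = p * r + q" "q < r" "0 < p" and m: "0 < m"
  obtains L where "L \<longlonglongrightarrow> multipartite_density p r q (uniform_parts m)"
    "\<And>n. L n \<le> induced_density F (balanced_host m n)"
proof -
  define L where "L n = multipartite_density p r q (uniform_parts m) * real m ^ s *
      (real ((n div m) choose s) / real (n choose s))" for n
  have "L \<longlonglongrightarrow> multipartite_density p r q (uniform_parts m) * real m ^ s * (1 / real m) ^ s"
    unfolding L_def by (intro tendsto_mult tendsto_const balanced_host_ratio_limit m)
  moreover have "multipartite_density p r q (uniform_parts m) * real m ^ s * (1 / real m) ^ s =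
      multipartite_density p r q (uniform_parts m)"
    using m by (simp add: power_divide)
  moreover have "L n \<le> induced_density F (balanced_host m n)" for n
    using induced_density_balanced_host_ge[OF F s m]
    unfolding L_def multipartite_density_def uniform_parts_def .
  ultimately show ?thesis using that by metis
qed

text \<open>
  Symmetrization bounds the density in every graph without a \<open>k\<close>-clique, and balanced complete
  \<open>m\<close>-partite graphs, which have no \<open>k\<close>-clique for \<open>m < k\<close>, attain the bound asymptotically.
\<close>

lemma inducibility_free_eq:
  assumes F: "is_turan_graph s r F" and s: "s = p * r + q" "q < r" "0 < p" and m: "0 < m" "m < k"
    and bound: "\<And>xs. part_lengths xs \<Longrightarrow> length xs < k \<Longrightarrow>
      multipartite_density p r q xs \<le> multipartite_density p r q (uniform_parts m)"
  shows "inducibility_free k F = multipartite_density p r q (uniform_parts m)"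
proof -
  define B where "B = multipartite_density p r q (uniform_parts m)"
  obtain L where L: "L \<longlonglongrightarrow> B" "\<And>n. L n \<le> induced_density F (balanced_host m n)"
    using balanced_host_density_limit[OF F s m(1)] unfolding B_def by blast
  have "max_induced_density_free k F \<longlonglongrightarrow> B"
    unfolding max_induced_density_free_def[abs_def]
  proof (rule max_density_tendsto[OF _ _ L(1)])
    fix n
    show "\<exists>G :: nat pair_pre_digraph. pair_graph G \<and> card (pverts G) = n \<and> clique_free k G \<and> L n \<le> induced_density F G"
      using L(2) pair_graph_balanced_host clique_free_balanced_host[OF m]
      by (intro exI[of _ "balanced_host m n"]) (simp add: balanced_host_def)
  next
    fix G :: "nat pair_pre_digraph" and n
    assume G: "pair_graph G" "card (pverts G) = n" "clique_free k G" and n: "0 < n" "s \<le> n"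
    show "induced_density F G \<le> B * (real n ^ s / (fact s * real (n choose s)))"
    proof (rule induced_density_le[OF F s G(1,2) n, where l = "k - 1"])
      show "multinomial_factor p (r - q) q * power_poly p (r - q) q xs \<le> B"
        if "sum_list xs = 1" "\<And>x. x \<in> set xs \<Longrightarrow> 0 < x" "length xs \<le> k - 1" for xs
        using bound[of xs] that m unfolding B_def multipartite_density_def part_lengths_def by auto
      show "card C \<le> k - 1" if "C \<subseteq> pverts G"
        "\<And>x y. x \<in> C \<Longrightarrow> y \<in> C \<Longrightarrow> x \<noteq> y \<Longrightarrow> (x, y) \<in> parcs G" for C
        using clique_free_card_le[OF G(1,3) that] .
    qed
  qed
  then show ?thesis unfolding inducibility_free_def B_def by (rule limI)
qed

lemma inducibility_eq:
  assumes F: "is_turan_graph s r F" and s: "s = p * r + q" "q < r" "0 < p" and m: "0 < m"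
    and bound: "\<And>xs. part_lengths xs \<Longrightarrow>
      multipartite_density p r q xs \<le> multipartite_density p r q (uniform_parts m)"
  shows "inducibility F = multipartite_density p r q (uniform_parts m)"
proof -
  define B where "B = multipartite_density p r q (uniform_parts m)"
  obtain L where L: "L \<longlonglongrightarrow> B" "\<And>n. L n \<le> induced_density F (balanced_host m n)"
    using balanced_host_density_limit[OF F s m(1)] unfolding B_def by blast
  have "(\<lambda>n. Max {induced_density F G | G :: nat pair_pre_digraph.
      pair_graph G \<and> card (pverts G) = n \<and> True}) \<longlonglongrightarrow> B"
  proof (rule max_density_tendsto[OF _ _ L(1)])
    fix n
    show "\<exists>G :: nat pair_pre_digraph. pair_graph G \<and> card (pverts G) = n \<and> True \<and> L n \<le> induced_density F G"
      using L(2) pair_graph_balanced_host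
      by (intro exI[of _ "balanced_host m n"]) (simp add: balanced_host_def)
  next
    fix G :: "nat pair_pre_digraph" and n
    assume G: "pair_graph G" "card (pverts G) = n" and n: "0 < n" "s \<le> n"
    show "induced_density F G \<le> B * (real n ^ s / (fact s * real (n choose s)))"
    proof (rule induced_density_le[OF F s G(1,2) n, where l = n])
      show "multinomial_factor p (r - q) q * power_poly p (r - q) q xs \<le> B"
        if "sum_list xs = 1" "\<And>x. x \<in> set xs \<Longrightarrow> 0 < x" for xs
        using bound[of xs] that unfolding B_def multipartite_density_def part_lengths_def by auto
      show "card C \<le> n" if "C \<subseteq> pverts G" for C
      proof -
        have "finite (pverts G)" using G(2) n(1) card_gt_0_iff by blast
        then show ?thesis using that G(2) card_mono by blast
      qed
    qed
  qed
  then have "max_induced_density F \<longlonglongrightarrow> B" unfolding max_induced_density_def[abs_def] by simp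
  then show ?thesis unfolding inducibility_def B_def by (rule limI)
qed

section \<open>The tabulated Turan graphs\<close>

text \<open>
  The two inequalities say in terms of integers that the value at uniform points increases from
  \<open>t - 1\<close> to \<open>t\<close> parts and decreases from \<open>t\<close> to \<open>t + 1\<close> parts (\<open>uniform_ratio_sum_less_iff\<close>).
\<close>

definition table_entry_ok :: "nat \<Rightarrow> nat \<Rightarrow> nat \<Rightarrow> real \<Rightarrow> bool" where
  "table_entry_ok s r t v \<longleftrightarrow> r \<le> t \<and> (t - r) * t ^ (s - 1) < (t - 1) ^ s \<and>
     t ^ s < (t + 1 - r) * (t + 1) ^ (s - 1) \<and>
     v = fact t * fact s /
       (fact (t - r) * fact (r - s mod r) * fact (s mod r) * fact (s div r) ^ r *
        real (s div r + 1) ^ (s mod r) * real t ^ s)"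

lemma turan_table_ok: "\<forall>((s, r), t, v)\<in>set turan_table. table_entry_ok s r t v"
  unfolding turan_table_def list.set Set.ball_simps prod.case
  by (intro conjI TrueI; simp add: table_entry_ok_def fact_numeral)

lemma uniform_ratio_sum_less_iff:
  assumes "r \<le> m + 1" "0 < s"
  shows "uniform_ratio_sum s m < real r \<longleftrightarrow> (m + 1 - r) * (m + 1) ^ (s - 1) < m ^ s"
    and "real r < uniform_ratio_sum s m \<longleftrightarrow> m ^ s < (m + 1 - r) * (m + 1) ^ (s - 1)"
proof -
  have pw: "real (m + 1) ^ s = real (m + 1) * real (m + 1) ^ (s - 1)" using assms by (cases s) auto
  have "(m + 1 - r) * (m + 1) ^ (s - 1) < m ^ s \<longleftrightarrow>
      real (m + 1 - r) * real (m + 1) ^ (s - 1) < real m ^ s"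
    by (metis of_nat_less_iff of_nat_mult of_nat_power)
  also have "\<dots> \<longleftrightarrow> real (m + 1) ^ s - real m ^ s < real r * real (m + 1) ^ (s - 1)"
    unfolding pw using assms by (simp add: of_nat_diff algebra_simps)
  finally show "uniform_ratio_sum s m < real r \<longleftrightarrow> (m + 1 - r) * (m + 1) ^ (s - 1) < m ^ s"
    unfolding uniform_ratio_sum_closed by (simp add: pos_divide_less_eq)
  have "m ^ s < (m + 1 - r) * (m + 1) ^ (s - 1) \<longleftrightarrow>
      real m ^ s < real (m + 1 - r) * real (m + 1) ^ (s - 1)"
    by (metis of_nat_less_iff of_nat_mult of_nat_power)
  also have "\<dots> \<longleftrightarrow> real r * real (m + 1) ^ (s - 1) < real (m + 1) ^ s - real m ^ s"
    unfolding pw using assms by (simp add: of_nat_diff algebra_simps)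
  finally show "real r < uniform_ratio_sum s m \<longleftrightarrow> m ^ s < (m + 1 - r) * (m + 1) ^ (s - 1)"
    unfolding uniform_ratio_sum_closed by (simp add: pos_less_divide_eq)
qed

theorem theorem1p7:
  fixes F :: "'a pair_pre_digraph" and s r p q t :: nat and v :: real
  assumes "2 \<le> r" and "r < s" and "s \<le> 14"
    and "s = p * r + q" and "q < r"
    and "map_of turan_table (s, r) = Some (t, v)"
    and "is_turan_graph s r F"
  shows "inducibility F = v \<and> uniquely_attained F (replicate t (1 / real t)) \<and>
    (\<forall>k\<ge>2.
       (k \<le> r \<longrightarrow> inducibility_free k F = 0) \<and>
       (r < k \<and> k \<le> t \<longrightarrow>
          uniquely_attained_free k F (replicate (k - 1) (1 / real (k - 1))) \<and>
          (let l = k - 1 in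
             inducibility_free k F =
               fact l * fact s /
                 (fact (l - r) * fact (r - q) * fact q * (fact p) ^ r * real (p + 1) ^ q *
                  real l ^ s))) \<and>
       (t < k \<longrightarrow>
          inducibility_free k F = v \<and>
          uniquely_attained_free k F (replicate t (1 / real t))))"
proof -
  have p: "0 < p" using assms(2,4,5) by (cases p) auto
  note s = assms(4,5) p and F = assms(7)
  have sp: "s div r = p" "s mod r = q" "0 < s" using assms(1,4,5) p by auto
  have "((s, r), t, v) \<in> set turan_table" using assms(6) by (rule map_of_SomeD)
  then have entry: "table_entry_ok s r t v" using turan_table_ok by blast
  then have rt: "r \<le> t"
    and v: "v = fact t * fact s / (fact (t - r) * fact (r - q) * fact q * fact p ^ r *
        real (p + 1) ^ q * real t ^ s)"
    unfolding table_entry_ok_def sp by blast+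
  have t: "t - 1 + 1 = t" using rt assms(1) by simp
  have peak: "uniform_ratio_sum s (t - 1) < real r" "real r < uniform_ratio_sum s t"
    using entry uniform_ratio_sum_less_iff[of r "t - 1" s] uniform_ratio_sum_less_iff[of r t s] rt sp t
    unfolding table_entry_ok_def by auto
  define D where "D = multipartite_density p r q"
  have vD: "v = D (uniform_parts t)"
    unfolding D_def v multipartite_density_uniform[OF s(1,2) rt] by simp
  have graphon: "graphon_density F (multipartite_graphon xs) = D xs" if "part_lengths xs" for xs
    unfolding D_def multipartite_density_def by (rule multipartite_graphon_density[OF F s that])
  note maximum = multipartite_density_maximum[OF s assms(1) rt _ peak, folded D_def]
  have all: "D xs \<le> D (uniform_parts t)" "D xs = D (uniform_parts t) \<Longrightarrow> xs = uniform_parts t"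
    if "part_lengths xs" for xs
  proof -
    have m: "min (max t (length xs)) t = t" "r \<le> max t (length xs)" using rt by auto
    show "D xs \<le> D (uniform_parts t)" "D xs = D (uniform_parts t) \<Longrightarrow> xs = uniform_parts t"
      using maximum[OF m(2) that] unfolding m(1) by auto
  qed
  have ind: "inducibility F = D (uniform_parts t)"
    unfolding D_def using rt assms(1) all(1) by (intro inducibility_eq[OF F s]) (auto simp: D_def)
  have unique: "uniquely_attained F (uniform_parts t)"
    unfolding uniquely_attained_def ind
  proof (intro conjI allI impI)
    show parts: "part_lengths (uniform_parts t)" using part_lengths_uniform rt assms(1) by simp
    then show "graphon_density F (multipartite_graphon (uniform_parts t)) = D (uniform_parts t)"
      by (rule graphon)
    fix ys assume "part_lengths ys \<and> graphon_density F (multipartite_graphon ys) = D (uniform_parts t)"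
    then have "ys = uniform_parts t" using all(2)[of ys] graphon[of ys] by simp
    then show "mset ys = mset (uniform_parts t)" by simp
  qed
  have zero: "inducibility_free k F = 0" if k: "2 \<le> k" "k \<le> r" for k
  proof -
    have zero: "D xs = 0" if "length xs < r" for xs
      using that s(2) unfolding D_def by (rule multipartite_density_eq_0)
    have "inducibility_free k F = D (uniform_parts 1)"
      unfolding D_def
    proof (rule inducibility_free_eq[OF F s])
      show "multipartite_density p r q xs \<le> multipartite_density p r q (uniform_parts 1)"
        if "length xs < k" for xs
        using zero[of xs] zero[of "uniform_parts 1"] that k unfolding D_def uniform_parts_def by simp
    qed (use k in auto)
    then show ?thesis using zero[of "uniform_parts 1"] k unfolding uniform_parts_def by simp
  qed
  have free: "uniquely_attained_free k F (uniform_parts (min (k - 1) t)) \<and>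
      inducibility_free k F = D (uniform_parts (min (k - 1) t))" if k: "r < k" for k
  proof -
    define m where "m = min (k - 1) t"
    have m: "0 < m" "m < k" using k rt assms(1) unfolding m_def by auto
    have le: "D xs \<le> D (uniform_parts m)" and eq: "D xs = D (uniform_parts m) \<Longrightarrow> xs = uniform_parts m"
      if "part_lengths xs" "length xs < k" for xs
      using maximum[of "k - 1" xs] that k unfolding m_def by auto
    have i: "inducibility_free k F = D (uniform_parts m)"
      unfolding D_def using le by (intro inducibility_free_eq[OF F s m]) (simp add: D_def)
    have "uniquely_attained_free k F (uniform_parts m)"
      unfolding uniquely_attained_free_def i
    proof (intro conjI allI impI)
      show parts: "part_lengths (uniform_parts m)" using part_lengths_uniform m by simp
      then show "graphon_density F (multipartite_graphon (uniform_parts m)) = D (uniform_parts m)"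
        by (rule graphon)
      show "length (uniform_parts m) < k" using m by (simp add: uniform_parts_def)
      fix ys assume "part_lengths ys \<and> length ys < k \<and>
        graphon_density F (multipartite_graphon ys) = D (uniform_parts m)"
      then have "ys = uniform_parts m" using eq[of ys] graphon[of ys] by simp
      then show "mset ys = mset (uniform_parts m)" by simp
    qed
    with i show ?thesis unfolding m_def by blast
  qed
  have formula: "D (uniform_parts l) = fact l * fact s / (fact (l - r) * fact (r - q) * fact q *
      fact p ^ r * real (p + 1) ^ q * real l ^ s)" if "r \<le> l" for l
    unfolding D_def by (rule multipartite_density_uniform[OF s(1,2) that])
  show ?thesis
    unfolding uniform_parts_def[symmetric] Let_def
  proof (intro conjI allI impI)
    show "inducibility F = v" unfolding ind vD ..
    show "uniquely_attained F (uniform_parts t)" by (rule unique)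
  next
    fix k :: nat assume "2 \<le> k" "k \<le> r"
    then show "inducibility_free k F = 0" by (rule zero)
  next
    fix k assume k: "r < k \<and> k \<le> t"
    then have m: "min (k - 1) t = k - 1" by linarith
    show "uniquely_attained_free k F (uniform_parts (k - 1))" using free[of k] k unfolding m by blast
    show "inducibility_free k F = fact (k - 1) * fact s / (fact (k - 1 - r) * fact (r - q) * fact q *
        fact p ^ r * real (p + 1) ^ q * real (k - 1) ^ s)"
    proof -
      have "r \<le> k - 1" using k by linarith
      moreover have "inducibility_free k F = D (uniform_parts (k - 1))"
        using free[of k] k unfolding m by blast
      ultimately show ?thesis by (simp only: formula)
    qed
  next
    fix k assume k: "t < k"
    then have m: "min (k - 1) t = t" by linarith
    show "inducibility_free k F = v" using free[of k] k rt unfolding m vD by simp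
    show "uniquely_attained_free k F (uniform_parts t)" using free[of k] k rt unfolding m by simp
  qed
qed

end
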